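(* Let $\lambda_d,\lambda_c,\zeta:[0,1]\to\mathbb{R}$ be non-negative, bounded and measurable, with $\zeta$ smooth, $\zeta'(0)=\zeta'(1)=0$ and $\int_0^1\zeta(x)dx=1$. Assume: (i) there exist an orthonormal basis $\{\xi_k\}_{k\ge1}$ of $L^2([0,1])$ and non-negative real numbers $\{\alpha_k\}_{k\ge1}$ such that $\xi_k'(0)=\xi_k'(1)=0$ and $\mathcal{A}\xi_k=\alpha_k\xi_k$ for all $k\ge1$, where $\mathcal{A}:=-\partial_x^2+\lambda_d(x)$, $x\in[0,1]$; (ii) there exists $N_0\ge1$ such that $\Pi_{N_0}\lambda_d=\lambda_d$, where $\Pi_N$ is the orthogonal projection of $L^2([0,1])$ onto the span of $\{\xi_1,\dots,\xi_N\}$. Let $\{\rho_n\}_{n\ge0}$ be a classical solution of the chemical diffusion master equation (stated in the context, together with its initial and Neumann boundary conditions). Then for every $N\ge N_0$ and $t\ge0$, $$\rho_0(t)=\mathbb{E}[u(t,Z)],$$ and for every $n\ge1$ and $(x_1,\dots,x_n)\in[0,1]^n$, $$\Pi_N^{\otimes n}\rho_n(t,x_1,\dots,x_n)=\frac1{n!}\sum_{j_1,\dots,j_n=1}^N\mathbb{E}\left[\left(\partial_{z_{j_1}}\cdots\partial_{z_{j_n}}u\right)(t,Z)\right]\xi_{j_1}(x_1)\cdots\xi_{j_n}(x_n).$$ Here $Z$ is a standard Gaussian vector in $\mathbb{R}^N$, i.e. $\mathbb{E}[g(Z)]=\int_{\mathbb{R}^N}g(z)(2\pi)^{-N/2}e^{-|z|^2/2}dz$,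 and $u:[0,+\infty[\times\mathbb{R}^N\to\mathbb{R}$ is the classical solution, given by the Feynman-Kac formula stated in the context, of $$\partial_tu(t,z)=\sum_{k=1}^N\alpha_k\partial_{z_k}^2u(t,z)+\sum_{k=1}^N(d_k-c_k-\alpha_kz_k)\partial_{z_k}u(t,z)+\left(\sum_{k=1}^Nc_kz_k-\gamma\right)u(t,z),\qquad u(0,z)=\sum_{k=1}^N\zeta_kz_k,$$ for $t\ge0$, $z\in\mathbb{R}^N$.
   Context: Notation: $d_k:=\langle\lambda_d,\xi_k\rangle_{L^2([0,1])}$, $c_k:=\langle\lambda_c,\xi_k\rangle_{L^2([0,1])}$, $\zeta_k:=\langle\zeta,\xi_k\rangle_{L^2([0,1])}$, $\gamma:=\int_0^1\lambda_c(y)dy$. $\Pi_N^{\otimes n}$ is the orthogonal projection of $L^2([0,1]^n)$ onto the span of $\{\xi_{i_1}\otimes\cdots\otimes\xi_{i_n}:1\le i_1,\dots,i_n\le N\}$. Chemical diffusion master equation (unknown: $\rho_0(t)$ and $\rho_n(t,x_1,\dots,x_n)$, $n\ge1$): $$\partial_t\rho_0(t)=\int_0^1\lambda_d(y)\rho_1(t,y)dy-\int_0^1\lambda_c(y)dy\cdot\rho_0(t),\quad t>0,$$ and for $n\ge1$, $t>0$, $(x_1,\dots,x_n)\in\,]0,1[^n$, $$\begin{aligned}\partial_t\rho_n(t,x_1,\dots,x_n)=&\sum_{i=1}^n\partial_{x_i}^2\rho_n(t,x_1,\dots,x_n)+(n+1)\int_0^1\lambda_d(y)\rho_{n+1}(t,x_1,\dots,x_n,y)dy-\sum_{i=1}^n\lambda_d(x_i)\rho_n(t,x_1,\dots,x_n)\\&+\frac1n\sum_{i=1}^n\lambda_c(x_i)\rho_{n-1}(t,x_1,\dots,x_{i-1},x_{i+1},\dots,x_n)-\int_0^1\lambda_c(y)dy\cdot\rho_n(t,x_1,\dots,x_n),\end{aligned}$$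 with $\rho_0(0)=0$; $\rho_1(0,x_1)=\zeta(x_1)$ for $x_1\in[0,1]$; $\rho_n(0,\cdot)=0$ on $[0,1]^n$ for $n>1$; and $\partial_\nu\rho_n(t,x_1,\dots,x_n)=0$ for $n\ge1$, $t\ge0$, $(x_1,\dots,x_n)\in\partial[0,1]^n$, where $\partial_\nu$ is the derivative along the outer normal. The functions $\rho_n$ are of the form $\rho_n(t,x_1,\dots,x_n)=p_n(t,x_1,\dots,x_n)\,\mathbb{P}(N(t)=n)$, where $N(t)$ is the (random) number of particles at time $t$ and $p_n(t,\cdot)$ is the joint probability density of the positions of $n$ indistinguishable particles given $N(t)=n$; thus each $\rho_n(t,\cdot)$ is non-negative and symmetric in $(x_1,\dots,x_n)$, $\int_{[0,1]^n}\rho_n(t,x)dx=\mathbb{P}(N(t)=n)$, and $\rho_0(t)+\sum_{n\ge1}\int_{[0,1]^n}\rho_n(t,x)dx=1$. Classical solution means that the $\rho_n$, their time derivative and their spatial partial derivatives up to second order are continuous and the equations hold pointwise. Feynman-Kac formula for $u$: $$u(t,z)=\mathbb{E}\left[\left(\sum_{i=1}^N\zeta_iZ_i^{z_i}(t)\right)\exp\left\{\int_0^t\left(\sum_{i=1}^Nc_iZ_i^{z_i}(s)-\gamma\right)ds\right\}\right],$$ where $Z_i^{z_i}$ is the unique strong solution of $dZ_i^{z_i}(t)=(d_i-c_i-\alpha_iZ_i^{z_i}(t))dt+\sqrt{2\alpha_i}\,dW_i(t)$, $Z_i^{z_i}(0)=z_i$, with $W_1,\dots,W_N$ independent one-dimensional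 Brownian motions. *)

theory Defs
  imports "HOL-Probability.Probability"
begin

text \<open>
  A point of \<open>\<real>^n\<close> is a function \<open>x :: nat \<Rightarrow> real\<close> with coordinates indexed by \<open>{1..n}\<close> and value
  \<^term>\<open>undefined\<close> elsewhere, as for \<^const>\<open>PiE\<close> and \<^const>\<open>PiM\<close>. The only point for
  \<open>n = 0\<close> is \<open>\<lambda>_. undefined\<close>. Infinite families are indexed from 1 on; index 0 is ignored.
\<close>

abbreviation leb01 :: "real measure" where
  "leb01 \<equiv> lebesgue_on {0..1}"

abbreviation cube_measure :: "nat \<Rightarrow> (nat \<Rightarrow> real) measure" where
  "cube_measure n \<equiv> PiM {1..n} (\<lambda>_. leb01)"

definition closed_cube :: "nat \<Rightarrow> (nat \<Rightarrow> real) set" where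
  "closed_cube n = PiE {1..n} (\<lambda>_. {0..1})"

definition open_cube :: "nat \<Rightarrow> (nat \<Rightarrow> real) set" where
  "open_cube n = PiE {1..n} (\<lambda>_. {0<..<1})"

definition euclid :: "nat \<Rightarrow> (nat \<Rightarrow> real) set" where
  "euclid N = PiE {1..N} (\<lambda>_. UNIV)"

subsection \<open>Bases and projections in \<open>L\<^sup>2\<close>\<close>

definition l2_inner :: "'a measure \<Rightarrow> ('a \<Rightarrow> real) \<Rightarrow> ('a \<Rightarrow> real) \<Rightarrow> real" where
  "l2_inner M f g = (LINT x|M. f x * g x)"

definition square_integrable :: "'a measure \<Rightarrow> ('a \<Rightarrow> real) \<Rightarrow> bool" where
  "square_integrable M f \<longleftrightarrow> f \<in> borel_measurable M \<and> integrable M (\<lambda>x. (f x)\<^sup>2)"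

definition orthonormal_basis :: "'a measure \<Rightarrow> (nat \<Rightarrow> 'a \<Rightarrow> real) \<Rightarrow> bool" where
  "orthonormal_basis M e \<longleftrightarrow>
     (\<forall>k\<ge>1. square_integrable M (e k)) \<and>
     (\<forall>j\<ge>1. \<forall>k\<ge>1. l2_inner M (e j) (e k) = (if j = k then 1 else 0)) \<and>
     (\<forall>f. square_integrable M f \<longrightarrow>
        (\<lambda>N. LINT x|M. (f x - (\<Sum>k=1..N. l2_inner M f (e k) * e k x))\<^sup>2) \<longlonglongrightarrow> 0)"

definition lin_span :: "'i set \<Rightarrow> ('i \<Rightarrow> 'a \<Rightarrow> real) \<Rightarrow> ('a \<Rightarrow> real) set" where
  "lin_span I b = {g. \<exists>a. g = (\<lambda>x. \<Sum>i\<in>I. a i * b i x)}"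

text \<open>
  Orthogonal projection onto the span of a finite family. The description selects the representative
  that is itself a linear combination of the \<open>b i\<close>; it is unique when the \<open>b i\<close> are linearly
  independent in \<open>L\<^sup>2\<close>, so that evaluating the projection at a point makes sense.
\<close>

definition orth_proj :: "'a measure \<Rightarrow> 'i set \<Rightarrow> ('i \<Rightarrow> 'a \<Rightarrow> real) \<Rightarrow> ('a \<Rightarrow> real) \<Rightarrow> 'a \<Rightarrow> real" where
  "orth_proj M I b f =
     (THE g. g \<in> lin_span I b \<and> (\<forall>h\<in>lin_span I b. l2_inner M (\<lambda>x. f x - g x) h = 0))"

definition tensor :: "(nat \<Rightarrow> real \<Rightarrow> real) \<Rightarrow> nat \<Rightarrow> (nat \<Rightarrow> nat) \<Rightarrow> (nat \<Rightarrow> real) \<Rightarrow> real" where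
  "tensor \<xi> n j x = (\<Prod>i=1..n. \<xi> (j i) (x i))"

definition multi_idx :: "nat \<Rightarrow> nat \<Rightarrow> (nat \<Rightarrow> nat) set" where
  "multi_idx N n = PiE {1..n} (\<lambda>_. {1..N})"

definition tensor_proj ::
    "(nat \<Rightarrow> real \<Rightarrow> real) \<Rightarrow> nat \<Rightarrow> nat \<Rightarrow> ((nat \<Rightarrow> real) \<Rightarrow> real) \<Rightarrow> (nat \<Rightarrow> real) \<Rightarrow> real" where
  "tensor_proj \<xi> N n = orth_proj (cube_measure n) (multi_idx N n) (tensor \<xi> n)"

subsection \<open>Data of the problem\<close>

definition nonneg_bounded_measurable :: "(real \<Rightarrow> real) \<Rightarrow> bool" where
  "nonneg_bounded_measurable f \<longleftrightarrow>
     f \<in> borel_measurable leb01 \<and> (\<forall>x\<in>{0..1}. 0 \<le> f x) \<and> (\<exists>B. \<forall>x\<in>{0..1}. f x \<le> B)"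

text \<open>\<open>C\<^sup>\<infinity>\<close> up to the end points, with one-sided derivatives there; \<open>F k\<close> is the k-th derivative.\<close>

definition smooth01 :: "(real \<Rightarrow> real) \<Rightarrow> bool" where
  "smooth01 f \<longleftrightarrow> (\<exists>F. F 0 = f \<and>
     (\<forall>k. \<forall>x\<in>{0..1}. (F k has_real_derivative F (Suc k) x) (at x within {0..1})))"

text \<open>
  \<open>f\<close> satisfies \<open>- f'' + \<lambda>\<^sub>d f = \<alpha> f\<close> in \<open>L\<^sup>2([0,1])\<close> and \<open>f'(0) = f'(1) = 0\<close>. Since \<open>\<lambda>\<^sub>d\<close> is only
  bounded and measurable, \<open>f'\<close> is absolutely continuous and \<open>f''\<close> is its almost everywhere derivative.
\<close>

definition neumann_eigenfunction :: "(real \<Rightarrow> real) \<Rightarrow> real \<Rightarrow> (real \<Rightarrow> real) \<Rightarrow> bool" where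
  "neumann_eigenfunction ld \<alpha> f \<longleftrightarrow> (\<exists>f' f''.
     (\<forall>x\<in>{0..1}. (f has_real_derivative f' x) (at x within {0..1})) \<and>
     integrable leb01 f'' \<and>
     (\<forall>x\<in>{0..1}. f' x = f' 0 + (LINT y|lebesgue_on {0..x}. f'' y)) \<and>
     f' 0 = 0 \<and> f' 1 = 0 \<and>
     (AE x in leb01. - f'' x + ld x * f x = \<alpha> * f x))"

subsection \<open>The chemical diffusion master equation\<close>

definition drop_coord :: "nat \<Rightarrow> nat \<Rightarrow> (nat \<Rightarrow> real) \<Rightarrow> nat \<Rightarrow> real" where
  "drop_coord n i x = (\<lambda>j\<in>{1..n - 1}. if j < i then x j else x (Suc j))"

text \<open>
  The function \<open>\<rho>\<^sub>0(t)\<close> is \<open>\<rho> 0 t (\<lambda>_. undefined)\<close>. The witnesses \<open>\<rho>t n\<close>, \<open>D n i\<close> and \<open>DD n i j\<close> are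
  the time derivative, the first and the second spatial partial derivatives of \<open>\<rho> n\<close>. As the initial
  and boundary conditions are imposed for \<open>t \<ge> 0\<close> and on the whole boundary, \<open>\<rho> n\<close> and \<open>D n i\<close> are
  continuous on the closed domain; the derivatives which only enter the equation are required where
  the equation is. The boundary condition on a face \<open>x\<^sub>i \<in> {0,1}\<close> concerns the derivative in
  direction \<open>i\<close>; at corners it is imposed for every face containing the point.
\<close>

definition cdme_classical_solution ::
    "(real \<Rightarrow> real) \<Rightarrow> (real \<Rightarrow> real) \<Rightarrow> (real \<Rightarrow> real) \<Rightarrow> (nat \<Rightarrow> real \<Rightarrow> (nat \<Rightarrow> real) \<Rightarrow> real) \<Rightarrow> bool" where
  "cdme_classical_solution ld lc \<zeta> \<rho> \<longleftrightarrow> (\<exists>\<rho>t D DD.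
     \<comment> \<open>regularity\<close>
     (\<forall>n. continuous_on ({0..} \<times> closed_cube n) (\<lambda>(t, x). \<rho> n t x)) \<and>
     (\<forall>n. \<forall>t>0. \<forall>x\<in>open_cube n. ((\<lambda>s. \<rho> n s x) has_real_derivative \<rho>t n t x) (at t)) \<and>
     (\<forall>n. continuous_on ({0<..} \<times> open_cube n) (\<lambda>(t, x). \<rho>t n t x)) \<and>
     (\<forall>n. \<forall>i\<in>{1..n}. \<forall>t\<ge>0. \<forall>x\<in>closed_cube n.
        ((\<lambda>s. \<rho> n t (x(i := s))) has_real_derivative D n i t x) (at (x i) within {0..1})) \<and>
     (\<forall>n. \<forall>i\<in>{1..n}. continuous_on ({0..} \<times> closed_cube n) (\<lambda>(t, x). D n i t x)) \<and>
     (\<forall>n. \<forall>i\<in>{1..n}. \<forall>j\<in>{1..n}. \<forall>t>0. \<forall>x\<in>open_cube n.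
        ((\<lambda>s. D n i t (x(j := s))) has_real_derivative DD n i j t x) (at (x j))) \<and>
     (\<forall>n. \<forall>i\<in>{1..n}. \<forall>j\<in>{1..n}.
        continuous_on ({0<..} \<times> open_cube n) (\<lambda>(t, x). DD n i j t x)) \<and>
     \<comment> \<open>equations\<close>
     (\<forall>t>0. \<rho>t 0 t (\<lambda>_. undefined) =
        (LINT y|leb01. ld y * \<rho> 1 t ((\<lambda>_. undefined)(1 := y)))
        - (LINT y|leb01. lc y) * \<rho> 0 t (\<lambda>_. undefined)) \<and>
     (\<forall>n\<ge>1. \<forall>t>0. \<forall>x\<in>open_cube n. \<rho>t n t x =
        (\<Sum>i=1..n. DD n i i t x)
        + real (n + 1) * (LINT y|leb01. ld y * \<rho> (n + 1) t (x(n + 1 := y)))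
        - (\<Sum>i=1..n. ld (x i) * \<rho> n t x)
        + 1 / real n * (\<Sum>i=1..n. lc (x i) * \<rho> (n - 1) t (drop_coord n i x))
        - (LINT y|leb01. lc y) * \<rho> n t x) \<and>
     \<comment> \<open>initial and Neumann boundary conditions\<close>
     \<rho> 0 0 (\<lambda>_. undefined) = 0 \<and>
     (\<forall>x\<in>closed_cube 1. \<rho> 1 0 x = \<zeta> (x 1)) \<and>
     (\<forall>n>1. \<forall>x\<in>closed_cube n. \<rho> n 0 x = 0) \<and>
     (\<forall>n\<ge>1. \<forall>t\<ge>0. \<forall>x\<in>closed_cube n. \<forall>i\<in>{1..n}. x i \<in> {0, 1} \<longrightarrow> D n i t x = 0))"

text \<open>
  \<open>\<rho>\<^sub>n = p\<^sub>n P(N(t) = n)\<close> for the law of finitely many indistinguishable particles. For \<open>n = 0\<close> the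
  measure is the Dirac mass at \<open>\<lambda>_. undefined\<close>, so the first term of the series is \<open>\<rho>\<^sub>0(t)\<close>.
\<close>

definition particle_densities :: "(nat \<Rightarrow> real \<Rightarrow> (nat \<Rightarrow> real) \<Rightarrow> real) \<Rightarrow> bool" where
  "particle_densities \<rho> \<longleftrightarrow> (\<forall>t\<ge>0.
     (\<forall>n. \<forall>x\<in>closed_cube n. 0 \<le> \<rho> n t x) \<and>
     (\<forall>n. \<forall>x\<in>closed_cube n. \<forall>p. p permutes {1..n} \<longrightarrow> \<rho> n t (x \<circ> p) = \<rho> n t x) \<and>
     (\<lambda>n. LINT x|cube_measure n. \<rho> n t x) sums 1)"

subsection \<open>Brownian motion, strong solutions and the Feynman-Kac formula\<close>

definition brownian_motion :: "'w measure \<Rightarrow> (real \<Rightarrow> 'w \<Rightarrow> real) \<Rightarrow> bool" where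
  "brownian_motion M W \<longleftrightarrow>
     (\<forall>t\<ge>0. W t \<in> borel_measurable M) \<and>
     (AE \<omega> in M. W 0 \<omega> = 0) \<and>
     (AE \<omega> in M. continuous_on {0..} (\<lambda>t. W t \<omega>)) \<and>
     (\<forall>s t. 0 \<le> s \<and> s < t \<longrightarrow>
        distributed M lborel (\<lambda>\<omega>. W t \<omega> - W s \<omega>) (normal_density 0 (sqrt (t - s)))) \<and>
     (\<forall>m \<tau>. 0 \<le> \<tau> 0 \<and> (\<forall>k<m. \<tau> k \<le> \<tau> (Suc k)) \<longrightarrow>
        prob_space.indep_vars M (\<lambda>_. borel) (\<lambda>k \<omega>. W (\<tau> (Suc k)) \<omega> - W (\<tau> k) \<omega>) {..<m})"

definition independent_brownian_motions :: "'w measure \<Rightarrow> nat \<Rightarrow> (nat \<Rightarrow> real \<Rightarrow> 'w \<Rightarrow> real) \<Rightarrow> bool" where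
  "independent_brownian_motions M N W \<longleftrightarrow>
     (\<forall>i\<in>{1..N}. brownian_motion M (W i)) \<and>
     prob_space.indep_vars M (\<lambda>_. PiM {0..} (\<lambda>_. borel)) (\<lambda>i \<omega>. \<lambda>t\<in>{0..}. W i t \<omega>) {1..N}"

definition augmented_filtration :: "'w measure \<Rightarrow> (real \<Rightarrow> 'w \<Rightarrow> real) \<Rightarrow> real \<Rightarrow> 'w measure" where
  "augmented_filtration M W t = sigma (space M)
     ({W s -` A \<inter> space M | s A. 0 \<le> s \<and> s \<le> t \<and> A \<in> sets borel} \<union> null_sets M)"

text \<open>
  Strong solution of \<open>dX = b(X) dt + \<sigma> dW\<close>, \<open>X(0) = z\<close>, with constant \<open>\<sigma>\<close>: the stochastic integral
  of a constant is \<open>\<sigma> (W t - W 0)\<close>, and \<open>W 0 = 0\<close> almost surely. All paths are continuous, so that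
  time integrals of the solution are random variables although \<open>M\<close> need not be complete.
\<close>

definition strong_solution ::
    "'w measure \<Rightarrow> (real \<Rightarrow> 'w \<Rightarrow> real) \<Rightarrow> (real \<Rightarrow> real) \<Rightarrow> real \<Rightarrow> real \<Rightarrow> (real \<Rightarrow> 'w \<Rightarrow> real) \<Rightarrow> bool" where
  "strong_solution M W b \<sigma> z X \<longleftrightarrow>
     (\<forall>t\<ge>0. X t \<in> borel_measurable (augmented_filtration M W t)) \<and>
     (\<forall>\<omega>\<in>space M. continuous_on {0..} (\<lambda>t. X t \<omega>)) \<and>
     (AE \<omega> in M. \<forall>t\<ge>0. X t \<omega> = z + (LINT s|lebesgue_on {0..t}. b (X s \<omega>)) + \<sigma> * W t \<omega>)"

text \<open>\<open>X i z\<^sub>i\<close> is the i-th component of the process, started at \<open>z\<^sub>i\<close>.\<close>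

definition feynman_kac ::
    "'w measure \<Rightarrow> nat \<Rightarrow> (nat \<Rightarrow> real \<Rightarrow> real \<Rightarrow> 'w \<Rightarrow> real) \<Rightarrow> (nat \<Rightarrow> real) \<Rightarrow> (nat \<Rightarrow> real) \<Rightarrow> real
       \<Rightarrow> real \<Rightarrow> (nat \<Rightarrow> real) \<Rightarrow> real" where
  "feynman_kac M N X \<zeta>k ck \<gamma> t z =
     (LINT \<omega>|M. (\<Sum>i=1..N. \<zeta>k i * X i (z i) t \<omega>) *
        exp (LINT s|lebesgue_on {0..t}. (\<Sum>i=1..N. ck i * X i (z i) s \<omega>) - \<gamma>))"

subsection \<open>The parabolic equation on \<open>\<real>^N\<close>\<close>

text \<open>\<open>ut\<close>, \<open>D i\<close> and \<open>DD i j\<close> are the time derivative (one-sided at 0) and the first and second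
  spatial partial derivatives of \<open>u\<close>.\<close>

definition ou_classical_solution ::
    "nat \<Rightarrow> (nat \<Rightarrow> real) \<Rightarrow> (nat \<Rightarrow> real) \<Rightarrow> (nat \<Rightarrow> real) \<Rightarrow> (nat \<Rightarrow> real) \<Rightarrow> real
       \<Rightarrow> (real \<Rightarrow> (nat \<Rightarrow> real) \<Rightarrow> real) \<Rightarrow> bool" where
  "ou_classical_solution N \<alpha> dk ck \<zeta>k \<gamma> u \<longleftrightarrow> (\<exists>ut D DD.
     continuous_on ({0..} \<times> euclid N) (\<lambda>(t, z). u t z) \<and>
     (\<forall>t\<ge>0. \<forall>z\<in>euclid N. ((\<lambda>s. u s z) has_real_derivative ut t z) (at t within {0..})) \<and>
     continuous_on ({0..} \<times> euclid N) (\<lambda>(t, z). ut t z) \<and>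
     (\<forall>i\<in>{1..N}. \<forall>t\<ge>0. \<forall>z\<in>euclid N.
        ((\<lambda>s. u t (z(i := s))) has_real_derivative D i t z) (at (z i))) \<and>
     (\<forall>i\<in>{1..N}. continuous_on ({0..} \<times> euclid N) (\<lambda>(t, z). D i t z)) \<and>
     (\<forall>i\<in>{1..N}. \<forall>j\<in>{1..N}. \<forall>t\<ge>0. \<forall>z\<in>euclid N.
        ((\<lambda>s. D i t (z(j := s))) has_real_derivative DD i j t z) (at (z j))) \<and>
     (\<forall>i\<in>{1..N}. \<forall>j\<in>{1..N}. continuous_on ({0..} \<times> euclid N) (\<lambda>(t, z). DD i j t z)) \<and>
     (\<forall>t\<ge>0. \<forall>z\<in>euclid N. ut t z =
        (\<Sum>k=1..N. \<alpha> k * DD k k t z)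
        + (\<Sum>k=1..N. (dk k - ck k - \<alpha> k * z k) * D k t z)
        + ((\<Sum>k=1..N. ck k * z k) - \<gamma>) * u t z) \<and>
     (\<forall>z\<in>euclid N. u 0 z = (\<Sum>k=1..N. \<zeta>k k * z k)))"

definition partial :: "nat \<Rightarrow> ((nat \<Rightarrow> real) \<Rightarrow> real) \<Rightarrow> (nat \<Rightarrow> real) \<Rightarrow> real" where
  "partial j g z = deriv (\<lambda>s. g (z(j := s))) (z j)"

definition partials :: "nat list \<Rightarrow> ((nat \<Rightarrow> real) \<Rightarrow> real) \<Rightarrow> (nat \<Rightarrow> real) \<Rightarrow> real" where
  "partials js g = foldr partial js g"

definition has_all_partials :: "nat \<Rightarrow> ((nat \<Rightarrow> real) \<Rightarrow> real) \<Rightarrow> bool" where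
  "has_all_partials N g \<longleftrightarrow> (\<forall>js. set js \<subseteq> {1..N} \<longrightarrow>
     (\<forall>z\<in>euclid N. \<forall>j\<in>{1..N}. (\<lambda>s. partials js g (z(j := s))) differentiable (at (z j))))"

definition std_gaussian :: "nat \<Rightarrow> (nat \<Rightarrow> real) measure" where
  "std_gaussian N = density (PiM {1..N} (\<lambda>_. lborel))
     (\<lambda>z. (2 * pi) powr (- real N / 2) * exp (- (\<Sum>i=1..N. (z i)\<^sup>2) / 2))"

end

theory Submission
  imports Defs
begin

text \<open>
  Both sides of the claim are computed in closed form. Put \<open>e\<^sub>k = exp (- \<alpha>\<^sub>k t)\<close>, and let \<open>E\<^sub>k\<close>
  and \<open>F\<^sub>k\<close> be its first and second iterated integrals over \<open>[0, t]\<close>.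

  Probabilistic side. The Ornstein--Uhlenbeck equation is solved path by path, which turns
  \<open>\<integral> \<Sum> c\<^sub>k Z\<^sub>k\<close> and \<open>\<Sum> \<zeta>\<^sub>k Z\<^sub>k(t)\<close> into deterministic terms plus Wiener integrals of deterministic
  functions. Hence the pair is Gaussian, and differentiating its Laplace transform yields
  \<open>u = (\<beta> + \<Sum> q\<^sub>k z\<^sub>k) exp (\<Sum> a\<^sub>k z\<^sub>k + \<kappa>)\<close> with \<open>a\<^sub>k = c\<^sub>k E\<^sub>k\<close> and \<open>q\<^sub>k = \<zeta>\<^sub>k e\<^sub>k\<close>
  (\<open>feynman_kac_eq_U\<close>). Functions of this shape are closed under partial derivatives, solve the
  parabolic equation (\<open>U_classical_solution\<close>), and have explicit Gaussian expectations, because the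
  exponential only shifts the Gaussian (\<open>gaussian_partials_coef\<close>).

  Density side. Let the coefficient with indices \<open>j\<^sub>1, \<dots>, j\<^sub>n\<close> be the inner product of \<open>\<rho>\<^sub>n(t)\<close>
  with \<open>\<xi>\<^bsub>j\<^sub>1\<^esub> \<otimes> \<dots> \<otimes> \<xi>\<^bsub>j\<^sub>n\<^esub>\<close>. Testing the master equation against these tensors and integrating
  by parts (the Neumann conditions remove the boundary terms) gives a linear system in which level
  \<open>n\<close> is coupled to the levels \<open>n - 1\<close> and \<open>n + 1\<close> (\<open>density_coef_deriv\<close>). It involves only indices up
  to \<open>N\<close>, since \<open>\<lambda>\<^sub>d\<close> is a combination of \<open>\<xi>\<^sub>1, \<dots>, \<xi>\<^sub>N\<close>. The Gaussian expectations above, divided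
  by \<open>n!\<close>, solve the same system with the same initial values (\<open>coef_deriv\<close>, \<open>coef_0\<close>).

  Uniqueness. The coupling to level \<open>n + 1\<close> carries the unbounded factor \<open>n + 1\<close>, so Gronwall's lemma
  does not apply. But both solutions are bounded by \<open>A C\<^sup>n\<close>: the densities are non-negative with total
  mass one and the eigenfunctions are bounded. Iterating the integrated system on the difference, in
  the manner of Cauchy and Kovalevskaya, then shows that it vanishes on a time step whose length
  depends only on \<open>C\<close> and the data (\<open>coupled_hierarchy_zero\<close>). Thus the coefficients agree, and the
  projection is the sum of the coefficients times the orthonormal tensors.
\<close>

section \<open>Stieltjes sums and integration by parts\<close>

definition grid :: "real \<Rightarrow> real \<Rightarrow> nat \<Rightarrow> nat \<Rightarrow> real" where
  "grid a b n k = a + real k * ((b - a) / real (Suc n))"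

lemma grid_0 [simp]: "grid a b n 0 = a"
  by (simp add: grid_def)

lemma grid_end [simp]: "grid a b n (Suc n) = b"
proof -
  have "real (Suc n) * ((b - a) / real (Suc n)) = b - a"
    by (rule nonzero_mult_div_cancel_left[of "real (Suc n)", unfolded times_divide_eq_right[symmetric]]) simp
  thus ?thesis unfolding grid_def by linarith
qed

lemma grid_step: "grid a b n (Suc k) - grid a b n k = (b - a) / real (Suc n)"
  unfolding grid_def of_nat_Suc[of k] by (simp only: distrib_right mult_1_left)

lemma grid_le_Suc:
  assumes "a \<le> b"
  shows "grid a b n k \<le> grid a b n (Suc k)"
proof -
  have "0 \<le> (b - a) / real (Suc n)" using assms by (intro divide_nonneg_nonneg) auto
  thus ?thesis using grid_step[of a b n k] by linarith
qed

lemma grid_mono: "a \<le> b \<Longrightarrow> j \<le> k \<Longrightarrow> grid a b n j \<le> grid a b n k"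
  using lift_Suc_mono_le[of "grid a b n" j k] grid_le_Suc[of a b n] by blast

lemma grid_bounds:
  assumes "a \<le> b" "k \<le> Suc n"
  shows "a \<le> grid a b n k" "grid a b n k \<le> b"
  using grid_mono[of a b 0 k n] grid_mono[of a b k "Suc n" n] assms by simp_all

lemma integral_grid:
  fixes f :: "real \<Rightarrow> real"
  assumes "a \<le> b" "f integrable_on {a..b}"
  shows "integral {a..b} f = (\<Sum>k\<le>n. integral {grid a b n k..grid a b n (Suc k)} f)"
proof -
  have "k \<le> Suc n \<Longrightarrow> integral {a..grid a b n k} f = (\<Sum>j<k. integral {grid a b n j..grid a b n (Suc j)} f)" for k
  proof (induction k)
    case (Suc k)
    have "f integrable_on {a..grid a b n (Suc k)}"
      using integrable_subinterval_real[OF assms(2)] grid_bounds[of a b "Suc k" n] assms Suc by auto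
    hence "integral {a..grid a b n (Suc k)} f = integral {a..grid a b n k} f
        + integral {grid a b n k..grid a b n (Suc k)} f"
      using Henstock_Kurzweil_Integration.integral_combine[of a "grid a b n k" "grid a b n (Suc k)" f] grid_bounds[of a b k n]
        grid_le_Suc[of a b n k] assms Suc by auto
    thus ?case using Suc by simp
  qed simp
  from this[of "Suc n"] show ?thesis by (simp add: lessThan_Suc_atMost)
qed

text \<open>
  Weighting by the increments of a primitive of \<open>h\<close> covers Riemann sums (\<open>h = 1\<close>) and Stieltjes sums
  against an absolutely continuous function alike. On each cell \<open>w\<close> differs from its sampled value by
  at most its modulus of continuity at the mesh size.
\<close>

lemma weighted_grid_sum_tendsto:
  fixes h w :: "real \<Rightarrow> real"
  assumes ab: "a \<le> b" and h: "h absolutely_integrable_on {a..b}" and w: "continuous_on {a..b} w"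
    and c: "\<And>n k. k \<le> n \<Longrightarrow> c n k \<in> {grid a b n k..grid a b n (Suc k)}"
  shows "(\<lambda>n. \<Sum>k\<le>n. w (c n k) * integral {grid a b n k..grid a b n (Suc k)} h)
    \<longlonglongrightarrow> integral {a..b} (\<lambda>s. w s * h s)"
proof (rule LIMSEQ_I)
  fix r :: real assume r: "0 < r"
  define H where "H = integral {a..b} (\<lambda>s. \<bar>h s\<bar>)"
  have absh: "(\<lambda>s. \<bar>h s\<bar>) integrable_on {a..b}"
    using h by (simp add: absolutely_integrable_on_def)
  have H0: "H \<ge> 0" unfolding H_def by (rule integral_nonneg[OF absh]) auto
  \<comment> \<open>\<open>H + 1\<close> instead of \<open>H\<close>, which may be 0\<close>
  define \<eta> where "\<eta> = r / (H + 1)"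
  have eta: "\<eta> > 0" "\<eta> * H < r" using r H0 by (auto simp: \<eta>_def field_simps)
  have hw: "(\<lambda>s. w s * h s) absolutely_integrable_on {a..b}"
    by (rule absolutely_integrable_bounded_measurable_product_real[OF _ _ _ h])
       (use w in \<open>auto intro!: continuous_imp_measurable_on_sets_lebesgue compact_imp_bounded compact_continuous_image\<close>)
  obtain \<delta> where \<delta>: "\<delta> > 0" "\<And>x y. x \<in> {a..b} \<Longrightarrow> y \<in> {a..b} \<Longrightarrow> dist y x < \<delta> \<Longrightarrow> dist (w y) (w x) < \<eta>"
    using compact_uniformly_continuous[OF w] eta unfolding uniformly_continuous_on_def by (meson compact_Icc)
  obtain n0 :: nat where n0: "(b - a) / \<delta> < real n0" using reals_Archimedean2 by blast
  show "\<exists>n0. \<forall>n\<ge>n0. norm ((\<Sum>k\<le>n. w (c n k) * integral {grid a b n k..grid a b n (Suc k)} h)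
     - integral {a..b} (\<lambda>s. w s * h s)) < r"
  proof (intro exI[of _ n0] allI impI)
    fix n assume n: "n0 \<le> n"
    have "real n0 < real (Suc n)" using n by simp
    hence "(b - a) / \<delta> < real (Suc n)" using n0 by linarith
    hence mesh: "(b - a) / real (Suc n) < \<delta>"
      using \<delta>(1) by (simp add: field_simps)
    let ?I = "\<lambda>k. {grid a b n k..grid a b n (Suc k)}"
    have sub: "?I k \<subseteq> {a..b}" if "k \<le> n" for k
      using grid_bounds[OF ab, of k n] grid_bounds[OF ab, of "Suc k" n] that by auto
    have bound: "\<bar>w (c n k) * integral (?I k) h - integral (?I k) (\<lambda>s. w s * h s)\<bar>
        \<le> \<eta> * integral (?I k) (\<lambda>s. \<bar>h s\<bar>)" if k: "k \<le> n" for k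
    proof -
      have i1: "h integrable_on ?I k" and i2: "(\<lambda>s. w s * h s) integrable_on ?I k"
        and i3: "(\<lambda>s. \<bar>h s\<bar>) integrable_on ?I k"
        using integrable_subinterval_real[OF _ sub[OF k]] h hw absh
        by (auto simp: absolutely_integrable_on_def)
      have i4: "(\<lambda>s. (w (c n k) - w s) * h s) integrable_on ?I k"
        using integrable_diff[OF integrable_on_cmult_left[OF i1, of "w (c n k)"] i2]
        by (simp add: left_diff_distrib)
      have "w (c n k) * integral (?I k) h - integral (?I k) (\<lambda>s. w s * h s)
          = integral (?I k) (\<lambda>s. (w (c n k) - w s) * h s)"
        using integral_diff[OF integrable_on_cmult_left[OF i1, of "w (c n k)"] i2]
        by (simp add: left_diff_distrib)
      also have "norm \<dots> \<le> integral (?I k) (\<lambda>s. \<eta> * \<bar>h s\<bar>)"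
      proof (rule integral_norm_bound_integral[OF i4])
        show "(\<lambda>s. \<eta> * \<bar>h s\<bar>) integrable_on ?I k" using integrable_on_cmult_left[OF i3, of \<eta>] by simp
        fix s assume s: "s \<in> ?I k"
        have "dist (c n k) s \<le> grid a b n (Suc k) - grid a b n k"
          using s c[OF k] by (auto simp: dist_real_def)
        hence "dist (c n k) s < \<delta>" using mesh by (simp add: grid_step)
        hence "dist (w (c n k)) (w s) < \<eta>"
          using \<delta>(2)[of s "c n k"] s c[OF k] sub[OF k] by blast
        hence "\<bar>w (c n k) - w s\<bar> \<le> \<eta>" by (simp add: dist_real_def)
        thus "norm ((w (c n k) - w s) * h s) \<le> \<eta> * \<bar>h s\<bar>"
          by (simp add: abs_mult mult_right_mono)
      qed
      finally show ?thesis by simp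
    qed
    have diff: "(\<Sum>k\<le>n. w (c n k) * integral (?I k) h) - integral {a..b} (\<lambda>s. w s * h s)
       = (\<Sum>k\<le>n. w (c n k) * integral (?I k) h - integral (?I k) (\<lambda>s. w s * h s))"
      using integral_grid[OF ab, of "\<lambda>s. w s * h s" n] hw
      by (simp add: absolutely_integrable_on_def sum_subtractf)
    have "\<bar>(\<Sum>k\<le>n. w (c n k) * integral (?I k) h - integral (?I k) (\<lambda>s. w s * h s))\<bar>
        \<le> (\<Sum>k\<le>n. \<bar>w (c n k) * integral (?I k) h - integral (?I k) (\<lambda>s. w s * h s)\<bar>)"
      by (rule sum_abs)
    also have "\<dots> \<le> (\<Sum>k\<le>n. \<eta> * integral (?I k) (\<lambda>s. \<bar>h s\<bar>))"
      by (rule sum_mono, rule bound, simp)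
    also have "\<dots> = \<eta> * H"
      unfolding H_def using integral_grid[OF ab absh, of n] by (simp add: sum_distrib_left)
    also have "\<dots> < r" by (rule eta)
    finally show "norm ((\<Sum>k\<le>n. w (c n k) * integral (?I k) h)
     - integral {a..b} (\<lambda>s. w s * h s)) < r" unfolding diff real_norm_def .
  qed
qed

text \<open>
  Summation by parts.
\<close>

lemma abel_grid:
  fixes G w :: "real \<Rightarrow> real"
  shows "(\<Sum>k\<le>n. G (grid a b n k) * (w (grid a b n (Suc k)) - w (grid a b n k)))
    = G b * w b - G a * w a - (\<Sum>k\<le>n. w (grid a b n (Suc k)) * (G (grid a b n (Suc k)) - G (grid a b n k)))"
proof -
  have "(\<Sum>k\<le>n. G (grid a b n k) * (w (grid a b n (Suc k)) - w (grid a b n k)))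
     + (\<Sum>k\<le>n. w (grid a b n (Suc k)) * (G (grid a b n (Suc k)) - G (grid a b n k)))
     = (\<Sum>k\<le>n. G (grid a b n (Suc k)) * w (grid a b n (Suc k)) - G (grid a b n k) * w (grid a b n k))"
    by (simp add: sum.distrib[symmetric] algebra_simps)
  also have "\<dots> = G b * w b - G a * w a"
    using sum_lessThan_telescope[of "\<lambda>k. G (grid a b n k) * w (grid a b n k)" "Suc n"]
    by (simp add: lessThan_Suc_atMost)
  finally show ?thesis by simp
qed

text \<open>
  Summation by parts moves the increments from \<open>w\<close> to \<open>G\<close>, so \<open>w\<close> is merely continuous: it will be a
  Brownian path, which makes the limit a pathwise version of the Wiener integral of \<open>G\<close>, or the
  derivative of an eigenfunction.
\<close>

lemma stieltjes_sum_tendsto: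
  fixes G G' w :: "real \<Rightarrow> real"
  assumes ab: "a \<le> b" and w: "continuous_on {a..b} w" and G': "continuous_on {a..b} G'"
    and G: "\<And>s. s \<in> {a..b} \<Longrightarrow> (G has_real_derivative G' s) (at s within {a..b})"
  shows "(\<lambda>n. \<Sum>k\<le>n. G (grid a b n k) * (w (grid a b n (Suc k)) - w (grid a b n k)))
    \<longlonglongrightarrow> G b * w b - G a * w a - integral {a..b} (\<lambda>s. w s * G' s)"
proof -
  have ai: "G' absolutely_integrable_on {a..b}"
    by (rule absolutely_integrable_continuous_real[OF G'])
  have "(\<lambda>n. \<Sum>k\<le>n. w (grid a b n (Suc k)) * integral {grid a b n k..grid a b n (Suc k)} G')
    \<longlonglongrightarrow> integral {a..b} (\<lambda>s. w s * G' s)"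
    by (rule weighted_grid_sum_tendsto[OF ab ai w]) (auto intro: grid_le_Suc[OF ab])
  moreover have "integral {grid a b n k..grid a b n (Suc k)} G' = G (grid a b n (Suc k)) - G (grid a b n k)"
    if "k \<le> n" for n k
  proof (rule integral_unique, rule fundamental_theorem_of_calculus)
    show "grid a b n k \<le> grid a b n (Suc k)" by (rule grid_le_Suc[OF ab])
    fix s assume s: "s \<in> {grid a b n k..grid a b n (Suc k)}"
    have sub: "{grid a b n k..grid a b n (Suc k)} \<subseteq> {a..b}"
      using grid_bounds[OF ab, of k n] grid_bounds[OF ab, of "Suc k" n] that by auto
    show "(G has_vector_derivative G' s) (at s within {grid a b n k..grid a b n (Suc k)})"
      using has_field_derivative_subset[OF G sub] s sub
      by (auto simp: has_real_derivative_iff_has_vector_derivative)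
  qed
  ultimately have "(\<lambda>n. \<Sum>k\<le>n. w (grid a b n (Suc k)) * (G (grid a b n (Suc k)) - G (grid a b n k)))
    \<longlonglongrightarrow> integral {a..b} (\<lambda>s. w s * G' s)"
    by simp
  from tendsto_diff[OF tendsto_const this] show ?thesis unfolding abel_grid .
qed

text \<open>
  The sums of \<open>f\<close> against the increments of \<open>g\<close> have two limits: as sums weighted by integrals of \<open>h\<close>,
  and as Stieltjes sums.
\<close>

lemma integral_by_parts_absolutely_continuous:
  fixes f f' g h :: "real \<Rightarrow> real"
  assumes ab: "a \<le> b" and f': "continuous_on {a..b} f'"
    and f: "\<And>s. s \<in> {a..b} \<Longrightarrow> (f has_real_derivative f' s) (at s within {a..b})"
    and h: "h absolutely_integrable_on {a..b}"
    and g: "\<And>s. s \<in> {a..b} \<Longrightarrow> g s = g a + integral {a..s} h"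
  shows "integral {a..b} (\<lambda>s. f s * h s) = f b * g b - f a * g a - integral {a..b} (\<lambda>s. g s * f' s)"
proof -
  have hi: "h integrable_on {a..b}" using h by (simp add: absolutely_integrable_on_def)
  have gc: "continuous_on {a..b} g"
  proof (rule continuous_on_eq)
    show "continuous_on {a..b} (\<lambda>s. g a + integral {a..s} h)"
      by (intro continuous_on_add continuous_on_const indefinite_integral_continuous_1 hi)
  qed (rule g[symmetric])
  have fc: "continuous_on {a..b} f" by (rule DERIV_continuous_on[OF f])
  have incr: "integral {grid a b n k..grid a b n (Suc k)} h = g (grid a b n (Suc k)) - g (grid a b n k)"
    if "k \<le> n" for n k
  proof -
    have "h integrable_on {a..grid a b n (Suc k)}"
      using integrable_subinterval_real[OF hi] grid_bounds[OF ab, of "Suc k" n] that by auto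
    hence "integral {a..grid a b n k} h + integral {grid a b n k..grid a b n (Suc k)} h
        = integral {a..grid a b n (Suc k)} h"
      using Henstock_Kurzweil_Integration.integral_combine[of a "grid a b n k" "grid a b n (Suc k)" h]
        grid_bounds[OF ab, of k n] grid_le_Suc[OF ab, of n k] that by auto
    moreover have "grid a b n k \<in> {a..b}" "grid a b n (Suc k) \<in> {a..b}"
      using grid_bounds[OF ab, of k n] grid_bounds[OF ab, of "Suc k" n] that by auto
    ultimately show ?thesis using g[of "grid a b n k"] g[of "grid a b n (Suc k)"] by linarith
  qed
  have "(\<lambda>n. \<Sum>k\<le>n. f (grid a b n k) * integral {grid a b n k..grid a b n (Suc k)} h)
    \<longlonglongrightarrow> integral {a..b} (\<lambda>s. f s * h s)"
    by (rule weighted_grid_sum_tendsto[OF ab h fc]) (auto intro: grid_le_Suc[OF ab])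
  hence "(\<lambda>n. \<Sum>k\<le>n. f (grid a b n k) * (g (grid a b n (Suc k)) - g (grid a b n k)))
    \<longlonglongrightarrow> integral {a..b} (\<lambda>s. f s * h s)"
    by (simp add: incr)
  from LIMSEQ_unique[OF this stieltjes_sum_tendsto[OF ab gc f' f]] show ?thesis by simp
qed

section \<open>Uniqueness for hierarchies coupled to the next level\<close>

lemma abs_le_power_of_deriv_bound:
  fixes f f' :: "real \<Rightarrow> real"
  assumes cont: "continuous_on {s..t} f" and f0: "f s = 0" and st: "s \<le> t"
    and d: "\<And>r. s < r \<Longrightarrow> r < t \<Longrightarrow> (f has_real_derivative f' r) (at r)"
    and b: "\<And>r. s < r \<Longrightarrow> r < t \<Longrightarrow> \<bar>f' r\<bar> \<le> B * (real (Suc k) * (r - s) ^ k)"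
  shows "\<bar>f t\<bar> \<le> B * (t - s) ^ Suc k"
proof -
  have *: "f1 t \<le> B * (t - s) ^ Suc k" if c1: "continuous_on {s..t} f1" and "f1 s = 0"
    and d1: "\<And>r. s < r \<Longrightarrow> r < t \<Longrightarrow> (f1 has_real_derivative g r) (at r)"
    and b1: "\<And>r. s < r \<Longrightarrow> r < t \<Longrightarrow> g r \<le> B * (real (Suc k) * (r - s) ^ k)" for f1 g :: "real \<Rightarrow> real"
  proof -
    let ?h = "\<lambda>r. B * (r - s) ^ Suc k - f1 r"
    have "?h s \<le> ?h t"
    proof (rule DERIV_nonneg_imp_increasing_open[OF st])
      fix r assume r: "s < r" "r < t"
      have "(?h has_real_derivative B * (real (Suc k) * (r - s) ^ k) - g r) (at r)"
        by (rule DERIV_cong, rule DERIV_diff[OF DERIV_cmult[OF DERIV_power_Suc[OF DERIV_diff[OF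
              DERIV_ident DERIV_const]]] d1[OF r]]) simp
      thus "\<exists>y. DERIV ?h r :> y \<and> 0 \<le> y" using b1[OF r] by (intro exI conjI) auto
    next
      show "continuous_on {s..t} ?h" by (intro continuous_intros c1)
    qed
    thus ?thesis using \<open>f1 s = 0\<close> by simp
  qed
  have "f t \<le> B * (t - s) ^ Suc k"
    by (rule *[OF cont f0 d]) (use b in \<open>auto simp: abs_le_iff\<close>)
  moreover have "- f t \<le> B * (t - s) ^ Suc k"
    by (rule *[of "\<lambda>r. - f r" "\<lambda>r. - f' r"])
       (use cont f0 b in \<open>auto intro!: continuous_intros DERIV_minus d simp: abs_le_iff\<close>)
  ultimately show ?thesis by (simp add: abs_le_iff)
qed

text \<open>
  Assume after \<open>k\<close> iterations that \<open>\<delta> n\<close> is at most \<open>A C\<^sup>n (K (t - s))\<^sup>k binom(n + k, k)\<close>. Inserting this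
  in the differential inequality and integrating gives the same bound for \<open>k + 1\<close>, because
  \<open>(n + 1) binom(n + 1 + k, k) = (k + 1) binom(n + k + 1, k + 1)\<close>: the division by \<open>k + 1\<close> that comes from
  integrating \<open>(t - s)\<^sup>k\<close> absorbs the unbounded factor \<open>n + 1\<close>. As the binomial coefficient is at most
  \<open>2\<^bsup>n + k\<^esup>\<close>, the bounds tend to 0 while \<open>2 K (t - s) < 1\<close>. The hypothesis \<open>rate\<close> is phrased in terms of
  arbitrary bounds \<open>y\<close> so that it can be fed with those of the previous iteration.
\<close>

lemma coupled_hierarchy_zero_step:
  fixes \<delta> D :: "nat \<Rightarrow> 'i \<Rightarrow> real \<Rightarrow> real" and I :: "nat \<Rightarrow> 'i set"
  assumes A: "0 \<le> A" and C: "0 < C" and L: "0 \<le> L" and s0: "0 \<le> s"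
    and cont: "\<And>n j. j \<in> I n \<Longrightarrow> continuous_on {s..T} (\<delta> n j)"
    and zero: "\<And>n j. j \<in> I n \<Longrightarrow> \<delta> n j s = 0"
    and deriv: "\<And>n j t. j \<in> I n \<Longrightarrow> s < t \<Longrightarrow> t < T \<Longrightarrow> (\<delta> n j has_real_derivative D n j t) (at t)"
    and bound: "\<And>n j t. j \<in> I n \<Longrightarrow> s \<le> t \<Longrightarrow> t \<le> T \<Longrightarrow> \<bar>\<delta> n j t\<bar> \<le> A * C ^ n"
    and rate: "\<And>n j t y. j \<in> I n \<Longrightarrow> s < t \<Longrightarrow> t < T \<Longrightarrow> (\<And>m i. i \<in> I m \<Longrightarrow> \<bar>\<delta> m i t\<bar> \<le> y m) \<Longrightarrow>
       \<bar>D n j t\<bar> \<le> L * (real (Suc n) * (y n + y (Suc n)) + y (n - 1))"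
    and j: "j \<in> I n" and t: "s \<le> t" "t \<le> T" "(t - s) * (4 * L * (2 + C + 1 / C)) < 1"
  shows "\<delta> n j t = 0"
proof -
  define K where "K = L * (2 + C + 1 / C)"
  have K0: "K \<ge> 0" unfolding K_def using L C by (intro mult_nonneg_nonneg) auto
  define y where "y = (\<lambda>k m r. A * C ^ m * (K * (r - s)) ^ k * real ((m + k) choose k))"
  have main: "\<lbrakk>j \<in> I n; s \<le> t; t \<le> T\<rbrakk> \<Longrightarrow> \<bar>\<delta> n j t\<bar> \<le> y k n t" for k n j t
  proof (induction k arbitrary: n j t)
    case 0
    thus ?case using bound by (simp add: y_def)
  next
    case (Suc k)
    have "\<bar>\<delta> n j t\<bar> \<le> (A * C ^ n * K ^ Suc k * real ((n + Suc k) choose Suc k)) * (t - s) ^ Suc k"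
    proof (rule abs_le_power_of_deriv_bound[where f = "\<delta> n j" and f' = "D n j"])
      show "continuous_on {s..t} (\<delta> n j)"
        using cont[OF Suc.prems(1)] Suc.prems by (auto intro: continuous_on_subset)
      show "\<delta> n j s = 0" "s \<le> t" using zero Suc.prems by auto
      fix r assume r: "s < r" "r < t"
      show "(\<delta> n j has_real_derivative D n j r) (at r)" using deriv Suc.prems r by auto
      have "\<bar>D n j r\<bar> \<le> L * (real (Suc n) * (y k n r + y k (Suc n) r) + y k (n - 1) r)"
        by (rule rate) (use Suc r in auto)
      also have "\<dots> \<le> L * ((2 + C + 1 / C) * (real (Suc n) * (A * C ^ n * (K * (r - s)) ^ k * real ((Suc n + k) choose k))))"
      proof (rule mult_left_mono[OF _ L])
        let ?b = "real ((Suc n + k) choose k)"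
        let ?z = "A * C ^ n * (K * (r - s)) ^ k"
        have z0: "0 \<le> ?z" using A C K0 r by (intro mult_nonneg_nonneg zero_le_power) auto
        have b1: "real ((n + k) choose k) \<le> ?b" "real ((n - 1 + k) choose k) \<le> ?b"
          by (auto intro!: binomial_right_mono)
        have yb: "y k n r \<le> ?z * ?b" unfolding y_def using z0 b1 by (intro mult_left_mono) auto
        have y2: "y k (Suc n) r = C * (?z * ?b)" by (simp add: y_def mult_ac)
        \<comment> \<open>for \<open>n = 0\<close> truncated subtraction gives \<open>n - 1 = 0\<close>, which accounts for the summand 1\<close>
        have y3: "y k (n - 1) r \<le> (1 + 1 / C) * (?z * ?b)"
        proof (cases n)
          case 0
          have "y k (n - 1) r = ?z * real ((n - 1 + k) choose k)" using 0 by (simp add: y_def)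
          also have "\<dots> \<le> ?z * ?b" by (rule mult_left_mono[OF b1(2) z0])
          also have "\<dots> \<le> (1 + 1 / C) * (?z * ?b)" using C z0 by (simp add: distrib_right)
          finally show ?thesis .
        next
          case (Suc m)
          have "y k (n - 1) r = (?z / C) * real ((n - 1 + k) choose k)"
            using C Suc by (simp add: y_def field_simps)
          also have "\<dots> \<le> (?z / C) * ?b" using b1 z0 C by (intro mult_left_mono) auto
          also have "\<dots> \<le> (1 + 1 / C) * (?z * ?b)" using C z0 by (simp add: distrib_right)
          finally show ?thesis .
        qed
        have "real (Suc n) * (y k n r + y k (Suc n) r) + y k (n - 1) r
          \<le> real (Suc n) * ((1 + C) * (?z * ?b)) + 1 * ((1 + 1 / C) * (?z * ?b))"
          using yb y2 y3 by (intro add_mono mult_left_mono) (auto simp: distrib_right)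
        also have "\<dots> \<le> real (Suc n) * ((1 + C) * (?z * ?b)) + real (Suc n) * ((1 + 1 / C) * (?z * ?b))"
        proof (intro add_left_mono mult_right_mono)
          show "0 \<le> (1 + 1 / C) * (?z * ?b)" by (rule mult_nonneg_nonneg[OF _ mult_nonneg_nonneg[OF z0]]) (use C in auto)
        qed simp
        also have "\<dots> = (2 + C + 1 / C) * (real (Suc n) * (?z * ?b))"
          by (simp only: algebra_simps)
        finally show "real (Suc n) * (y k n r + y k (Suc n) r) + y k (n - 1) r
          \<le> (2 + C + 1 / C) * (real (Suc n) * (?z * ?b))" .
      qed
      also have "\<dots> = A * C ^ n * K ^ Suc k * (r - s) ^ k * real (Suc n * ((Suc (k + n)) choose k))"
        by (simp add: K_def power_mult_distrib add_ac mult_ac del: of_nat_Suc mult_Suc)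
      also have "\<dots> = A * C ^ n * K ^ Suc k * real ((n + Suc k) choose Suc k) * (real (Suc k) * (r - s) ^ k)"
        using Suc_times_binomial_add[of k n]
        by (simp add: add_ac mult_ac del: of_nat_Suc binomial_Suc_Suc flip: of_nat_mult)
      finally show "\<bar>D n j r\<bar> \<le> A * C ^ n * K ^ Suc k * real ((n + Suc k) choose Suc k) * (real (Suc k) * (r - s) ^ k)" .
    qed
    thus ?case by (simp add: y_def power_mult_distrib mult_ac)
  qed
  define x where "x = K * (t - s)"
  have "(t - s) * (4 * L * (2 + C + 1 / C)) = 4 * x" by (simp only: x_def K_def mult_ac)
  moreover have "0 \<le> x" unfolding x_def using K0 t by simp
  ultimately have x: "0 \<le> x" "2 * x < 1" using t by linarith+
  have "\<bar>\<delta> n j t\<bar> \<le> A * C ^ n * 2 ^ n * (2 * x) ^ k" for k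
  proof -
    have "\<bar>\<delta> n j t\<bar> \<le> A * C ^ n * x ^ k * real ((n + k) choose k)"
      using main[OF j t(1,2), of k] by (simp add: y_def x_def)
    also have "\<dots> \<le> A * C ^ n * x ^ k * 2 ^ (n + k)"
    proof (rule mult_left_mono)
      have "real ((n + k) choose k) \<le> real (2 ^ (n + k))"
        by (rule of_nat_mono, rule binomial_le_pow2)
      thus "real ((n + k) choose k) \<le> 2 ^ (n + k)" by simp
      show "0 \<le> A * C ^ n * x ^ k" using A C x by simp
    qed
    finally show ?thesis by (simp add: power_add power_mult_distrib mult_ac)
  qed
  moreover have "(\<lambda>k. A * C ^ n * 2 ^ n * (2 * x) ^ k) \<longlonglongrightarrow> A * C ^ n * 2 ^ n * 0"
    by (intro tendsto_mult tendsto_const LIMSEQ_realpow_zero) (use x in auto)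
  ultimately have "\<bar>\<delta> n j t\<bar> \<le> 0"
    by (intro LIMSEQ_le_const[of "\<lambda>k. A * C ^ n * 2 ^ n * (2 * x) ^ k"]) auto
  thus ?thesis by simp
qed

text \<open>
  The admissible step length depends on \<open>L\<close> and \<open>C\<close> only, so that finitely many steps reach \<open>T\<close>.
\<close>

lemma coupled_hierarchy_zero:
  fixes \<delta> D :: "nat \<Rightarrow> 'i \<Rightarrow> real \<Rightarrow> real" and I :: "nat \<Rightarrow> 'i set"
  assumes A: "0 \<le> A" and C: "0 < C" and L: "0 \<le> L"
    and cont: "\<And>n j. j \<in> I n \<Longrightarrow> continuous_on {0..T} (\<delta> n j)"
    and zero: "\<And>n j. j \<in> I n \<Longrightarrow> \<delta> n j 0 = 0"
    and deriv: "\<And>n j t. j \<in> I n \<Longrightarrow> 0 < t \<Longrightarrow> t < T \<Longrightarrow> (\<delta> n j has_real_derivative D n j t) (at t)"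
    and bound: "\<And>n j t. j \<in> I n \<Longrightarrow> 0 \<le> t \<Longrightarrow> t \<le> T \<Longrightarrow> \<bar>\<delta> n j t\<bar> \<le> A * C ^ n"
    and rate: "\<And>n j t y. j \<in> I n \<Longrightarrow> 0 < t \<Longrightarrow> t < T \<Longrightarrow> (\<And>m i. i \<in> I m \<Longrightarrow> \<bar>\<delta> m i t\<bar> \<le> y m) \<Longrightarrow>
       \<bar>D n j t\<bar> \<le> L * (real (Suc n) * (y n + y (Suc n)) + y (n - 1))"
    and j: "j \<in> I n" and t: "0 \<le> t" "t \<le> T"
  shows "\<delta> n j t = 0"
proof -
  define c where "c = 4 * L * (2 + C + 1 / C)"
  have c0: "c \<ge> 0" unfolding c_def using L C by (intro mult_nonneg_nonneg) auto
  define \<tau> where "\<tau> = 1 / (c + 1)"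
  have tau: "\<tau> > 0" "\<tau> * c < 1" using c0 by (auto simp: \<tau>_def field_simps)
  have step: "\<forall>n. \<forall>j\<in>I n. \<forall>t. 0 \<le> t \<and> t \<le> T \<and> t \<le> real m * \<tau> \<longrightarrow> \<delta> n j t = 0" for m
  proof (induction m)
    case 0
    thus ?case using zero by auto
  next
    case (Suc m)
    show ?case
    proof (intro allI ballI impI)
      fix n j t assume j: "j \<in> I n" and t: "0 \<le> t \<and> t \<le> T \<and> t \<le> real (Suc m) * \<tau>"
      show "\<delta> n j t = 0"
      proof (cases "t \<le> real m * \<tau>")
        case False
        have s: "0 \<le> real m * \<tau>" "real m * \<tau> \<le> T" using tau False t by auto
        have "(t - real m * \<tau>) * c \<le> \<tau> * c"
          using t by (intro mult_right_mono c0) (auto simp: algebra_simps)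
        hence lt: "(t - real m * \<tau>) * c < 1" using tau by linarith
        show ?thesis
        proof (rule coupled_hierarchy_zero_step[where s = "real m * \<tau>" and T = T and D = D and \<delta> = \<delta>
              and I = I, OF A C L s(1)])
          show "continuous_on {real m * \<tau>..T} (\<delta> n j)" if "j \<in> I n" for n j
            using cont[OF that] s by (auto intro: continuous_on_subset)
          show "\<delta> n j (real m * \<tau>) = 0" if "j \<in> I n" for n j
            using Suc that s by auto
        qed (use deriv bound rate j t lt s False in \<open>auto simp: c_def\<close>)
      qed (use Suc j t in auto)
    qed
  qed
  obtain m :: nat where "t / \<tau> < real m" using reals_Archimedean2 by blast
  hence "t \<le> real m * \<tau>" using tau by (simp add: field_simps)
  thus ?thesis using step[of m] j t by auto
qed

section \<open>An explicit solution of the coefficient hierarchy\<close>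

text \<open>
  The integral of \<open>exp (- al * s)\<close> over \<open>s\<close> from 0 to \<open>t\<close>; eigenvalues may vanish, hence the case
  distinction.
\<close>

definition ou_E :: "real \<Rightarrow> real \<Rightarrow> real" where
  "ou_E al t = (if al = 0 then t else (1 - exp (- al * t)) / al)"

text \<open>
  The integral of \<open>ou_E al\<close> from 0 to \<open>t\<close>.
\<close>

definition ou_F :: "real \<Rightarrow> real \<Rightarrow> real" where
  "ou_F al t = (if al = 0 then t\<^sup>2 / 2 else (t - ou_E al t) / al)"

lemma ou_E_deriv [derivative_intros]:
  "(ou_E al has_real_derivative exp (- al * t)) (at t within A)"
  unfolding ou_E_def by (cases "al = 0") (auto intro!: derivative_eq_intros)

lemma ou_F_deriv [derivative_intros]:
  "(ou_F al has_real_derivative ou_E al t) (at t within A)"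
proof (cases "al = 0")
  case True
  thus ?thesis unfolding ou_F_def by (auto intro!: derivative_eq_intros simp: ou_E_def)
next
  case False
  have "((\<lambda>t. (t - ou_E al t) / al) has_real_derivative (1 - exp (- al * t)) / al) (at t within A)"
    by (auto intro!: derivative_eq_intros simp: False)
  thus ?thesis using False unfolding ou_F_def by (simp add: ou_E_def)
qed

lemma exp_eq_ou_E: "exp (- al * t) = 1 - al * ou_E al t"
  by (simp add: ou_E_def)

lemma ou_E_0 [simp]: "ou_E al 0 = 0" and ou_F_0 [simp]: "ou_F al 0 = 0"
  by (simp_all add: ou_E_def ou_F_def)

lemma ou_F_eq: "al * ou_F al t = t - ou_E al t"
  by (simp add: ou_F_def ou_E_def)

text \<open>
  Deletion of entry \<open>i\<close> from a tuple indexed from 1, as for \<^const>\<open>drop_coord\<close> but on untruncated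
  functions.
\<close>

definition drop_nth :: "nat \<Rightarrow> (nat \<Rightarrow> 'a) \<Rightarrow> nat \<Rightarrow> 'a" where
  "drop_nth i x l = (if l < i then x l else x (Suc l))"

lemma skip_image:
  assumes "i \<in> {1..n}"
  shows "(\<lambda>l. if l < i then l else Suc l) ` {1..n - 1} = {1..n} - {i}"
proof (intro equalityI subsetI)
  fix x assume x: "x \<in> {1..n} - {i}"
  show "x \<in> (\<lambda>l. if l < i then l else Suc l) ` {1..n - 1}"
  proof (cases "x < i")
    case True
    thus ?thesis using x assms by (intro image_eqI[of _ _ x]) auto
  next
    case False
    thus ?thesis using x assms by (intro image_eqI[of _ _ "x - 1"]) auto
  qed
qed (use assms in \<open>auto split: if_splits\<close>)

lemma skip_inj: "inj_on (\<lambda>l. if l < i then l else Suc l) A" for i :: nat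
  by (auto simp: inj_on_def)

text \<open>
  The numbers \<open>d k\<close>, \<open>c k\<close> and \<open>\<zeta> k\<close> stand for the coefficients of \<open>\<lambda>\<^sub>d\<close>, \<open>\<lambda>\<^sub>c\<close> and the initial density.
  
  The quantities below can be read off from a system of independent particles. Created particles alive
  at time \<open>t\<close> form a Poisson process whose intensity has the coefficients \<open>a k t\<close>, and \<open>K t\<close> is the
  probability that there are none. The density of the initial particle has the coefficients \<open>q k t\<close>, and
  \<open>S t\<close> is the probability that it has disappeared.
\<close>

locale ou_data =
  fixes N :: nat and \<alpha> d c \<zeta> :: "nat \<Rightarrow> real" and \<gamma> :: real
begin

definition a :: "nat \<Rightarrow> real \<Rightarrow> real" where
  "a k t = c k * ou_E (\<alpha> k) t"

definition q :: "nat \<Rightarrow> real \<Rightarrow> real" where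
  "q k t = \<zeta> k * exp (- \<alpha> k * t)"

definition S :: "real \<Rightarrow> real" where
  "S t = (\<Sum>k=1..N. \<zeta> k * d k * ou_E (\<alpha> k) t)"

definition K :: "real \<Rightarrow> real" where
  "K t = exp ((\<Sum>k=1..N. c k * d k * ou_F (\<alpha> k) t) - \<gamma> * t)"

definition P :: "nat set \<Rightarrow> (nat \<Rightarrow> nat) \<Rightarrow> real \<Rightarrow> real" where
  "P L j t = (\<Prod>l\<in>L. a (j l) t)"

text \<open>
  Either the initial particle has disappeared and all labels in \<open>L\<close> belong to created particles, or
  exactly one label \<open>k\<close> belongs to the initial particle.
\<close>

definition V :: "nat set \<Rightarrow> (nat \<Rightarrow> nat) \<Rightarrow> real \<Rightarrow> real" where
  "V L j t = S t * P L j t + (\<Sum>k\<in>L. q (j k) t * P (L - {k}) j t)"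

definition coef :: "nat \<Rightarrow> (nat \<Rightarrow> nat) \<Rightarrow> real \<Rightarrow> real" where
  "coef n j t = K t / fact n * V {1..n} j t"

lemma P_insert: "finite L \<Longrightarrow> m \<notin> L \<Longrightarrow> P (insert m L) j t = a (j m) t * P L j t"
  by (simp add: P_def)

text \<open>
  Common step of the inductions on \<open>L\<close> below, whose sums remove one factor at a time.
\<close>

lemma sum_insert_remove:
  fixes f :: "nat \<Rightarrow> real" and H :: "nat set \<Rightarrow> real"
  assumes "finite L" "m \<notin> L" and "\<And>k. k \<in> L \<Longrightarrow> H (insert m (L - {k})) = G k"
  shows "(\<Sum>k\<in>insert m L. f k * H (insert m L - {k})) = f m * H L + (\<Sum>k\<in>L. f k * G k)"
proof -
  have "(\<Sum>k\<in>L. f k * H (insert m L - {k})) = (\<Sum>k\<in>L. f k * G k)"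
  proof (rule sum.cong[OF refl])
    fix k assume k: "k \<in> L"
    have "insert m L - {k} = insert m (L - {k})" using k assms by auto
    thus "f k * H (insert m L - {k}) = f k * G k" using assms(3)[OF k] by simp
  qed
  moreover have "insert m L - {m} = L" using assms by auto
  ultimately show ?thesis using assms by (simp add: sum.insert)
qed

lemma V_insert:
  assumes "finite L" "m \<notin> L"
  shows "V (insert m L) j t = a (j m) t * V L j t + q (j m) t * P L j t"
proof -
  have "(\<Sum>k\<in>insert m L. q (j k) t * P (insert m L - {k}) j t)
    = q (j m) t * P L j t + (\<Sum>k\<in>L. q (j k) t * (a (j m) t * P (L - {k}) j t))"
    by (rule sum_insert_remove[OF assms, where H = "\<lambda>L. P L j t"]) (use assms in \<open>auto simp: P_insert\<close>)
  thus ?thesis unfolding V_def using assms by (simp add: P_insert algebra_simps sum_distrib_left)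
qed

lemma a_deriv: "(a k has_real_derivative - \<alpha> k * a k t + c k) (at t within A)"
proof -
  have "(a k has_real_derivative c k * exp (- \<alpha> k * t)) (at t within A)"
    unfolding a_def by (auto intro!: derivative_eq_intros)
  moreover have "c k * exp (- \<alpha> k * t) = - \<alpha> k * a k t + c k"
    unfolding exp_eq_ou_E by (simp add: a_def algebra_simps)
  ultimately show ?thesis by simp
qed

lemma q_deriv: "(q k has_real_derivative - \<alpha> k * q k t) (at t within A)"
  unfolding q_def by (auto intro!: derivative_eq_intros)

lemma S_deriv: "(S has_real_derivative (\<Sum>k=1..N. d k * q k t)) (at t within A)"
  unfolding S_def q_def by (auto intro!: derivative_eq_intros sum.cong)

lemma K_deriv: "(K has_real_derivative K t * ((\<Sum>k=1..N. d k * a k t) - \<gamma>)) (at t within A)"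
  unfolding K_def a_def by (auto intro!: derivative_eq_intros sum.cong)

lemma P_deriv:
  assumes "finite L"
  shows "(P L j has_real_derivative - (\<Sum>l\<in>L. \<alpha> (j l)) * P L j t
    + (\<Sum>i\<in>L. c (j i) * P (L - {i}) j t)) (at t within A)"
  using assms
proof (induction L)
  case empty
  show ?case by (simp add: P_def)
next
  case (insert m L)
  have eq: "P (insert m L) j = (\<lambda>t. a (j m) t * P L j t)"
    using insert by (simp add: P_insert fun_eq_iff)
  have s: "(\<Sum>k\<in>insert m L. c (j k) * P (insert m L - {k}) j t)
    = c (j m) * P L j t + (\<Sum>k\<in>L. c (j k) * (a (j m) t * P (L - {k}) j t))"
    by (rule sum_insert_remove[where H = "\<lambda>L. P L j t"]) (use insert in \<open>auto simp: P_insert\<close>)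
  show ?case unfolding s using insert unfolding eq
    by (auto intro!: derivative_eq_intros a_deriv simp: algebra_simps sum_distrib_left)
qed

lemma V_deriv:
  assumes "finite L"
  shows "(V L j has_real_derivative - (\<Sum>l\<in>L. \<alpha> (j l)) * V L j t
    + (\<Sum>i\<in>L. c (j i) * V (L - {i}) j t) + (\<Sum>k=1..N. d k * q k t) * P L j t) (at t within A)"
  using assms
proof (induction L)
  case empty
  have "V {} j = S" by (simp add: V_def P_def fun_eq_iff)
  thus ?case using S_deriv by (simp add: P_def)
next
  case (insert m L)
  have eq: "V (insert m L) j = (\<lambda>t. a (j m) t * V L j t + q (j m) t * P L j t)"
    using insert by (simp add: V_insert fun_eq_iff)
  have s: "(\<Sum>k\<in>insert m L. c (j k) * V (insert m L - {k}) j t)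
    = c (j m) * V L j t + (\<Sum>k\<in>L. c (j k) * (a (j m) t * V (L - {k}) j t + q (j m) t * P (L - {k}) j t))"
    by (rule sum_insert_remove[where H = "\<lambda>L. V L j t"]) (use insert in \<open>auto simp: V_insert\<close>)
  show ?case unfolding s P_insert[OF insert(1,2)] unfolding eq
    by (rule derivative_eq_intros a_deriv q_deriv P_deriv insert refl)+
       (use insert in \<open>simp add: algebra_simps sum_distrib_left sum.distrib\<close>)
qed

lemma V_cong: "(\<And>l. l \<in> L \<Longrightarrow> j l = j' l) \<Longrightarrow> V L j t = V L j' t"
  unfolding V_def P_def by (auto intro!: sum.cong arg_cong2[of _ _ _ _ "(*)"] prod.cong)

lemma V_reindex:
  assumes "inj_on h L"
  shows "V (h ` L) j t = V L (j \<circ> h) t"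
proof -
  have "h ` L - {h k} = h ` (L - {k})" if "k \<in> L" for k
    using assms that by (auto simp: inj_on_def)
  moreover have "inj_on h (L - {k})" for k using assms by (rule inj_on_subset) auto
  ultimately have P: "P (h ` L - {h k}) j t = P (L - {k}) (j \<circ> h) t" if "k \<in> L" for k
    using that by (simp add: P_def prod.reindex)
  have "(\<Sum>k\<in>h ` L. q (j k) t * P (h ` L - {k}) j t) = (\<Sum>k\<in>L. q ((j \<circ> h) k) t * P (L - {k}) (j \<circ> h) t)"
    unfolding sum.reindex[OF assms] by (intro sum.cong refl) (simp add: P)
  moreover have "P (h ` L) j t = P L (j \<circ> h) t" using assms by (simp add: P_def prod.reindex)
  ultimately show ?thesis unfolding V_def by simp
qed

lemma V_drop_nth:
  assumes "i \<in> {1..n}"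
  shows "V {1..n - 1} (drop_nth i j) t = V ({1..n} - {i}) j t"
proof -
  have "drop_nth i j = j \<circ> (\<lambda>l. if l < i then l else Suc l)"
    by (auto simp: drop_nth_def fun_eq_iff)
  thus ?thesis using V_reindex[OF skip_inj, of i "{1..n - 1}" j t] skip_image[OF assms] by simp
qed

text \<open>
  The terms match one by one: the derivative of \<open>K\<close> and of \<open>S\<close> together give the coupling to level
  \<open>n + 1\<close> and the loss \<open>\<gamma>\<close>; the product rule for \<open>V\<close> gives the decay rates and the coupling to level
  \<open>n - 1\<close>.
\<close>

lemma coef_deriv:
  "(coef n j has_real_derivative
      - (\<Sum>l=1..n. \<alpha> (j l)) * coef n j t
      + real (n + 1) * (\<Sum>k=1..N. d k * coef (n + 1) (j(n + 1 := k)) t)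
      + 1 / real n * (\<Sum>i=1..n. c (j i) * coef (n - 1) (drop_nth i j) t)
      - \<gamma> * coef n j t) (at t within A)"
proof -
  let ?V = "V {1..n} j t" and ?P = "P {1..n} j t"
  have 1: "real (n + 1) * (\<Sum>k=1..N. d k * coef (n + 1) (j(n + 1 := k)) t)
     = K t / fact n * ((\<Sum>k=1..N. d k * a k t) * ?V + (\<Sum>k=1..N. d k * q k t) * ?P)"
  proof -
    have f: "fact (n + 1) = real (n + 1) * (fact n :: real)" by simp
    have "coef (n + 1) (j(n + 1 := k)) t = (K t / fact n) / real (n + 1) * (a k t * ?V + q k t * ?P)" for k
    proof -
      have i: "{1..n + 1} = insert (n + 1) {1..n}" by auto
      have "V {1..n} (j(n + 1 := k)) t = ?V" by (rule V_cong) auto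
      moreover have "P {1..n} (j(n + 1 := k)) t = ?P" by (auto simp: P_def intro!: prod.cong)
      ultimately have "V {1..n + 1} (j(n + 1 := k)) t = a k t * ?V + q k t * ?P"
        unfolding i by (subst V_insert) auto
      thus ?thesis unfolding coef_def f by (simp add: field_simps del: of_nat_Suc)
    qed
    hence "real (n + 1) * (\<Sum>k=1..N. d k * coef (n + 1) (j(n + 1 := k)) t)
      = (\<Sum>k=1..N. d k * (K t / fact n * (a k t * ?V + q k t * ?P)))"
    proof -
      have aux: "r \<noteq> 0 \<Longrightarrow> r * (e * (X / r * Y)) = e * (X * Y)" for r e X Y :: real by simp
      assume eq: "\<And>k. coef (n + 1) (j(n + 1 := k)) t = (K t / fact n) / real (n + 1) * (a k t * ?V + q k t * ?P)"
      show ?thesis unfolding sum_distrib_left eq by (intro sum.cong refl aux) simp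
    qed
    also have "\<dots> = K t / fact n * ((\<Sum>k=1..N. d k * a k t) * ?V + (\<Sum>k=1..N. d k * q k t) * ?P)"
      by (simp add: sum_distrib_left sum_distrib_right sum.distrib algebra_simps)
    finally show ?thesis .
  qed
  have 2: "1 / real n * (\<Sum>i=1..n. c (j i) * coef (n - 1) (drop_nth i j) t)
     = K t / fact n * (\<Sum>i=1..n. c (j i) * V ({1..n} - {i}) j t)"
  proof (cases n)
    case (Suc m)
    have f: "fact n = real n * (fact (n - 1) :: real)" using Suc by simp
    have "coef (n - 1) (drop_nth i j) t = K t / fact (n - 1) * V ({1..n} - {i}) j t" if "i \<in> {1..n}" for i
      unfolding coef_def V_drop_nth[OF that] ..
    hence "(\<Sum>i=1..n. c (j i) * coef (n - 1) (drop_nth i j) t)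
        = (\<Sum>i=1..n. K t / fact (n - 1) * (c (j i) * V ({1..n} - {i}) j t))"
      by (intro sum.cong refl) simp
    thus ?thesis unfolding f sum_distrib_left[symmetric] by simp
  qed simp
  have "(coef n j has_real_derivative K t * ((\<Sum>k=1..N. d k * a k t) - \<gamma>) / fact n * ?V
     + K t / fact n * (- (\<Sum>l=1..n. \<alpha> (j l)) * ?V
    + (\<Sum>i=1..n. c (j i) * V ({1..n} - {i}) j t) + (\<Sum>k=1..N. d k * q k t) * ?P)) (at t within A)"
    unfolding coef_def
    by (rule DERIV_cong, rule DERIV_mult[OF DERIV_cdivide[OF K_deriv] V_deriv[OF finite_atLeastAtMost]])
       (simp add: algebra_simps)
  moreover have "K t * ((\<Sum>k=1..N. d k * a k t) - \<gamma>) / fact n * ?V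
     + K t / fact n * (- (\<Sum>l=1..n. \<alpha> (j l)) * ?V
    + (\<Sum>i=1..n. c (j i) * V ({1..n} - {i}) j t) + (\<Sum>k=1..N. d k * q k t) * ?P)
    = - (\<Sum>l=1..n. \<alpha> (j l)) * (K t / fact n * ?V)
     + K t / fact n * ((\<Sum>k=1..N. d k * a k t) * ?V + (\<Sum>k=1..N. d k * q k t) * ?P)
     + K t / fact n * (\<Sum>i=1..n. c (j i) * V ({1..n} - {i}) j t) - \<gamma> * (K t / fact n * ?V)"
    by (simp add: algebra_simps diff_divide_distrib)
  ultimately show ?thesis unfolding 1 2 coef_def[of n j t] by simp
qed

lemma continuous_coef: "continuous_on A (coef n j)"
  by (rule DERIV_continuous_on, rule coef_deriv)

lemma coef_0:
  shows "coef n j 0 = (if n = 1 then \<zeta> (j 1) else 0)"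
proof -
  have z: "S 0 = 0" "K 0 = 1" by (simp_all add: S_def K_def)
  have P0: "P L j 0 = 0" if "L \<noteq> {}" "finite L" for L using that by (auto simp: P_def a_def)
  have "(\<Sum>k=1..n. q (j k) 0 * P ({1..n} - {k}) j 0) = 0" if "n \<noteq> 1"
  proof (rule sum.neutral, rule ballI)
    fix k assume k: "k \<in> {1..n}"
    have "(if k = 1 then 2 else 1) \<in> {1..n} - {k}" using k that by auto
    hence "{1..n} - {k} \<noteq> {}" by blast
    from P0[OF this] show "q (j k) 0 * P ({1..n} - {k}) j 0 = 0" by simp
  qed
  moreover have "P {} j 0 = 1" by (simp add: P_def)
  ultimately show ?thesis unfolding coef_def V_def z by (auto simp: q_def)
qed

text \<open>
  The bound is geometric, not merely finite for each \<open>n\<close>, as the uniqueness argument requires: the sum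
  in \<open>V\<close> has \<open>n\<close> terms, and \<open>(n + 1) / n!\<close> is at most 2.
\<close>

lemma coef_bounded:
  shows "\<exists>A\<ge>0. \<exists>C\<ge>1. \<forall>n j t. (\<forall>l\<in>{1..n}. j l \<in> {1..N}) \<longrightarrow> 0 \<le> t \<longrightarrow> t \<le> T \<longrightarrow> \<bar>coef n j t\<bar> \<le> A * C ^ n"
proof -
  have ex: "\<exists>B. \<forall>t\<in>{0..T}. \<bar>f t\<bar> \<le> B" if "continuous_on {0..T} f" for f :: "real \<Rightarrow> real"
    using compact_imp_bounded[OF compact_continuous_image[OF that]] by (auto simp: bounded_iff)
  have ca: "continuous_on {0..T} (a k)" and cq: "continuous_on {0..T} (q k)"
    and cS: "continuous_on {0..T} S" and cK: "continuous_on {0..T} K" for k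
    by (rule DERIV_continuous_on, rule a_deriv q_deriv S_deriv K_deriv)+
  obtain Ba Bq BS BK where B: "\<And>k t. t \<in> {0..T} \<Longrightarrow> \<bar>a k t\<bar> \<le> Ba k"
     "\<And>k t. t \<in> {0..T} \<Longrightarrow> \<bar>q k t\<bar> \<le> Bq k"
     "\<And>t. t \<in> {0..T} \<Longrightarrow> \<bar>S t\<bar> \<le> BS" "\<And>t. t \<in> {0..T} \<Longrightarrow> \<bar>K t\<bar> \<le> BK"
    using ex[OF ca] ex[OF cq] ex[OF cS] ex[OF cK] by metis
  define C where "C = Max (insert 1 (insert BS (insert BK (Ba ` {1..N} \<union> Bq ` {1..N}))))"
  have le: "x \<le> C" if "x \<in> insert 1 (insert BS (insert BK (Ba ` {1..N} \<union> Bq ` {1..N})))" for x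
    unfolding C_def by (rule Max_ge) (use that in auto)
  have C1: "C \<ge> 1" by (rule le) simp
  have "\<bar>coef n j t\<bar> \<le> (2 * C\<^sup>2) * C ^ n" if j: "\<forall>l\<in>{1..n}. j l \<in> {1..N}" and t: "0 \<le> t" "t \<le> T" for n j t
  proof -
    have a: "\<bar>a k t\<bar> \<le> C" "\<bar>q k t\<bar> \<le> C" if "k \<in> {1..N}" for k
      using B(1)[of t k] B(2)[of t k] le[of "Ba k"] le[of "Bq k"] that t by auto
    have s: "\<bar>S t\<bar> \<le> C" "\<bar>K t\<bar> \<le> C"
      using B(3)[of t] B(4)[of t] le[of BS] le[of BK] t by auto
    have P: "\<bar>P L j t\<bar> \<le> C ^ n" if "L \<subseteq> {1..n}" for L
    proof -
      have "\<bar>P L j t\<bar> \<le> (\<Prod>l\<in>L. C)" unfolding P_def abs_prod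
        by (rule prod_mono) (use a j that in auto)
      also have "\<dots> = C ^ card L" by simp
      also have "\<dots> \<le> C ^ n" using card_mono[OF _ that] by (intro power_increasing C1) auto
      finally show ?thesis .
    qed
    have "\<bar>V {1..n} j t\<bar> \<le> \<bar>S t\<bar> * \<bar>P {1..n} j t\<bar> + (\<Sum>k=1..n. \<bar>q (j k) t\<bar> * \<bar>P ({1..n} - {k}) j t\<bar>)"
      unfolding V_def by (rule order_trans[OF abs_triangle_ineq]) (auto simp: abs_mult intro: sum_abs[THEN order_trans])
    also have "\<dots> \<le> C * C ^ n + (\<Sum>k=1..n. C * C ^ n)"
      using C1 j by (intro add_mono mult_mono sum_mono P a s) auto
    also have "\<dots> = real (n + 1) * (C * C ^ n)" by (simp add: algebra_simps)
    finally have V: "\<bar>V {1..n} j t\<bar> \<le> real (n + 1) * (C * C ^ n)" .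
    have "\<bar>coef n j t\<bar> = \<bar>K t\<bar> / fact n * \<bar>V {1..n} j t\<bar>" by (simp add: coef_def abs_mult)
    also have "\<dots> \<le> C / fact n * (real (n + 1) * (C * C ^ n))"
      using C1 by (intro mult_mono divide_right_mono V s) auto
    also have "\<dots> = real (n + 1) / fact n * (C\<^sup>2 * C ^ n)" by (simp add: power2_eq_square)
    also have "\<dots> \<le> 2 * (C\<^sup>2 * C ^ n)"
    proof (rule mult_right_mono)
      have "n + 1 \<le> 2 * fact n" using fact_ge_self[of n] fact_ge_1[of n] by (smt (verit) One_nat_def add_mono mult_2)
      hence "real (n + 1) \<le> real (2 * fact n)" by (simp only: of_nat_le_iff)
      thus "real (n + 1) / fact n \<le> 2" by (simp add: field_simps)
    qed (use C1 in auto)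
    finally show ?thesis by (simp add: mult_ac)
  qed
  thus ?thesis using C1 by (intro exI[of _ "2 * C\<^sup>2"] exI[of _ C] conjI) auto
qed

end

section \<open>Gaussian expectations and the parabolic equation\<close>

text \<open>
  This class contains the solution of the parabolic equation and is closed under partial derivatives.
\<close>

definition affine_exp :: "nat \<Rightarrow> real \<Rightarrow> (nat \<Rightarrow> real) \<Rightarrow> (nat \<Rightarrow> real) \<Rightarrow> real \<Rightarrow> (nat \<Rightarrow> real) \<Rightarrow> real" where
  "affine_exp N b r v w z = (b + (\<Sum>i=1..N. r i * z i)) * exp ((\<Sum>i=1..N. v i * z i) + w)"

lemma sum_fun_upd:
  assumes "j \<in> {1..N::nat}"
  shows "(\<Sum>i=1..N. r i * ((z(j := s)) i)) = (\<Sum>i\<in>{1..N}-{j}. r i * z i) + r j * (s::real)"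
proof -
  have "(\<Sum>i\<in>{1..N} - {j}. r i * (z(j := s)) i) = (\<Sum>i\<in>{1..N} - {j}. r i * z i)"
    by (rule sum.cong) auto
  moreover have "(\<Sum>i=1..N. r i * ((z(j := s)) i)) = r j * (z(j := s)) j + (\<Sum>i\<in>{1..N} - {j}. r i * (z(j := s)) i)"
    by (rule sum.remove) (use assms in auto)
  ultimately show ?thesis by simp
qed

lemma affine_exp_deriv:
  assumes j: "j \<in> {1..N}"
  shows "((\<lambda>s. affine_exp N b r v w (z(j := s))) has_real_derivative
     affine_exp N (v j * b + r j) (\<lambda>i. v j * r i) v w z) (at (z j))"
proof -
  have *: "(\<Sum>i=1..N. r i * z i) = (\<Sum>i\<in>{1..N}-{j}. r i * z i) + r j * z j" for r
    using sum_fun_upd[OF j, of r z "z j"] by simp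
  have "(\<Sum>i=1..N. v j * r i * z i) = v j * (\<Sum>i=1..N. r i * z i)"
    by (simp add: sum_distrib_left mult_ac)
  thus ?thesis unfolding affine_exp_def sum_fun_upd[OF j]
    by (auto intro!: derivative_eq_intros simp: algebra_simps * simp del: One_nat_def)
qed

lemma euclid_upd: "z \<in> euclid N \<Longrightarrow> j \<in> {1..N} \<Longrightarrow> z(j := s) \<in> euclid N"
  by (auto simp: euclid_def PiE_iff extensional_def)

text \<open>
  The constant term after differentiating along the list; the linear part is only multiplied by the
  product of the \<open>v k\<close>.
\<close>

fun affine_exp_const :: "real \<Rightarrow> (nat \<Rightarrow> real) \<Rightarrow> (nat \<Rightarrow> real) \<Rightarrow> nat list \<Rightarrow> real" where
  "affine_exp_const b r v [] = b"
| "affine_exp_const b r v (k # js) = v k * affine_exp_const b r v js + prod_list (map v js) * r k"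

text \<open>
  Only the values of \<open>g\<close> on \<^term>\<open>euclid N\<close> matter, because changing a coordinate with index in \<open>{1..N}\<close>
  stays within that set.
\<close>

lemma partials_affine_exp:
  assumes eq: "\<And>z. z \<in> euclid N \<Longrightarrow> g z = affine_exp N b r v w z"
    and js: "set js \<subseteq> {1..N}" and z: "z \<in> euclid N"
  shows "partials js g z
    = affine_exp N (affine_exp_const b r v js) (\<lambda>i. prod_list (map v js) * r i) v w z"
  using js z
proof (induction js arbitrary: z)
  case Nil
  thus ?case using eq by (simp add: partials_def)
next
  case (Cons k js)
  have k: "k \<in> {1..N}" and js: "set js \<subseteq> {1..N}" using Cons.prems by auto
  have "partials (k # js) g z = deriv (\<lambda>s. partials js g (z(k := s))) (z k)"
    by (simp add: partials_def partial_def)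
  also have "(\<lambda>s. partials js g (z(k := s))) = (\<lambda>s. affine_exp N (affine_exp_const b r v js)
      (\<lambda>i. prod_list (map v js) * r i) v w (z(k := s)))"
    using Cons.IH[OF js euclid_upd[OF Cons.prems(2) k]] by (rule ext)
  also have "deriv \<dots> (z k) = affine_exp N (v k * affine_exp_const b r v js + prod_list (map v js) * r k)
      (\<lambda>i. v k * (prod_list (map v js) * r i)) v w z"
    by (rule DERIV_imp_deriv[OF affine_exp_deriv[OF k]])
  finally show ?case by (simp add: mult.assoc)
qed

lemma has_all_partials_affine_exp:
  assumes eq: "\<And>z. z \<in> euclid N \<Longrightarrow> g z = affine_exp N b r v w z"
  shows "has_all_partials N g"
  unfolding has_all_partials_def
proof (intro allI impI ballI)
  fix js z j assume js: "set js \<subseteq> {1..N}" and z: "z \<in> euclid N" and j: "j \<in> {1..N}"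
  have e: "(\<lambda>s. partials js g (z(j := s))) = (\<lambda>s. affine_exp N (affine_exp_const b r v js)
      (\<lambda>i. prod_list (map v js) * r i) v w (z(j := s)))"
    using partials_affine_exp[OF eq js euclid_upd[OF z j]] by (rule ext)
  show "(\<lambda>s. partials js g (z(j := s))) differentiable at (z j)"
    unfolding e real_differentiable_def by (rule exI, rule affine_exp_deriv[OF j])
qed

lemma space_std_gaussian: "space (std_gaussian N) = euclid N"
  by (simp add: std_gaussian_def space_PiM euclid_def)

lemma std_gaussian_density:
  "(2 * pi) powr (- real N / 2) * exp (- (\<Sum>i=1..N. (z i)\<^sup>2) / 2) = (\<Prod>i=1..N. std_normal_density (z i))"
proof -
  have "(\<Prod>i=1..N. std_normal_density (z i)) = (1 / sqrt (2 * pi)) ^ N * exp (\<Sum>i=1..N. - (z i)\<^sup>2 / 2)"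
    unfolding std_normal_density_def prod.distrib by (simp only: exp_sum finite_atLeastAtMost prod_constant card_atLeastAtMost) simp
  moreover have "(1 / sqrt (2 * pi)) ^ N = (2 * pi) powr (- real N / 2)"
  proof -
    have "1 / sqrt (2 * pi) = (2 * pi) powr (- (1 / 2))"
      unfolding powr_minus by (subst powr_half_sqrt) (simp_all only: inverse_eq_divide, simp)
    hence "(1 / sqrt (2 * pi)) ^ N = ((2 * pi) powr (- (1 / 2))) ^ N" by (rule arg_cong)
    also have "\<dots> = ((2 * pi) powr (- (1 / 2))) powr real N"
      by (rule powr_realpow[symmetric]) simp
    also have "\<dots> = (2 * pi) powr (- (1 / 2) * real N)" by (rule powr_powr)
    also have "- (1 / 2) * real N = - real N / 2" by simp
    finally show ?thesis .
  qed
  moreover have "(\<Sum>i=1..N. - (z i)\<^sup>2 / 2) = - (\<Sum>i=1..N. (z i)\<^sup>2) / 2"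
    by (simp add: sum_negf sum_divide_distrib)
  ultimately show ?thesis by simp
qed

text \<open>
  Completing the square: an exponential weight shifts the Gaussian.
\<close>

lemma normal_density_shift:
  "std_normal_density x * exp (v * x) = exp (v\<^sup>2 / 2) * normal_density v 1 x"
proof -
  have "- x\<^sup>2 / 2 + v * x = v\<^sup>2 / 2 + (- (x - v)\<^sup>2 / 2)"
    by (simp add: power2_eq_square algebra_simps add_divide_distrib diff_divide_distrib)
  hence "exp (- x\<^sup>2 / 2) * exp (v * x) = exp (v\<^sup>2 / 2) * exp (- (x - v)\<^sup>2 / 2)"
    by (simp only: exp_add[symmetric])
  thus ?thesis by (simp add: normal_density_def)
qed

interpretation lborel_prod: product_sigma_finite "\<lambda>_::nat. lborel :: real measure"
  by standard

lemma shifted_gaussian_moments: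
  fixes v :: "nat \<Rightarrow> real"
  shows "integrable (PiM {1..N} (\<lambda>_. lborel)) (\<lambda>z. \<Prod>i=1..N. normal_density (v i) 1 (z i))"
    "(LINT z|PiM {1..N} (\<lambda>_. lborel). (\<Prod>i=1..N. normal_density (v i) 1 (z i))) = 1"
    "m \<in> {1..N} \<Longrightarrow> integrable (PiM {1..N} (\<lambda>_. lborel)) (\<lambda>z. z m * (\<Prod>i=1..N. normal_density (v i) 1 (z i)))"
    "m \<in> {1..N} \<Longrightarrow> (LINT z|PiM {1..N} (\<lambda>_. lborel). z m * (\<Prod>i=1..N. normal_density (v i) 1 (z i))) = v m"
proof -
  have i0: "integrable lborel (normal_density (v i) 1)" for i by simp
  show "integrable (PiM {1..N} (\<lambda>_. lborel)) (\<lambda>z. \<Prod>i=1..N. normal_density (v i) 1 (z i))"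
    by (rule lborel_prod.product_integrable_prod) (auto intro: i0)
  show "(LINT z|PiM {1..N} (\<lambda>_. lborel). (\<Prod>i=1..N. normal_density (v i) 1 (z i))) = 1"
    by (subst lborel_prod.product_integral_prod) auto
  assume m: "m \<in> {1..N}"
  define f where "f = (\<lambda>i x. if i = m then normal_density (v i) 1 x * x else normal_density (v i) 1 x)"
  have fi: "integrable lborel (f i)" for i
    using integrable_normal_moment_nz_1[of 1 "v i"] i0[of i] by (cases "i = m") (simp_all add: f_def)
  have fl: "(LINT x|lborel. f i x) = (if i = m then v m else 1)" for i
    using integral_normal_moment_nz_1[of 1 "v i"] by (cases "i = m") (simp_all add: f_def)
  have eq: "z m * (\<Prod>i=1..N. normal_density (v i) 1 (z i)) = (\<Prod>i=1..N. f i (z i))" for z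
  proof -
    have "(\<Prod>i\<in>{1..N}-{m}. f i (z i)) = (\<Prod>i\<in>{1..N}-{m}. normal_density (v i) 1 (z i))"
      by (rule prod.cong) (auto simp: f_def)
    moreover have "(\<Prod>i=1..N. h i) = h m * (\<Prod>i\<in>{1..N}-{m}. h i)" for h :: "nat \<Rightarrow> real"
      by (rule prod.remove) (use m in auto)
    ultimately show ?thesis by (simp add: f_def)
  qed
  show "integrable (PiM {1..N} (\<lambda>_. lborel)) (\<lambda>z. z m * (\<Prod>i=1..N. normal_density (v i) 1 (z i)))"
    unfolding eq by (rule lborel_prod.product_integrable_prod) (auto intro: fi)
  show "(LINT z|PiM {1..N} (\<lambda>_. lborel). z m * (\<Prod>i=1..N. normal_density (v i) 1 (z i))) = v m"
    unfolding eq using m by (subst lborel_prod.product_integral_prod) (auto intro: fi simp: fl)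
qed

text \<open>
  After the shift the integrand is an affine function against the Gaussian with mean \<open>v\<close>.
\<close>

lemma gaussian_affine_exp:
  assumes eq: "\<And>z. z \<in> euclid N \<Longrightarrow> g z = affine_exp N b r v w z"
  shows "integrable (std_gaussian N) g"
    and "(LINT z|std_gaussian N. g z)
      = (b + (\<Sum>i=1..N. r i * v i)) * exp ((\<Sum>i=1..N. (v i)\<^sup>2 / 2) + w)"
proof -
  let ?M = "PiM {1..N} (\<lambda>_. lborel :: real measure)"
  let ?n = "\<lambda>z. \<Prod>i=1..N. std_normal_density (z i)"
  let ?c = "exp ((\<Sum>i=1..N. (v i)\<^sup>2 / 2) + w)"
  let ?p = "\<lambda>z. \<Prod>i=1..N. normal_density (v i) 1 (z i)"
  let ?h = "\<lambda>z. ?c * (b * ?p z + (\<Sum>i=1..N. r i * (z i * ?p z)))"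
  have sg: "std_gaussian N = density ?M (\<lambda>z. ?n z)"
    unfolding std_gaussian_def std_gaussian_density ..
  have hi: "integrable ?M ?h"
    by (intro integrable_mult_right Bochner_Integration.integrable_add Bochner_Integration.integrable_sum
        shifted_gaussian_moments)
  have hl: "(LINT z|?M. ?h z) = ?c * (b + (\<Sum>i=1..N. r i * v i))"
  proof -
    have "(LINT z|?M. ?h z) = ?c * (b * (LINT z|?M. ?p z) + (\<Sum>i=1..N. r i * (LINT z|?M. z i * ?p z)))"
    proof (subst integral_mult_right_zero, subst Bochner_Integration.integral_add)
      show "integrable ?M (\<lambda>z. b * ?p z)" by (intro integrable_mult_right shifted_gaussian_moments)
      show "integrable ?M (\<lambda>z. \<Sum>i=1..N. r i * (z i * ?p z))"
        by (intro integrable_mult_right Bochner_Integration.integrable_sum shifted_gaussian_moments)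
      have "(LINT z|?M. (\<Sum>i=1..N. r i * (z i * ?p z))) = (\<Sum>i=1..N. LINT z|?M. r i * (z i * ?p z))"
        by (intro Bochner_Integration.integral_sum integrable_mult_right shifted_gaussian_moments)
      thus "?c * ((LINT z|?M. b * ?p z) + (LINT z|?M. (\<Sum>i=1..N. r i * (z i * ?p z))))
        = ?c * (b * (LINT z|?M. ?p z) + (\<Sum>i=1..N. r i * (LINT z|?M. z i * ?p z)))"
        by (simp only: integral_mult_right_zero)
    qed
    also have "\<dots> = ?c * (b * 1 + (\<Sum>i=1..N. r i * v i))"
      by (intro arg_cong2[where f="(*)"] arg_cong2[where f="(+)"] sum.cong refl)
         (use shifted_gaussian_moments in auto)
    finally show ?thesis by simp
  qed
  have h: "?n z * affine_exp N b r v w z = ?h z" for z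
  proof -
    have "?n z * exp (\<Sum>i=1..N. v i * z i) = (\<Prod>i=1..N. std_normal_density (z i) * exp (v i * z i))"
      by (simp add: exp_sum prod.distrib)
    also have "\<dots> = exp (\<Sum>i=1..N. (v i)\<^sup>2 / 2) * ?p z"
      by (simp only: normal_density_shift prod.distrib) (simp add: exp_sum)
    finally have e: "?n z * exp (\<Sum>i=1..N. v i * z i) = exp (\<Sum>i=1..N. (v i)\<^sup>2 / 2) * ?p z" .
    have "?n z * affine_exp N b r v w z
      = (b + (\<Sum>i=1..N. r i * z i)) * exp w * (?n z * exp (\<Sum>i=1..N. v i * z i))"
      by (simp only: affine_exp_def exp_add mult_ac)
    also have "\<dots> = ?c * (b * ?p z + (\<Sum>i=1..N. r i * z i) * ?p z)"
      unfolding e exp_add by (simp only: algebra_simps)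
    finally show ?thesis by (simp only: sum_distrib_right mult.assoc)
  qed
  have am: "affine_exp N b r v w \<in> borel_measurable ?M"
    unfolding affine_exp_def by measurable
  have nm: "?n \<in> borel_measurable ?M" by measurable
  have nn: "AE z in ?M. 0 \<le> ?n z" by (auto intro!: prod_nonneg AE_I2)
  have 1: "integrable (std_gaussian N) (affine_exp N b r v w)"
    unfolding sg by (rule integrable_density[THEN iffD2, OF am nm nn]) (use hi in \<open>simp only: real_scaleR_def h\<close>)
  have 2: "(LINT z|std_gaussian N. affine_exp N b r v w z) = ?c * (b + (\<Sum>i=1..N. r i * v i))"
    unfolding sg unfolding integral_density[OF am nm nn] real_scaleR_def h by (rule hl)
  show "integrable (std_gaussian N) g"
    using 1 by (subst Bochner_Integration.integrable_cong[OF refl eq]) (auto simp: space_std_gaussian)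
  have "(LINT z|std_gaussian N. g z) = (LINT z|std_gaussian N. affine_exp N b r v w z)"
    by (rule Bochner_Integration.integral_cong[OF refl eq]) (simp add: space_std_gaussian)
  thus "(LINT z|std_gaussian N. g z)
      = (b + (\<Sum>i=1..N. r i * v i)) * exp ((\<Sum>i=1..N. (v i)\<^sup>2 / 2) + w)"
    unfolding 2 by (simp only: mult_ac)
qed

context ou_data
begin

text \<open>
  The summand \<open>- (a k t)\<^sup>2 / 2\<close> is the Wick normalisation: it cancels the factor that the Gaussian
  expectation of \<open>exp (\<Sum> a k t * z k)\<close> produces.
\<close>

definition kap :: "real \<Rightarrow> real" where
  "kap t = (\<Sum>k=1..N. c k * d k * ou_F (\<alpha> k) t) - \<gamma> * t - (\<Sum>k=1..N. (a k t)\<^sup>2 / 2)"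

definition bet :: "real \<Rightarrow> real" where
  "bet t = S t - (\<Sum>k=1..N. q k t * a k t)"

definition U :: "real \<Rightarrow> (nat \<Rightarrow> real) \<Rightarrow> real" where
  "U t = affine_exp N (bet t) (\<lambda>k. q k t) (\<lambda>k. a k t) (kap t)"

text \<open>
  The recursion of \<open>affine_exp_const\<close> along a list, evaluated at the shifted mean, is the recursion of \<open>V\<close>
  when one label is added.
\<close>

lemma affine_exp_const_V:
  assumes "distinct ls"
  shows "affine_exp_const (bet t) (\<lambda>k. q k t) (\<lambda>k. a k t) (map j ls)
    + prod_list (map (\<lambda>k. a k t) (map j ls)) * (\<Sum>k=1..N. q k t * a k t) = V (set ls) j t
    \<and> prod_list (map (\<lambda>k. a k t) (map j ls)) = P (set ls) j t"
  using assms
proof (induction ls)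
  case Nil
  show ?case by (simp add: V_def P_def bet_def)
next
  case (Cons m ls)
  let ?s = "\<Sum>k=1..N. q k t * a k t"
  let ?b = "affine_exp_const (bet t) (\<lambda>k. q k t) (\<lambda>k. a k t) (map j ls)"
  let ?p = "prod_list (map (\<lambda>k. a k t) (map j ls))"
  have dl: "distinct ls" using Cons.prems by simp
  note IH = conjunct1[OF Cons.IH[OF dl]] conjunct2[OF Cons.IH[OF dl]]
  have "(a (j m) t * ?b + ?p * q (j m) t) + (a (j m) t * ?p) * ?s
     = a (j m) t * (?b + ?p * ?s) + q (j m) t * ?p"
    by (simp only: algebra_simps)
  also have "\<dots> = V (set (m # ls)) j t"
    using Cons.prems unfolding IH(1) unfolding IH(2) by (simp add: V_insert)
  finally show ?case using Cons.prems IH(2)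
    by (simp only: list.map list.set affine_exp_const.simps prod_list.Cons distinct.simps P_insert finite_set simp_thms)
qed

lemma gaussian_partials_coef:
  assumes eq: "\<And>z. z \<in> euclid N \<Longrightarrow> g z = U t z" and j: "j \<in> multi_idx N n"
  shows "integrable (std_gaussian N) (partials (map j [1..<n+1]) g)"
    "(LINT z|std_gaussian N. partials (map j [1..<n+1]) g z) = fact n * coef n j t"
proof -
  let ?js = "map j [1..<n+1]"
  have js: "set ?js \<subseteq> {1..N}" using j by (auto simp: multi_idx_def)
  note p = partials_affine_exp[OF eq[unfolded U_def] js]
  show "integrable (std_gaussian N) (partials ?js g)"
    by (rule gaussian_affine_exp(1)[OF p])
  let ?s = "\<Sum>k=1..N. q k t * a k t"
  let ?b = "affine_exp_const (bet t) (\<lambda>k. q k t) (\<lambda>k. a k t) ?js"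
  let ?p = "prod_list (map (\<lambda>k. a k t) ?js)"
  have "(LINT z|std_gaussian N. partials ?js g z)
     = (?b + (\<Sum>i=1..N. ?p * q i t * a i t)) * exp ((\<Sum>i=1..N. (a i t)\<^sup>2 / 2) + kap t)"
    by (rule gaussian_affine_exp(2)[OF p])
  also have "(\<Sum>i=1..N. ?p * q i t * a i t) = ?p * ?s"
    by (simp only: sum_distrib_left mult.assoc)
  also have "?b + ?p * ?s = V (set [1..<n+1]) j t"
    using affine_exp_const_V[OF distinct_upt, of t j 1 "n + 1"] by (rule conjunct1)
  also have "set [1..<n+1] = {1..n}" by auto
  also have "(\<Sum>i=1..N. (a i t)\<^sup>2 / 2) + kap t = (\<Sum>k=1..N. c k * d k * ou_F (\<alpha> k) t) - \<gamma> * t"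
    by (simp add: kap_def)
  finally show "(LINT z|std_gaussian N. partials ?js g z) = fact n * coef n j t"
    by (simp add: coef_def K_def)
qed

lemma gaussian_U:
  assumes eq: "\<And>z. z \<in> euclid N \<Longrightarrow> g z = U t z"
  shows "integrable (std_gaussian N) g" "(LINT z|std_gaussian N. g z) = coef 0 j t" "has_all_partials N g"
proof -
  have j: "(\<lambda>_. undefined) \<in> multi_idx N 0" by (auto simp: multi_idx_def)
  show "integrable (std_gaussian N) g"
    using gaussian_partials_coef(1)[OF eq j] by (simp add: partials_def)
  have "coef 0 j t = coef 0 (\<lambda>_. undefined) t" by (simp add: coef_def V_def P_def)
  thus "(LINT z|std_gaussian N. g z) = coef 0 j t"
    using gaussian_partials_coef(2)[OF eq j] by (simp add: partials_def)
  show "has_all_partials N g"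
    by (rule has_all_partials_affine_exp[OF eq[unfolded U_def]])
qed

lemma kap_deriv: "(kap has_real_derivative
    (\<Sum>k=1..N. d k * a k t + \<alpha> k * (a k t)\<^sup>2 - c k * a k t) - \<gamma>) (at t within A)"
proof -
  have "(kap has_real_derivative (\<Sum>k=1..N. c k * d k * ou_E (\<alpha> k) t) - \<gamma>
      - (\<Sum>k=1..N. a k t * (- \<alpha> k * a k t + c k))) (at t within A)"
  proof -
    have 1: "((\<lambda>t. \<Sum>k=1..N. c k * d k * ou_F (\<alpha> k) t) has_real_derivative
        (\<Sum>k=1..N. c k * d k * ou_E (\<alpha> k) t)) (at t within A)"
      by (intro DERIV_sum DERIV_cmult ou_F_deriv)
    have 2: "((\<lambda>t. \<gamma> * t) has_real_derivative \<gamma>) (at t within A)"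
      by (rule DERIV_cong[OF DERIV_cmult[OF DERIV_ident]]) simp
    have 3: "((\<lambda>t. \<Sum>k=1..N. (a k t)\<^sup>2 / 2) has_real_derivative
        (\<Sum>k=1..N. a k t * (- \<alpha> k * a k t + c k))) (at t within A)"
    proof (rule DERIV_sum)
      show "((\<lambda>t. (a k t)\<^sup>2 / 2) has_real_derivative a k t * (- \<alpha> k * a k t + c k)) (at t within A)" for k
        by (rule DERIV_cong[OF DERIV_cdivide[OF DERIV_power[OF a_deriv]]]) simp
    qed
    show ?thesis unfolding kap_def by (rule DERIV_diff[OF DERIV_diff[OF 1 2] 3])
  qed
  moreover have "(\<Sum>k=1..N. c k * d k * ou_E (\<alpha> k) t) - (\<Sum>k=1..N. a k t * (- \<alpha> k * a k t + c k))
      = (\<Sum>k=1..N. d k * a k t + \<alpha> k * (a k t)\<^sup>2 - c k * a k t)"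
    unfolding sum_subtractf[symmetric]
    by (intro sum.cong refl) (simp add: algebra_simps power2_eq_square a_def)
  ultimately show ?thesis by (elim DERIV_cong) linarith
qed

lemma bet_deriv: "(bet has_real_derivative
    (\<Sum>k=1..N. d k * q k t + 2 * \<alpha> k * q k t * a k t - c k * q k t)) (at t within A)"
proof -
  have "(bet has_real_derivative (\<Sum>k=1..N. d k * q k t)
      - (\<Sum>k=1..N. - \<alpha> k * q k t * a k t + (- \<alpha> k * a k t + c k) * q k t)) (at t within A)"
    unfolding bet_def by (auto intro!: derivative_eq_intros S_deriv a_deriv q_deriv sum.cong)
  moreover have "(\<Sum>k=1..N. d k * q k t)
      - (\<Sum>k=1..N. - \<alpha> k * q k t * a k t + (- \<alpha> k * a k t + c k) * q k t)
      = (\<Sum>k=1..N. d k * q k t + 2 * \<alpha> k * q k t * a k t - c k * q k t)"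
    unfolding sum_subtractf[symmetric] by (intro sum.cong refl) (simp add: algebra_simps)
  ultimately show ?thesis by simp
qed

lemma continuous_coefs:
  "continuous_on A (a k)" "continuous_on A (q k)" "continuous_on A bet" "continuous_on A kap"
  by (rule DERIV_continuous_on, rule a_deriv q_deriv bet_deriv kap_deriv)+

lemma continuous_affine_exp:
  fixes A :: "real set"
  assumes "continuous_on A b" "\<And>k. continuous_on A (r k)" "\<And>k. continuous_on A (v k)" "continuous_on A w"
  shows "continuous_on (A \<times> B) (\<lambda>(t, z). affine_exp N (b t) (\<lambda>k. r k t) (\<lambda>k. v k t) (w t) z)"
proof -
  have f: "continuous_on (A \<times> B) (\<lambda>x. f (fst x))" if "continuous_on A f" for f :: "real \<Rightarrow> real"
    by (rule continuous_on_compose2[OF that continuous_on_fst[OF continuous_on_id]]) auto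
  have s: "continuous_on (A \<times> B) (\<lambda>x. snd x i)" for i :: nat
    by (rule continuous_on_product_then_coordinatewise, rule continuous_on_snd[OF continuous_on_id])
  show ?thesis unfolding case_prod_unfold affine_exp_def
    by (intro continuous_intros f s assms)
qed

text \<open>
  Write \<open>U = p L\<close> with \<open>p\<close> affine and \<open>L\<close> the exponential. All derivatives are multiples of \<open>L\<close>, and after
  division by \<open>L\<close> the equation becomes an identity between sums over the modes, which holds summand by
  summand.
\<close>

lemma U_classical_solution:
  assumes eq: "\<And>t z. t \<ge> 0 \<Longrightarrow> z \<in> euclid N \<Longrightarrow> u t z = U t z"
  shows "ou_classical_solution N \<alpha> d c \<zeta> \<gamma> u"
proof -
  define b' where "b' t = (\<Sum>k=1..N. d k * q k t + 2 * \<alpha> k * q k t * a k t - c k * q k t)" for t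
  define k' where "k' t = (\<Sum>k=1..N. d k * a k t + \<alpha> k * (a k t)\<^sup>2 - c k * a k t) - \<gamma>" for t
  define L where "L t z = exp ((\<Sum>k=1..N. a k t * z k) + kap t)" for t z
  define p where "p t z = bet t + (\<Sum>k=1..N. q k t * z k)" for t z
  define ut where "ut t z = (b' t + (\<Sum>k=1..N. - \<alpha> k * q k t * z k)) * L t z
     + (p t z * ((\<Sum>k=1..N. (- \<alpha> k * a k t + c k) * z k) + k' t)) * L t z" for t z
  define D where "D i t = affine_exp N (a i t * bet t + q i t) (\<lambda>k. a i t * q k t) (\<lambda>k. a k t) (kap t)" for i t
  define DD where "DD i j t = affine_exp N (a j t * (a i t * bet t + q i t) + a i t * q j t)
     (\<lambda>k. a j t * (a i t * q k t)) (\<lambda>k. a k t) (kap t)" for i j t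
  have U_pL: "U t z = p t z * L t z" for t z by (simp add: U_def affine_exp_def p_def L_def)
  have Ut: "((\<lambda>s. U s z) has_real_derivative ut t z) (at t within {0..})" for t z
  proof -
    have 1: "((\<lambda>s. p s z) has_real_derivative b' t + (\<Sum>k=1..N. - \<alpha> k * q k t * z k)) (at t within {0..})"
      unfolding p_def b'_def
      by (intro DERIV_add bet_deriv DERIV_sum DERIV_cmult_right q_deriv)
    have "((\<lambda>s. (\<Sum>k=1..N. a k s * z k) + kap s) has_real_derivative
         (\<Sum>k=1..N. (- \<alpha> k * a k t + c k) * z k) + k' t) (at t within {0..})"
      unfolding k'_def by (intro DERIV_add kap_deriv DERIV_sum DERIV_cmult_right a_deriv)
    hence 2: "((\<lambda>s. L s z) has_real_derivative L t z * ((\<Sum>k=1..N. (- \<alpha> k * a k t + c k) * z k) + k' t)) (at t within {0..})"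
      unfolding L_def by (rule DERIV_chain2[OF DERIV_exp])
    show ?thesis unfolding U_pL ut_def
      by (rule DERIV_cong[OF DERIV_mult[OF 1 2]]) (simp only: mult_ac add_ac)
  qed
  have cont: "continuous_on ({0..} \<times> B) (\<lambda>x. f (fst x))" if "continuous_on {0..} f" for f :: "real \<Rightarrow> real" and B :: "(nat \<Rightarrow> real) set"
    by (rule continuous_on_compose2[OF that continuous_on_fst[OF continuous_on_id]]) auto
  have cs: "continuous_on (A \<times> B) (\<lambda>x. snd x i)" for i :: nat and A :: "real set" and B :: "(nat \<Rightarrow> real) set"
    by (rule continuous_on_product_then_coordinatewise, rule continuous_on_snd[OF continuous_on_id])
  have D_pL: "D i t z = (q i t + a i t * p t z) * L t z" for i t z
  proof -
    have "(\<Sum>k=1..N. a i t * q k t * z k) = a i t * (\<Sum>k=1..N. q k t * z k)"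
      by (simp only: sum_distrib_left mult.assoc)
    thus ?thesis by (simp add: D_def affine_exp_def p_def L_def algebra_simps)
  qed
  have DD_pL: "DD k k t z = (2 * a k t * q k t + (a k t)\<^sup>2 * p t z) * L t z" for k t z
  proof -
    have "(\<Sum>i=1..N. a k t * (a k t * q i t) * z i) = (a k t)\<^sup>2 * (\<Sum>i=1..N. q i t * z i)"
      by (simp only: sum_distrib_left mult.assoc power2_eq_square)
    thus ?thesis by (simp add: DD_def affine_exp_def p_def L_def algebra_simps power2_eq_square)
  qed
  have pde: "ut t z = (\<Sum>k=1..N. \<alpha> k * DD k k t z)
        + (\<Sum>k=1..N. (d k - c k - \<alpha> k * z k) * D k t z)
        + ((\<Sum>k=1..N. c k * z k) - \<gamma>) * U t z" for t z
  proof -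
    let ?p = "p t z"
    have aux: "r * (x + (y - h)) = r * x + r * y - r * h" for r x y h :: real by (simp add: algebra_simps)
    have "(b' t + (\<Sum>k=1..N. - \<alpha> k * q k t * z k)) + (?p * ((\<Sum>k=1..N. (- \<alpha> k * a k t + c k) * z k) + k' t))
      = (\<Sum>k=1..N. (d k * q k t + 2 * \<alpha> k * q k t * a k t - c k * q k t) + - \<alpha> k * q k t * z k
           + ?p * ((- \<alpha> k * a k t + c k) * z k) + ?p * (d k * a k t + \<alpha> k * (a k t)\<^sup>2 - c k * a k t)) - ?p * \<gamma>"
      unfolding b'_def k'_def aux by (simp only: sum_distrib_left sum.distrib add_diff_eq add.assoc)
    also have "\<dots> = (\<Sum>k=1..N. \<alpha> k * (2 * a k t * q k t + (a k t)\<^sup>2 * ?p)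
        + (d k - c k - \<alpha> k * z k) * (q k t + a k t * ?p) + c k * z k * ?p) - ?p * \<gamma>"
      by (intro arg_cong2[where f="(-)"] sum.cong refl) (simp add: algebra_simps power2_eq_square)
    also have "\<dots> = (\<Sum>k=1..N. \<alpha> k * (2 * a k t * q k t + (a k t)\<^sup>2 * ?p))
        + (\<Sum>k=1..N. (d k - c k - \<alpha> k * z k) * (q k t + a k t * ?p)) + ((\<Sum>k=1..N. c k * z k) - \<gamma>) * ?p"
      by (simp only: sum.distrib sum_distrib_right[symmetric] left_diff_distrib mult.commute[of \<gamma>])
    finally show ?thesis unfolding DD_pL D_pL U_pL ut_def
      by (simp only: mult.assoc[symmetric] sum_distrib_right[symmetric] distrib_right[symmetric])
  qed
  show ?thesis unfolding ou_classical_solution_def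
  proof (intro exI[of _ ut] exI[of _ D] exI[of _ DD] conjI ballI allI impI)
    have "continuous_on ({0..} \<times> euclid N) (\<lambda>(t, z). U t z)"
      unfolding U_def by (rule continuous_affine_exp) (rule continuous_coefs)+
    thus "continuous_on ({0..} \<times> euclid N) (\<lambda>(t, z). u t z)"
      by (rule continuous_on_eq) (auto simp: eq)
    show "continuous_on ({0..} \<times> euclid N) (\<lambda>(t, z). ut t z)"
      unfolding ut_def case_prod_unfold L_def p_def b'_def k'_def
      by (intro continuous_intros cont cs continuous_coefs)
    show "continuous_on ({0..} \<times> euclid N) (\<lambda>(t, z). D i t z)" for i
      unfolding D_def by (rule continuous_affine_exp) (intro continuous_intros continuous_coefs)+
    show "continuous_on ({0..} \<times> euclid N) (\<lambda>(t, z). DD i j t z)" for i j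
      unfolding DD_def by (rule continuous_affine_exp) (intro continuous_intros continuous_coefs)+
    fix t z assume t: "0 \<le> (t::real)" and z: "z \<in> euclid N"
    show "((\<lambda>s. u s z) has_real_derivative ut t z) (at t within {0..})"
      by (rule has_field_derivative_transform_within[OF Ut zero_less_one]) (use t eq z in auto)
    show "((\<lambda>s. u t (z(i := s))) has_real_derivative D i t z) (at (z i))" if i: "i \<in> {1..N}" for i
      using affine_exp_deriv[OF i] unfolding D_def eq[OF t euclid_upd[OF z i]] U_def .
    show "((\<lambda>s. D i t (z(j := s))) has_real_derivative DD i j t z) (at (z j))" if j: "j \<in> {1..N}" for i j
      using affine_exp_deriv[OF j] unfolding D_def DD_def .
    show "ut t z = (\<Sum>k=1..N. \<alpha> k * DD k k t z)
        + (\<Sum>k=1..N. (d k - c k - \<alpha> k * z k) * D k t z)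
        + ((\<Sum>k=1..N. c k * z k) - \<gamma>) * u t z"
      using pde eq[OF t z] by simp
  next
    fix z assume z: "z \<in> euclid N"
    show "u 0 z = (\<Sum>k=1..N. \<zeta> k * z k)"
      using eq[OF order.refl z] by (simp add: U_def affine_exp_def bet_def kap_def S_def a_def q_def)
  qed
qed

end

section \<open>Exponential moments of limits of Wiener sums\<close>

text \<open>
  The case \<open>s = t\<close> is included because the cells of the grid on \<open>[0, 0]\<close> have length 0.
\<close>

lemma (in prob_space) char_gaussian_increment:
  assumes B: "brownian_motion M W" and st: "0 \<le> s" "s \<le> t"
  shows "char (distr M borel (\<lambda>\<omega>. g * (W t \<omega> - W s \<omega>))) \<theta> = complex_of_real (exp (- \<theta>\<^sup>2 * (g\<^sup>2 * (t - s)) / 2))"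
proof (cases "s = t")
  case True
  thus ?thesis by (simp add: char_def integral_distr prob_space del: distr_const)
next
  case False
  hence lt: "s < t" using st by simp
  have mW[measurable]: "W s \<in> borel_measurable M" "W t \<in> borel_measurable M"
    using B st by (auto simp: brownian_motion_def)
  define \<sigma> where "\<sigma> = sqrt (t - s)"
  have \<sigma>: "\<sigma> > 0" "\<sigma>\<^sup>2 = t - s" using lt by (auto simp: \<sigma>_def)
  have "distributed M lborel (\<lambda>\<omega>. W t \<omega> - W s \<omega>) (normal_density 0 \<sigma>)"
    using B lt st unfolding brownian_motion_def \<sigma>_def by blast
  hence Z: "distributed M lborel (\<lambda>\<omega>. (W t \<omega> - W s \<omega>) / \<sigma>) std_normal_density"
    using normal_standard_normal_convert[OF \<sigma>(1), of "\<lambda>\<omega>. W t \<omega> - W s \<omega>" 0] by simp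
  have "std_normal_distribution = distr M lborel (\<lambda>\<omega>. (W t \<omega> - W s \<omega>) / \<sigma>)"
    using distributed_distr_eq_density[OF Z] by simp
  also have "\<dots> = distr M borel (\<lambda>\<omega>. (W t \<omega> - W s \<omega>) / \<sigma>)"
    by (rule distr_cong) auto
  finally have d: "std_normal_distribution = distr M borel (\<lambda>\<omega>. (W t \<omega> - W s \<omega>) / \<sigma>)" .
  have "char (distr M borel (\<lambda>\<omega>. g * (W t \<omega> - W s \<omega>))) \<theta> = (CLINT \<omega>|M. iexp (\<theta> * (g * (W t \<omega> - W s \<omega>))))"
    unfolding char_def by (subst integral_distr) auto
  also have "\<dots> = (CLINT \<omega>|M. iexp ((\<theta> * g * \<sigma>) * ((W t \<omega> - W s \<omega>) / \<sigma>)))"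
    using \<sigma> by (intro Bochner_Integration.integral_cong refl) simp
  also have "\<dots> = char std_normal_distribution (\<theta> * g * \<sigma>)"
    unfolding d char_def by (subst integral_distr) auto
  also have "\<dots> = complex_of_real (exp (- (\<theta> * g * \<sigma>)\<^sup>2 / 2))"
    by (simp add: char_std_normal_distribution)
  also have "(\<theta> * g * \<sigma>)\<^sup>2 = \<theta>\<^sup>2 * (g\<^sup>2 * (t - s))"
    unfolding power_mult_distrib \<sigma>(2) by simp
  finally show ?thesis by simp
qed

lemma (in prob_space) char_wiener_sum:
  fixes G :: "nat \<Rightarrow> real \<Rightarrow> real" and W :: "nat \<Rightarrow> real \<Rightarrow> 'a \<Rightarrow> real"
  assumes B: "independent_brownian_motions M N W" and t: "0 \<le> t"
  shows "char (distr M borel (\<lambda>\<omega>. \<Sum>i=1..N. \<Sum>k\<le>n. G i (grid 0 t n k) * (W i (grid 0 t n (Suc k)) \<omega> - W i (grid 0 t n k) \<omega>))) \<theta>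
    = complex_of_real (exp (- \<theta>\<^sup>2 * (\<Sum>i=1..N. \<Sum>k\<le>n. (G i (grid 0 t n k))\<^sup>2 * (grid 0 t n (Suc k) - grid 0 t n k)) / 2))"
proof -
  let ?g = "grid 0 t n"
  have g0: "0 \<le> ?g k" for k using t by (simp add: grid_def)
  have BW: "brownian_motion M (W i)" if "i \<in> {1..N}" for i
    using B that by (auto simp: independent_brownian_motions_def)
  define \<Phi> where "\<Phi> = (\<lambda>i (p::real \<Rightarrow> real). \<Sum>k\<le>n. G i (?g k) * (p (?g (Suc k)) - p (?g k)))"
  have \<Phi>m: "\<Phi> i \<in> borel_measurable (PiM {0..} (\<lambda>_. borel))" for i
    unfolding \<Phi>_def
    by (intro borel_measurable_sum borel_measurable_times borel_measurable_const borel_measurable_diff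
        measurable_component_singleton) (auto simp: g0)
  have "indep_vars (\<lambda>_. borel) (\<lambda>i \<omega>. \<Phi> i (\<lambda>t\<in>{0..}. W i t \<omega>)) {1..N}"
  proof (rule indep_vars_compose2[where M' = "\<lambda>_. PiM {0..} (\<lambda>_. borel)" and X = "\<lambda>i \<omega>. \<lambda>t\<in>{0..}. W i t \<omega>" and Y = \<Phi>])
    show "indep_vars (\<lambda>_. PiM {0..} (\<lambda>_. borel)) (\<lambda>i \<omega>. \<lambda>t\<in>{0..}. W i t \<omega>) {1..N}"
      using B unfolding independent_brownian_motions_def by (rule conjunct2)
  qed (rule \<Phi>m)
  hence ind: "indep_vars (\<lambda>_. borel) (\<lambda>i \<omega>. \<Sum>k\<le>n. G i (?g k) * (W i (?g (Suc k)) \<omega> - W i (?g k) \<omega>)) {1..N}"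
    unfolding \<Phi>_def restrict_apply' [OF atLeast_iff[THEN iffD2, OF g0]] .
  have "char (distr M borel (\<lambda>\<omega>. \<Sum>k\<le>n. G i (?g k) * (W i (?g (Suc k)) \<omega> - W i (?g k) \<omega>))) \<theta>
      = (\<Prod>k\<le>n. complex_of_real (exp (- \<theta>\<^sup>2 * ((G i (?g k))\<^sup>2 * (?g (Suc k) - ?g k)) / 2)))" if i: "i \<in> {1..N}" for i
  proof -
    have "indep_vars (\<lambda>_. borel) (\<lambda>k \<omega>. W i (?g (Suc k)) \<omega> - W i (?g k) \<omega>) {..<Suc n}"
      using BW[OF i] t grid_le_Suc[OF t] unfolding brownian_motion_def by simp
    hence "indep_vars (\<lambda>_. borel) (\<lambda>k \<omega>. G i (?g k) * (W i (?g (Suc k)) \<omega> - W i (?g k) \<omega>)) {..<Suc n}"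
      by (rule indep_vars_compose2) auto
    hence ind': "indep_vars (\<lambda>_. borel) (\<lambda>k \<omega>. G i (?g k) * (W i (?g (Suc k)) \<omega> - W i (?g k) \<omega>)) {..n}"
      by (simp add: lessThan_Suc_atMost)
    show ?thesis unfolding char_distr_sum[OF ind']
      by (intro prod.cong refl char_gaussian_increment[OF BW[OF i] g0 grid_le_Suc[OF t]])
  qed
  hence "char (distr M borel (\<lambda>\<omega>. \<Sum>i=1..N. \<Sum>k\<le>n. G i (?g k) * (W i (?g (Suc k)) \<omega> - W i (?g k) \<omega>))) \<theta>
     = (\<Prod>i=1..N. \<Prod>k\<le>n. complex_of_real (exp (- \<theta>\<^sup>2 * ((G i (?g k))\<^sup>2 * (?g (Suc k) - ?g k)) / 2)))"
    unfolding char_distr_sum[OF ind] by (intro prod.cong refl)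
  also have "\<dots> = complex_of_real (exp (\<Sum>i=1..N. \<Sum>k\<le>n. - \<theta>\<^sup>2 * ((G i (?g k))\<^sup>2 * (?g (Suc k) - ?g k)) / 2))"
    by (simp add: exp_sum)
  also have "(\<Sum>i=1..N. \<Sum>k\<le>n. - \<theta>\<^sup>2 * ((G i (?g k))\<^sup>2 * (?g (Suc k) - ?g k)) / 2)
    = - \<theta>\<^sup>2 * (\<Sum>i=1..N. \<Sum>k\<le>n. (G i (?g k))\<^sup>2 * (?g (Suc k) - ?g k)) / 2"
    by (simp only: sum_distrib_left sum_divide_distrib)
  finally show ?thesis .
qed

lemma std_normal_exp:
  "integrable std_normal_distribution (\<lambda>x. exp (v * x))"
  "(LINT x|std_normal_distribution. exp (v * x)) = exp (v\<^sup>2 / 2)"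
proof -
  have i: "integrable lborel (\<lambda>x. exp (v\<^sup>2 / 2) * normal_density v 1 x)" by simp
  show "integrable std_normal_distribution (\<lambda>x. exp (v * x))"
    by (subst integrable_density) (use i in \<open>auto simp: normal_density_shift\<close>)
  show "(LINT x|std_normal_distribution. exp (v * x)) = exp (v\<^sup>2 / 2)"
    by (subst integral_density) (auto simp: normal_density_shift)
qed

text \<open>
  Exponentials are unbounded, so almost sure convergence does not transfer to their expectations
  directly. Characteristic functions do converge and identify the law of the limit, from which the
  exponential moment is computed. Writing that law as the image of the standard normal law under
  multiplication by \<open>sqrt w\<close> treats the degenerate case \<open>w = 0\<close> on the same footing.
\<close>

lemma (in prob_space) gaussian_limit_exp:
  assumes Ym: "\<And>n. Yn n \<in> borel_measurable M" "Y \<in> borel_measurable M"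
    and lim: "AE \<omega> in M. (\<lambda>n. Yn n \<omega>) \<longlonglongrightarrow> Y \<omega>"
    and ch: "\<And>n \<theta>. char (distr M borel (Yn n)) \<theta> = complex_of_real (exp (- \<theta>\<^sup>2 * v n / 2))"
    and v: "v \<longlonglongrightarrow> w" and w: "0 \<le> w"
  shows "integrable M (\<lambda>\<omega>. exp (Y \<omega>))" "(LINT \<omega>|M. exp (Y \<omega>)) = exp (w / 2)"
proof -
  note [measurable] = Ym
  have ch': "char (distr M borel Y) \<theta> = complex_of_real (exp (- \<theta>\<^sup>2 * w / 2))" for \<theta>
  proof (rule LIMSEQ_unique)
    have "(\<lambda>n. CLINT \<omega>|M. iexp (\<theta> * Yn n \<omega>)) \<longlonglongrightarrow> (CLINT \<omega>|M. iexp (\<theta> * Y \<omega>))"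
    proof (rule integral_dominated_convergence[where w = "\<lambda>_. 1"])
      show "AE \<omega> in M. (\<lambda>n. iexp (\<theta> * Yn n \<omega>)) \<longlonglongrightarrow> iexp (\<theta> * Y \<omega>)"
        using lim by eventually_elim (intro tendsto_intros)
    qed auto
    thus "(\<lambda>n. char (distr M borel (Yn n)) \<theta>) \<longlonglongrightarrow> char (distr M borel Y) \<theta>"
      unfolding char_def by (simp add: integral_distr)
    show "(\<lambda>n. char (distr M borel (Yn n)) \<theta>) \<longlonglongrightarrow> complex_of_real (exp (- \<theta>\<^sup>2 * w / 2))"
      unfolding ch by (intro tendsto_intros v) auto
  qed
  interpret std: real_distribution std_normal_distribution by (rule real_dist_normal_dist)
  have "distr M borel Y = distr std_normal_distribution borel (\<lambda>x. sqrt w * x)"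
  proof (rule Levy_uniqueness)
    show "real_distribution (distr M borel Y)" by (rule real_distribution_distr) auto
    show "real_distribution (distr std_normal_distribution borel (\<lambda>x. sqrt w * x))"
      by (rule std.real_distribution_distr) auto
    show "char (distr M borel Y) = char (distr std_normal_distribution borel (\<lambda>x. sqrt w * x))"
    proof
      fix \<theta>
      have "char (distr std_normal_distribution borel (\<lambda>x. sqrt w * x)) \<theta>
         = (CLINT x|std_normal_distribution. iexp (\<theta> * (sqrt w * x)))"
        unfolding char_def by (subst integral_distr) auto
      also have "\<dots> = char std_normal_distribution (\<theta> * sqrt w)"
        unfolding char_def by (simp only: mult.assoc)
      also have "\<dots> = complex_of_real (exp (- \<theta>\<^sup>2 * w / 2))"
        using w by (simp add: char_std_normal_distribution power_mult_distrib)
      finally show "char (distr M borel Y) \<theta> = char (distr std_normal_distribution borel (\<lambda>x. sqrt w * x)) \<theta>"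
        using ch' by simp
    qed
  qed
  note d = this
  have "integrable (distr std_normal_distribution borel (\<lambda>x. sqrt w * x)) exp"
    by (subst integrable_distr_eq) (use std_normal_exp(1) in auto)
  hence "integrable (distr M borel Y) exp" unfolding d .
  thus "integrable M (\<lambda>\<omega>. exp (Y \<omega>))" by (subst (asm) integrable_distr_eq) auto
  have "(LINT \<omega>|M. exp (Y \<omega>)) = (LINT x|distr M borel Y. exp x)"
    by (subst integral_distr) auto
  also have "\<dots> = (LINT x|std_normal_distribution. exp (sqrt w * x))"
    unfolding d by (subst integral_distr) auto
  also have "\<dots> = exp (w / 2)" using w by (simp add: std_normal_exp)
  finally show "(LINT \<omega>|M. exp (Y \<omega>)) = exp (w / 2)" .
qed

lemma abs_exp_minus_one_le: "\<bar>exp y - 1\<bar> \<le> \<bar>y\<bar> * exp \<bar>y\<bar>" for y :: real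
proof (cases "y \<ge> 0")
  case True
  have "exp y * (1 - exp (- y)) \<le> exp y * y"
    using exp_ge_add_one_self[of "- y"] by (intro mult_left_mono) auto
  hence "exp y - 1 \<le> exp y * y" by (simp add: right_diff_distrib exp_minus)
  moreover have "exp y \<ge> 1" using True by simp
  ultimately show ?thesis using True by (simp add: mult.commute)
next
  case False
  have "1 - exp y \<le> - y" using exp_ge_add_one_self[of y] by linarith
  also have "\<dots> \<le> - y * exp (- y)" using False by simp
  finally show ?thesis using False by auto
qed

text \<open>
  Both sides are derivatives at \<open>\<theta> = 0\<close>. The difference quotients are dominated because the exponential
  moments are finite for all \<open>\<theta>\<close>, in particular for \<open>2\<close> and \<open>-2\<close>.
\<close>

lemma exp_tilted_expectation:
  fixes V Y :: "'a \<Rightarrow> real"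
  assumes [measurable]: "V \<in> borel_measurable M" "Y \<in> borel_measurable M"
    and int: "\<And>\<theta>. integrable M (\<lambda>\<omega>. exp (V \<omega> + \<theta> * Y \<omega>))"
    and val: "\<And>\<theta>. (LINT \<omega>|M. exp (V \<omega> + \<theta> * Y \<omega>)) = exp (A + B * \<theta> + C * \<theta>\<^sup>2)"
  shows "(LINT \<omega>|M. Y \<omega> * exp (V \<omega>)) = B * exp A"
proof (rule LIMSEQ_unique)
  define \<theta> :: "nat \<Rightarrow> real" where "\<theta> n = 1 / real (Suc n)" for n
  have \<theta>: "0 < \<theta> n" "\<theta> n \<le> 1" for n by (auto simp: \<theta>_def)
  have \<theta>0: "\<theta> \<longlonglongrightarrow> 0" unfolding \<theta>_def using LIMSEQ_inverse_real_of_nat by (simp add: inverse_eq_divide)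
  have quot: "(\<lambda>n. (f (\<theta> n) - f 0) / \<theta> n) \<longlonglongrightarrow> D" if "(f has_real_derivative D) (at 0)" for f :: "real \<Rightarrow> real" and D
  proof -
    have "((\<lambda>h. (f (0 + h) - f 0) / h) \<longlongrightarrow> D) (at 0)" using that by (simp add: DERIV_def)
    moreover have "filterlim \<theta> (at 0) sequentially"
      using \<theta>0 \<theta>(1) by (auto simp: filterlim_at eventually_sequentially less_imp_neq[symmetric])
    ultimately show ?thesis using filterlim_compose by fastforce
  qed
  let ?f = "\<lambda>n \<omega>. (exp (V \<omega> + \<theta> n * Y \<omega>) - exp (V \<omega> + 0 * Y \<omega>)) / \<theta> n"
  show "(\<lambda>n. LINT \<omega>|M. ?f n \<omega>) \<longlonglongrightarrow> (LINT \<omega>|M. Y \<omega> * exp (V \<omega>))"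
  proof (rule integral_dominated_convergence[where w = "\<lambda>\<omega>. exp (V \<omega> + 2 * Y \<omega>) + exp (V \<omega> + (- 2) * Y \<omega>)"])
    show "integrable M (\<lambda>\<omega>. exp (V \<omega> + 2 * Y \<omega>) + exp (V \<omega> + (- 2) * Y \<omega>))"
      by (intro Bochner_Integration.integrable_add int)
    have "(\<lambda>n. ?f n \<omega>) \<longlonglongrightarrow> Y \<omega> * exp (V \<omega>)" for \<omega>
    proof (rule quot[of "\<lambda>h. exp (V \<omega> + h * Y \<omega>)"])
      show "((\<lambda>h. exp (V \<omega> + h * Y \<omega>)) has_real_derivative Y \<omega> * exp (V \<omega>)) (at 0)"
        by (auto intro!: derivative_eq_intros)
    qed
    thus "AE \<omega> in M. (\<lambda>n. ?f n \<omega>) \<longlonglongrightarrow> Y \<omega> * exp (V \<omega>)" by simp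
    show "AE \<omega> in M. norm (?f n \<omega>) \<le> exp (V \<omega> + 2 * Y \<omega>) + exp (V \<omega> + (- 2) * Y \<omega>)" for n
    proof (rule AE_I2)
      fix \<omega>
      let ?y = "\<bar>Y \<omega>\<bar>"
      have "?f n \<omega> = exp (V \<omega>) * ((exp (\<theta> n * Y \<omega>) - 1) / \<theta> n)"
        by (simp add: exp_add right_diff_distrib)
      hence "norm (?f n \<omega>) = exp (V \<omega>) * (\<bar>exp (\<theta> n * Y \<omega>) - 1\<bar> / \<theta> n)"
        using \<theta>(1)[of n] by (simp add: abs_mult)
      also have "\<dots> \<le> exp (V \<omega>) * ((\<bar>\<theta> n * Y \<omega>\<bar> * exp \<bar>\<theta> n * Y \<omega>\<bar>) / \<theta> n)"
        using \<theta>(1)[of n] by (intro mult_left_mono divide_right_mono abs_exp_minus_one_le) auto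
      also have "\<dots> = exp (V \<omega>) * (?y * exp (\<theta> n * ?y))"
        using \<theta>(1)[of n] by (simp add: abs_mult)
      also have "\<dots> \<le> exp (V \<omega>) * (exp ?y * exp (1 * ?y))"
      proof -
        have "?y \<le> exp ?y" using exp_ge_add_one_self[of ?y] by linarith
        moreover have "exp (\<theta> n * ?y) \<le> exp (1 * ?y)" using \<theta>(2)[of n] mult_right_mono[of "\<theta> n" 1 ?y] by simp
        ultimately show ?thesis by (intro mult_left_mono mult_mono) auto
      qed
      also have "\<dots> = exp (V \<omega> + 2 * ?y)" by (simp add: exp_add[symmetric])
      also have "\<dots> \<le> exp (V \<omega> + 2 * Y \<omega>) + exp (V \<omega> + (- 2) * Y \<omega>)"
        by (cases "Y \<omega> \<ge> 0") auto
      finally show "norm (?f n \<omega>) \<le> exp (V \<omega> + 2 * Y \<omega>) + exp (V \<omega> + (- 2) * Y \<omega>)" .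
    qed
  qed auto
  have "(LINT \<omega>|M. ?f n \<omega>) = (exp (A + B * \<theta> n + C * (\<theta> n)\<^sup>2) - exp (A + B * 0 + C * 0\<^sup>2)) / \<theta> n" for n
    unfolding val[symmetric]
    by (subst Bochner_Integration.integral_diff[symmetric]) (auto intro: int int[of 0, simplified])
  moreover have "(\<lambda>n. (exp (A + B * \<theta> n + C * (\<theta> n)\<^sup>2) - exp (A + B * 0 + C * 0\<^sup>2)) / \<theta> n) \<longlonglongrightarrow> B * exp A"
    by (rule quot[of "\<lambda>h. exp (A + B * h + C * h\<^sup>2)"]) (auto intro!: derivative_eq_intros)
  ultimately show "(\<lambda>n. LINT \<omega>|M. ?f n \<omega>) \<longlonglongrightarrow> B * exp A" by (simp only:)
qed

lemma integral_eq_lebesgue_on: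
  fixes f :: "real \<Rightarrow> real"
  assumes "continuous_on {a..b} f"
  shows "(LINT s|lebesgue_on {a..b}. f s) = integral {a..b} f"
  by (rule lebesgue_integral_eq_integral[OF continuous_imp_integrable_real[OF assms]]) simp

text \<open>
  The integral \<open>I s\<close> of the path satisfies \<open>I' + al I = z + b s + \<sigma> w s\<close>; this is solved with the
  integrating factor \<open>exp (al * s)\<close>. Working with \<open>I\<close> rather than \<open>x\<close> keeps everything differentiable
  although \<open>w\<close> is not.
\<close>

lemma ou_path:
  fixes x w :: "real \<Rightarrow> real"
  assumes t: "0 \<le> t" and x: "continuous_on {0..t} x" and w: "continuous_on {0..t} w"
    and eq: "\<And>s. s \<in> {0..t} \<Longrightarrow> x s = z + (LINT r|lebesgue_on {0..s}. b - al * x r) + \<sigma> * w s"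
  shows "integral {0..t} x = z * ou_E al t + b * ou_F al t + \<sigma> * integral {0..t} (\<lambda>s. w s * exp (- al * (t - s)))"
    and "x t = z + b * t - al * integral {0..t} x + \<sigma> * w t"
proof -
  let ?I = "\<lambda>s. integral {0..s} x"
  have eq': "x s = z + b * s - al * ?I s + \<sigma> * w s" if s: "s \<in> {0..t}" for s
  proof -
    have c: "continuous_on {0..s} x" using continuous_on_subset[OF x] s by auto
    have "(LINT r|lebesgue_on {0..s}. b - al * x r) = integral {0..s} (\<lambda>r. b - al * x r)"
      by (intro integral_eq_lebesgue_on continuous_intros c)
    also have "\<dots> = integral {0..s} (\<lambda>r. b) - integral {0..s} (\<lambda>r. al * x r)"
      by (intro Henstock_Kurzweil_Integration.integral_diff integrable_continuous_real continuous_intros c)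
    also have "\<dots> = b * s - al * ?I s" using s by simp
    finally show ?thesis using eq[OF s] by simp
  qed
  show "x t = z + b * t - al * ?I t + \<sigma> * w t" using eq' t by simp
  \<comment> \<open>the solution for \<open>w = 0\<close>, multiplied by the integrating factor\<close>
  define k where "k s = exp (al * s) * (z * ou_E al s + b * ou_F al s)" for s
  define h where "h s = exp (al * s) * ?I s - k s" for s
  have dk: "(k has_real_derivative exp (al * s) * (z + b * s)) (at s within {0..t})" for s
  proof -
    have "(k has_real_derivative al * exp (al * s) * (z * ou_E al s + b * ou_F al s)
       + exp (al * s) * (z * exp (- al * s) + b * ou_E al s)) (at s within {0..t})"
      unfolding k_def by (auto intro!: derivative_eq_intros)
    moreover have "al * exp (al * s) * (z * ou_E al s + b * ou_F al s)
       + exp (al * s) * (z * exp (- al * s) + b * ou_E al s) = exp (al * s) * (z + b * s)"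
    proof -
      have "al * exp (al * s) * (z * ou_E al s + b * ou_F al s)
       + exp (al * s) * (z * exp (- al * s) + b * ou_E al s)
       = exp (al * s) * (z * (al * ou_E al s) + b * (al * ou_F al s) + z * exp (- al * s) + b * ou_E al s)"
        by (simp only: algebra_simps)
      also have "\<dots> = exp (al * s) * (z + b * s)"
        unfolding ou_F_eq exp_eq_ou_E by (simp add: algebra_simps)
      finally show ?thesis .
    qed
    ultimately show ?thesis by simp
  qed
  have dh: "(h has_real_derivative \<sigma> * (w s * exp (al * s))) (at s within {0..t})" if s: "s \<in> {0..t}" for s
  proof -
    have "(h has_real_derivative (al * exp (al * s) * ?I s + exp (al * s) * x s) - exp (al * s) * (z + b * s)) (at s within {0..t})"
      unfolding h_def by (auto intro!: derivative_eq_intros dk integral_has_real_derivative[OF x s])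
    moreover have "(al * exp (al * s) * ?I s + exp (al * s) * x s) - exp (al * s) * (z + b * s) = \<sigma> * (w s * exp (al * s))"
      unfolding eq'[OF s] by (simp add: algebra_simps)
    ultimately show ?thesis by simp
  qed
  have "((\<lambda>s. \<sigma> * (w s * exp (al * s))) has_integral h t - h 0) {0..t}"
    by (rule fundamental_theorem_of_calculus[OF t])
       (use dh in \<open>auto simp: has_real_derivative_iff_has_vector_derivative\<close>)
  moreover have "h 0 = 0" by (simp add: h_def k_def)
  ultimately have "integral {0..t} (\<lambda>s. \<sigma> * (w s * exp (al * s))) = h t"
    by (simp only: integral_unique diff_zero)
  hence "h t = \<sigma> * integral {0..t} (\<lambda>s. w s * exp (al * s))" by simp
  hence "exp (al * t) * ?I t = exp (al * t) * (z * ou_E al t + b * ou_F al t) + \<sigma> * integral {0..t} (\<lambda>s. w s * exp (al * s))"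
    by (simp add: h_def k_def)
  hence "exp (- al * t) * (exp (al * t) * ?I t) = exp (- al * t) * (exp (al * t) * (z * ou_E al t + b * ou_F al t))
     + \<sigma> * (exp (- al * t) * integral {0..t} (\<lambda>s. w s * exp (al * s)))"
    by (simp only: distrib_left mult.left_commute)
  moreover have "exp (- al * t) * (exp (al * t) * y) = y" for y
    by (simp add: mult.assoc[symmetric] exp_add[symmetric])
  moreover have "exp (- al * t) * integral {0..t} (\<lambda>s. w s * exp (al * s)) = integral {0..t} (\<lambda>s. w s * exp (- al * (t - s)))"
  proof -
    have e: "w s * exp (- al * (t - s)) = exp (- al * t) * (w s * exp (al * s))" for s
    proof -
      have "- al * (t - s) = - al * t + al * s" by (simp add: algebra_simps)
      thus ?thesis by (simp only: exp_add mult_ac)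
    qed
    show ?thesis unfolding e by (rule integral_mult_right[symmetric])
  qed
  ultimately show "?I t = z * ou_E al t + b * ou_F al t + \<sigma> * integral {0..t} (\<lambda>s. w s * exp (- al * (t - s)))"
    by (simp only:)
qed

section \<open>The Feynman--Kac formula in closed form\<close>

context ou_data
begin

text \<open>
  The integrand for which \<open>c i * \<integral>\<^sub>0\<^sup>t X\<^sub>i + \<theta> * \<zeta> i * X\<^sub>i t\<close> is \<open>fk_mean\<close> plus its Wiener integral over
  \<open>[0, t]\<close>.
\<close>

definition fkG :: "real \<Rightarrow> real \<Rightarrow> nat \<Rightarrow> real \<Rightarrow> real" where
  "fkG t \<theta> i s = sqrt (2 * \<alpha> i) * (\<theta> * \<zeta> i * exp (- \<alpha> i * (t - s)) + c i * ou_E (\<alpha> i) (t - s))"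

text \<open>
  The integral of \<open>(fkG t \<theta> i)\<^sup>2\<close> over \<open>[0, t]\<close>, at \<open>r = t\<close>.
\<close>

definition fk_var :: "real \<Rightarrow> nat \<Rightarrow> real \<Rightarrow> real" where
  "fk_var \<theta> i r = \<theta>\<^sup>2 * (\<zeta> i)\<^sup>2 * (1 - (exp (- \<alpha> i * r))\<^sup>2) + 2 * \<theta> * \<zeta> i * c i * \<alpha> i * (ou_E (\<alpha> i) r)\<^sup>2
     + (c i)\<^sup>2 * (2 * ou_F (\<alpha> i) r - (ou_E (\<alpha> i) r)\<^sup>2)"

definition fk_mean :: "real \<Rightarrow> (nat \<Rightarrow> real) \<Rightarrow> real \<Rightarrow> nat \<Rightarrow> real" where
  "fk_mean t z \<theta> i = \<theta> * \<zeta> i * (z i * exp (- \<alpha> i * t) + (d i - c i) * ou_E (\<alpha> i) t)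
     + c i * (z i * ou_E (\<alpha> i) t + (d i - c i) * ou_F (\<alpha> i) t)"

lemma fkG_deriv:
  "(fkG t \<theta> i has_real_derivative sqrt (2 * \<alpha> i) * ((\<theta> * \<zeta> i * \<alpha> i - c i) * exp (- \<alpha> i * (t - s)))) (at s within A)"
proof -
  have 1: "((\<lambda>s. t - s) has_real_derivative - 1) (at s within A)"
    by (auto intro!: derivative_eq_intros)
  have 2: "((\<lambda>s. exp (- \<alpha> i * (t - s))) has_real_derivative \<alpha> i * exp (- \<alpha> i * (t - s))) (at s within A)"
    by (auto intro!: derivative_eq_intros)
  have 3: "((\<lambda>s. ou_E (\<alpha> i) (t - s)) has_real_derivative exp (- \<alpha> i * (t - s)) * - 1) (at s within A)"
    by (rule DERIV_chain2[OF ou_E_deriv 1])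
  show ?thesis unfolding fkG_def
    by (rule DERIV_cong[OF DERIV_cmult[OF DERIV_add[OF DERIV_cmult[OF 2] DERIV_cmult[OF 3]]]])
       (simp add: algebra_simps)
qed

lemma fk_var_deriv:
  "(fk_var \<theta> i has_real_derivative 2 * \<alpha> i * (\<theta> * \<zeta> i * exp (- \<alpha> i * r) + c i * ou_E (\<alpha> i) r)\<^sup>2) (at r within A)"
proof -
  let ?e = "exp (- \<alpha> i * r)" and ?E = "ou_E (\<alpha> i) r"
  have 1: "((\<lambda>r. (exp (- \<alpha> i * r))\<^sup>2) has_real_derivative 2 * (- \<alpha> i * ?e) * ?e) (at r within A)"
    by (auto intro!: derivative_eq_intros)
  have 2: "((\<lambda>r. (ou_E (\<alpha> i) r)\<^sup>2) has_real_derivative 2 * ?e * ?E) (at r within A)"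
    by (auto intro!: derivative_eq_intros)
  have "(fk_var \<theta> i has_real_derivative \<theta>\<^sup>2 * (\<zeta> i)\<^sup>2 * (0 - 2 * (- \<alpha> i * ?e) * ?e)
      + 2 * \<theta> * \<zeta> i * c i * \<alpha> i * (2 * ?e * ?E) + (c i)\<^sup>2 * (2 * ?E - 2 * ?e * ?E)) (at r within A)"
    unfolding fk_var_def
    by (intro DERIV_add DERIV_cmult DERIV_diff DERIV_const 1 2 ou_F_deriv)
  moreover have "\<theta>\<^sup>2 * (\<zeta> i)\<^sup>2 * (0 - 2 * (- \<alpha> i * ?e) * ?e)
      + 2 * \<theta> * \<zeta> i * c i * \<alpha> i * (2 * ?e * ?E) + (c i)\<^sup>2 * (2 * ?E - 2 * ?e * ?E)
     = 2 * \<alpha> i * (\<theta> * \<zeta> i * ?e + c i * ?E)\<^sup>2"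
  proof -
    have "2 * ?E - 2 * ?e * ?E = 2 * \<alpha> i * ?E * ?E" unfolding exp_eq_ou_E by (simp add: algebra_simps)
    thus ?thesis by (simp only: power2_eq_square) (simp only: algebra_simps, simp)
  qed
  ultimately show ?thesis by simp
qed

lemma fk_var_integral:
  assumes t: "0 \<le> t" and \<alpha>: "0 \<le> \<alpha> i"
  shows "integral {0..t} (\<lambda>s. (fkG t \<theta> i s)\<^sup>2) = fk_var \<theta> i t" "0 \<le> fk_var \<theta> i t"
proof -
  have "((\<lambda>s. (fkG t \<theta> i s)\<^sup>2) has_integral (- fk_var \<theta> i (t - t)) - (- fk_var \<theta> i (t - 0))) {0..t}"
  proof (rule fundamental_theorem_of_calculus[OF t])
    fix s
    have 1: "((\<lambda>s. t - s) has_real_derivative - 1) (at s within {0..t})"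
      by (auto intro!: derivative_eq_intros)
    have "((\<lambda>s. - fk_var \<theta> i (t - s)) has_real_derivative
        - ((2 * \<alpha> i * (\<theta> * \<zeta> i * exp (- \<alpha> i * (t - s)) + c i * ou_E (\<alpha> i) (t - s))\<^sup>2) * - 1)) (at s within {0..t})"
      by (intro DERIV_minus DERIV_chain2[OF fk_var_deriv 1])
    moreover have "- ((2 * \<alpha> i * (\<theta> * \<zeta> i * exp (- \<alpha> i * (t - s)) + c i * ou_E (\<alpha> i) (t - s))\<^sup>2) * - 1) = (fkG t \<theta> i s)\<^sup>2"
      using \<alpha> by (simp add: fkG_def power_mult_distrib)
    ultimately show "((\<lambda>s. - fk_var \<theta> i (t - s)) has_vector_derivative (fkG t \<theta> i s)\<^sup>2) (at s within {0..t})"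
      by (simp only: has_real_derivative_iff_has_vector_derivative)
  qed
  moreover have "fk_var \<theta> i (t - t) = 0" by (simp add: fk_var_def)
  ultimately have h: "((\<lambda>s. (fkG t \<theta> i s)\<^sup>2) has_integral fk_var \<theta> i t) {0..t}" by simp
  show "integral {0..t} (\<lambda>s. (fkG t \<theta> i s)\<^sup>2) = fk_var \<theta> i t" by (rule integral_unique[OF h])
  show "0 \<le> fk_var \<theta> i t" by (rule has_integral_nonneg[OF h]) simp
qed

lemma continuous_fkG: "continuous_on A (fkG t \<theta> i)"
  by (rule DERIV_continuous_on, rule fkG_deriv)

lemma grid_sum_tendsto_integral:
  fixes f :: "real \<Rightarrow> real"
  assumes t: "0 \<le> t" and f: "continuous_on {0..t} f"
  shows "(\<lambda>n. \<Sum>k\<le>n. f (grid 0 t n k) * (grid 0 t n (Suc k) - grid 0 t n k)) \<longlonglongrightarrow> integral {0..t} f"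
proof -
  have "(\<lambda>_. 1::real) absolutely_integrable_on {0..t}" by (rule absolutely_integrable_continuous_real) simp
  from weighted_grid_sum_tendsto[OF t this f, of "\<lambda>n k. grid 0 t n k"]
  show ?thesis using grid_le_Suc[OF t] by simp
qed

text \<open>
  Both summands on the right are affine in \<open>w t\<close> and the integral of \<open>w\<close> against an exponential, and so is
  the limit of the Stieltjes sums.
\<close>

lemma wiener_sum_path:
  fixes x w :: "real \<Rightarrow> real"
  assumes t: "0 \<le> t" and x: "continuous_on {0..t} x" and w: "continuous_on {0..t} w" and w0: "w 0 = 0"
    and eq: "\<And>s. s \<in> {0..t} \<Longrightarrow> x s = z i + (LINT r|lebesgue_on {0..s}. (d i - c i) - \<alpha> i * x r) + sqrt (2 * \<alpha> i) * w s"
  shows "(\<lambda>n. \<Sum>k\<le>n. fkG t \<theta> i (grid 0 t n k) * (w (grid 0 t n (Suc k)) - w (grid 0 t n k)))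
    \<longlonglongrightarrow> c i * integral {0..t} x + \<theta> * (\<zeta> i * x t) - fk_mean t z \<theta> i"
proof -
  let ?s = "sqrt (2 * \<alpha> i)"
  let ?b = "d i - c i" and ?E = "ou_E (\<alpha> i) t" and ?F = "ou_F (\<alpha> i) t"
  let ?J = "integral {0..t} (\<lambda>s. w s * exp (- \<alpha> i * (t - s)))"
  have I: "integral {0..t} x = z i * ?E + ?b * ?F + ?s * ?J"
    by (rule ou_path(1)[OF t x w eq])
  have X: "x t = z i + ?b * t - \<alpha> i * integral {0..t} x + ?s * w t"
    by (rule ou_path(2)[OF t x w eq])
  have "(\<lambda>n. \<Sum>k\<le>n. fkG t \<theta> i (grid 0 t n k) * (w (grid 0 t n (Suc k)) - w (grid 0 t n k)))
    \<longlonglongrightarrow> fkG t \<theta> i t * w t - fkG t \<theta> i 0 * w 0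
      - integral {0..t} (\<lambda>s. w s * (?s * ((\<theta> * \<zeta> i * \<alpha> i - c i) * exp (- \<alpha> i * (t - s)))))"
    by (rule stieltjes_sum_tendsto[OF t w _ fkG_deriv]) (intro continuous_intros)
  moreover have "integral {0..t} (\<lambda>s. w s * (?s * ((\<theta> * \<zeta> i * \<alpha> i - c i) * exp (- \<alpha> i * (t - s)))))
     = ?s * (\<theta> * \<zeta> i * \<alpha> i - c i) * ?J"
  proof -
    have "(\<lambda>s. w s * (?s * ((\<theta> * \<zeta> i * \<alpha> i - c i) * exp (- \<alpha> i * (t - s)))))
      = (\<lambda>s. ?s * (\<theta> * \<zeta> i * \<alpha> i - c i) * (w s * exp (- \<alpha> i * (t - s))))"
      by (intro ext) (simp only: mult_ac)
    thus ?thesis by (simp only: integral_mult_right)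
  qed
  moreover have "fkG t \<theta> i t = ?s * (\<theta> * \<zeta> i)" by (simp add: fkG_def)
  moreover have "c i * integral {0..t} x + \<theta> * (\<zeta> i * x t) - fk_mean t z \<theta> i
     = ?s * (\<theta> * \<zeta> i) * w t - ?s * (\<theta> * \<zeta> i * \<alpha> i - c i) * ?J"
  proof -
    have e: "exp (- \<alpha> i * t) = 1 - \<alpha> i * ?E" by (rule exp_eq_ou_E)
    have f: "?b * ?E = ?b * t - ?b * (\<alpha> i * ?F)" unfolding ou_F_eq by (simp add: algebra_simps)
    show ?thesis unfolding X unfolding I fk_mean_def e f by (simp only: algebra_simps)
  qed
  ultimately show ?thesis using w0 by simp
qed

text \<open>
  The exponent is quadratic in \<open>\<theta>\<close>. Its constant term and the coefficient of \<open>\<theta>\<close> are the exponent and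
  the affine factor of \<open>U\<close>.
\<close>

lemma fk_exponents:
  "(\<Sum>i=1..N. fk_mean t z \<theta> i) - \<gamma> * t + (\<Sum>i=1..N. fk_var \<theta> i t) / 2
   = ((\<Sum>i=1..N. a i t * z i) + kap t) + (bet t + (\<Sum>i=1..N. q i t * z i)) * \<theta>
     + (\<Sum>i=1..N. (\<zeta> i)\<^sup>2 * (1 - (exp (- \<alpha> i * t))\<^sup>2) / 2) * \<theta>\<^sup>2"
proof -
  have k: "fk_mean t z \<theta> i + fk_var \<theta> i t / 2
    = a i t * z i + c i * d i * ou_F (\<alpha> i) t - (a i t)\<^sup>2 / 2
      + (\<zeta> i * d i * ou_E (\<alpha> i) t - q i t * a i t + q i t * z i) * \<theta>
      + (\<zeta> i)\<^sup>2 * (1 - (exp (- \<alpha> i * t))\<^sup>2) / 2 * \<theta>\<^sup>2" for i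
  proof -
    let ?E = "ou_E (\<alpha> i) t" and ?F = "ou_F (\<alpha> i) t" and ?e = "exp (- \<alpha> i * t)"
    have e: "\<alpha> i * ?E\<^sup>2 = ?E - ?e * ?E"
      unfolding exp_eq_ou_E by (simp add: power2_eq_square algebra_simps)
    have v: "fk_var \<theta> i t / 2 = \<theta> * \<zeta> i * c i * (\<alpha> i * ?E\<^sup>2) + (c i)\<^sup>2 * ?F - (c i)\<^sup>2 * ?E\<^sup>2 / 2
        + (\<zeta> i)\<^sup>2 * (1 - ?e\<^sup>2) / 2 * \<theta>\<^sup>2"
      unfolding fk_var_def by (simp add: algebra_simps add_divide_distrib diff_divide_distrib)
    show ?thesis unfolding v e fk_mean_def a_def q_def
      by (simp add: algebra_simps power2_eq_square)
  qed
  have "(\<Sum>i=1..N. fk_mean t z \<theta> i) - \<gamma> * t + (\<Sum>i=1..N. fk_var \<theta> i t) / 2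
     = (\<Sum>i=1..N. fk_mean t z \<theta> i + fk_var \<theta> i t / 2) - \<gamma> * t"
    by (simp add: sum.distrib sum_divide_distrib)
  also have "\<dots> = ((\<Sum>i=1..N. a i t * z i) + kap t) + (bet t + (\<Sum>i=1..N. q i t * z i)) * \<theta>
     + (\<Sum>i=1..N. (\<zeta> i)\<^sup>2 * (1 - (exp (- \<alpha> i * t))\<^sup>2) / 2) * \<theta>\<^sup>2"
    unfolding k kap_def bet_def S_def
    unfolding sum.distrib sum_subtractf sum_distrib_right[symmetric] by linarith
  finally show ?thesis .
qed

text \<open>
  Augmentation only adds null sets of \<open>M\<close> itself.
\<close>

lemma strong_solution_measurable:
  assumes X: "strong_solution M W b \<sigma> z X" and W: "brownian_motion M W" and t: "0 \<le> t"
  shows "X t \<in> borel_measurable M"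
proof (rule measurable_from_subalg)
  show "X t \<in> borel_measurable (augmented_filtration M W t)"
    using X t by (simp add: strong_solution_def)
  let ?A = "{W s -` A \<inter> space M | s A. 0 \<le> s \<and> s \<le> t \<and> A \<in> sets borel} \<union> null_sets M"
  have sub: "?A \<subseteq> sets M"
    using W by (auto simp: brownian_motion_def null_sets_def intro: measurable_sets)
  have "?A \<subseteq> Pow (space M)" using sub sets.space_closed by blast
  thus "subalgebra M (augmented_filtration M W t)"
    unfolding subalgebra_def augmented_filtration_def
    using sets.sigma_sets_subset[OF sub] by simp
qed

text \<open>
  With \<open>V'\<close> the exponent and \<open>Y\<close> the prefactor, \<open>V' + \<theta> Y\<close> minus its mean is almost surely the limit of
  Wiener sums, for every \<open>\<theta>\<close>. This determines the expectation of \<open>exp (V' + \<theta> Y)\<close>, and its derivative at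
  \<open>\<theta> = 0\<close> is the expectation of \<open>Y exp V'\<close>.
\<close>

lemma feynman_kac_eq_U:
  fixes M :: "'w measure" and W :: "nat \<Rightarrow> real \<Rightarrow> 'w \<Rightarrow> real"
  assumes ps: "prob_space M" and B: "independent_brownian_motions M N W"
   and \<alpha>0: "\<And>i. i \<in> {1..N} \<Longrightarrow> 0 \<le> \<alpha> i"
   and sde: "\<And>i z. i \<in> {1..N} \<Longrightarrow> strong_solution M (W i) (\<lambda>y. d i - c i - \<alpha> i * y) (sqrt (2 * \<alpha> i)) z (X i z)"
   and t: "0 \<le> t"
  shows "feynman_kac M N X \<zeta> c \<gamma> t z = U t z"
proof -
  interpret prob_space M by (rule ps)
  have BW: "brownian_motion M (W i)" if "i \<in> {1..N}" for i
    using B that by (auto simp: independent_brownian_motions_def)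
  define x where "x i s \<omega> = X i (z i) s \<omega>" for i s \<omega>
  have mX: "x i s \<in> borel_measurable M" if "i \<in> {1..N}" "0 \<le> s" for i s
    using strong_solution_measurable[OF sde[OF that(1)] BW[OF that(1)] that(2)] by (simp add: x_def[abs_def])
  have mW: "W i s \<in> borel_measurable M" if "i \<in> {1..N}" "0 \<le> s" for i s
    using BW[OF that(1)] that(2) by (auto simp: brownian_motion_def)
  have cX: "continuous_on {0..t} (\<lambda>s. x i s \<omega>)" if "i \<in> {1..N}" "\<omega> \<in> space M" for i \<omega>
  proof (rule continuous_on_subset)
    show "continuous_on {0..} (\<lambda>s. x i s \<omega>)"
      using sde[OF that(1), of "z i"] that(2) unfolding strong_solution_def x_def by blast
  qed auto
  define I where "I i \<omega> = integral {0..t} (\<lambda>s. x i s \<omega>)" for i \<omega>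
  have g0: "0 \<le> grid 0 t n k" for n k using t by (simp add: grid_def)
  have mI: "I i \<in> borel_measurable M" if i: "i \<in> {1..N}" for i
  proof (rule borel_measurable_LIMSEQ_real)
    show "(\<lambda>n. \<Sum>k\<le>n. x i (grid 0 t n k) \<omega> * (grid 0 t n (Suc k) - grid 0 t n k)) \<longlonglongrightarrow> I i \<omega>"
      if "\<omega> \<in> space M" for \<omega>
      unfolding I_def by (rule grid_sum_tendsto_integral[OF t cX[OF i that]])
    show "(\<lambda>\<omega>. \<Sum>k\<le>n. x i (grid 0 t n k) \<omega> * (grid 0 t n (Suc k) - grid 0 t n k)) \<in> borel_measurable M" for n
      by (intro borel_measurable_sum borel_measurable_times borel_measurable_const mX i g0)
  qed
  define V' where "V' \<omega> = (\<Sum>i=1..N. c i * I i \<omega>) - \<gamma> * t" for \<omega>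
  define Y where "Y \<omega> = (\<Sum>i=1..N. \<zeta> i * x i t \<omega>)" for \<omega>
  have mV: "V' \<in> borel_measurable M" unfolding V'_def[abs_def]
    by (intro borel_measurable_diff borel_measurable_sum borel_measurable_times borel_measurable_const mI)
  have mY: "Y \<in> borel_measurable M" unfolding Y_def[abs_def]
    by (intro borel_measurable_sum borel_measurable_times borel_measurable_const mX t)
  have fk: "feynman_kac M N X \<zeta> c \<gamma> t z = (LINT \<omega>|M. Y \<omega> * exp (V' \<omega>))"
    unfolding feynman_kac_def
  proof (rule Bochner_Integration.integral_cong[OF refl])
    fix \<omega> assume \<omega>: "\<omega> \<in> space M"
    have ii: "(\<lambda>s. c i * x i s \<omega>) integrable_on {0..t}" if "i \<in> {1..N}" for i
      by (intro integrable_continuous_real continuous_intros cX that \<omega>)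
    have "(LINT s|lebesgue_on {0..t}. (\<Sum>i=1..N. c i * x i s \<omega>) - \<gamma>)
        = integral {0..t} (\<lambda>s. (\<Sum>i=1..N. c i * x i s \<omega>) - \<gamma>)"
      by (intro integral_eq_lebesgue_on continuous_intros cX \<omega>)
    also have "\<dots> = integral {0..t} (\<lambda>s. \<Sum>i=1..N. c i * x i s \<omega>) - integral {0..t} (\<lambda>s. \<gamma>)"
      by (intro Henstock_Kurzweil_Integration.integral_diff integrable_sum ii) auto
    also have "\<dots> = V' \<omega>"
      unfolding V'_def I_def using t
      by (subst Henstock_Kurzweil_Integration.integral_sum) (auto intro: ii simp: mult.commute)
    finally show "(\<Sum>i=1..N. \<zeta> i * X i (z i) t \<omega>) *
        exp (LINT s|lebesgue_on {0..t}. (\<Sum>i=1..N. c i * X i (z i) s \<omega>) - \<gamma>) = Y \<omega> * exp (V' \<omega>)"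
      by (simp add: Y_def x_def)
  qed
  define m where "m \<theta> = (\<Sum>i=1..N. fk_mean t z \<theta> i) - \<gamma> * t" for \<theta>
  define var where "var \<theta> = (\<Sum>i=1..N. fk_var \<theta> i t)" for \<theta>
  have main: "integrable M (\<lambda>\<omega>. exp (V' \<omega> + \<theta> * Y \<omega> - m \<theta>))"
     "(LINT \<omega>|M. exp (V' \<omega> + \<theta> * Y \<omega> - m \<theta>)) = exp (var \<theta> / 2)" for \<theta>
  proof -
    define Yn where "Yn n \<omega> = (\<Sum>i=1..N. \<Sum>k\<le>n. fkG t \<theta> i (grid 0 t n k)
        * (W i (grid 0 t n (Suc k)) \<omega> - W i (grid 0 t n k) \<omega>))" for n \<omega>
    have 1: "Yn n \<in> borel_measurable M" for n
      unfolding Yn_def[abs_def]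
      by (intro borel_measurable_sum borel_measurable_times borel_measurable_const borel_measurable_diff mW g0)
    have 2: "(\<lambda>\<omega>. V' \<omega> + \<theta> * Y \<omega> - m \<theta>) \<in> borel_measurable M"
      using mV mY by measurable
    have "AE \<omega> in M. \<forall>i\<in>{1..N}. W i 0 \<omega> = 0 \<and> continuous_on {0..} (\<lambda>t. W i t \<omega>)
        \<and> (\<forall>s\<ge>0. x i s \<omega> = z i + (LINT r|lebesgue_on {0..s}. (d i - c i) - \<alpha> i * x i r \<omega>) + sqrt (2 * \<alpha> i) * W i s \<omega>)"
    proof (rule AE_finite_allI)
      fix i assume i: "i \<in> {1..N}"
      have "AE \<omega> in M. W i 0 \<omega> = 0" "AE \<omega> in M. continuous_on {0..} (\<lambda>t. W i t \<omega>)"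
        using BW[OF i] by (simp_all add: brownian_motion_def)
      moreover have "AE \<omega> in M. \<forall>s\<ge>0. x i s \<omega> = z i + (LINT r|lebesgue_on {0..s}. (d i - c i) - \<alpha> i * x i r \<omega>) + sqrt (2 * \<alpha> i) * W i s \<omega>"
        using sde[OF i, of "z i"] unfolding strong_solution_def x_def by blast
      ultimately show "AE \<omega> in M. W i 0 \<omega> = 0 \<and> continuous_on {0..} (\<lambda>t. W i t \<omega>)
        \<and> (\<forall>s\<ge>0. x i s \<omega> = z i + (LINT r|lebesgue_on {0..s}. (d i - c i) - \<alpha> i * x i r \<omega>) + sqrt (2 * \<alpha> i) * W i s \<omega>)"
        by eventually_elim blast
    qed simp
    hence 3: "AE \<omega> in M. (\<lambda>n. Yn n \<omega>) \<longlonglongrightarrow> V' \<omega> + \<theta> * Y \<omega> - m \<theta>"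
      using AE_space
    proof eventually_elim
      case (elim \<omega>)
      have "(\<lambda>n. Yn n \<omega>) \<longlonglongrightarrow> (\<Sum>i=1..N. c i * I i \<omega> + \<theta> * (\<zeta> i * x i t \<omega>) - fk_mean t z \<theta> i)"
        unfolding Yn_def I_def
      proof (rule tendsto_sum)
        fix i assume i: "i \<in> {1..N}"
        have c: "continuous_on {0..t} (\<lambda>s. W i s \<omega>)"
          using elim(1) i by (auto intro: continuous_on_subset[of "{0..}"])
        show "(\<lambda>n. \<Sum>k\<le>n. fkG t \<theta> i (grid 0 t n k) * (W i (grid 0 t n (Suc k)) \<omega> - W i (grid 0 t n k) \<omega>))
          \<longlonglongrightarrow> c i * integral {0..t} (\<lambda>s. x i s \<omega>) + \<theta> * (\<zeta> i * x i t \<omega>) - fk_mean t z \<theta> i"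
          by (rule wiener_sum_path[OF t cX[OF i elim(2)] c]) (use elim(1) i in auto)
      qed
      also have "(\<Sum>i=1..N. c i * I i \<omega> + \<theta> * (\<zeta> i * x i t \<omega>) - fk_mean t z \<theta> i) = V' \<omega> + \<theta> * Y \<omega> - m \<theta>"
        by (simp add: V'_def Y_def m_def sum.distrib sum_subtractf sum_distrib_left)
      finally show ?case .
    qed
    have 4: "char (distr M borel (Yn n)) \<eta> = complex_of_real (exp (- \<eta>\<^sup>2 *
        (\<Sum>i=1..N. \<Sum>k\<le>n. (fkG t \<theta> i (grid 0 t n k))\<^sup>2 * (grid 0 t n (Suc k) - grid 0 t n k)) / 2))" for n \<eta>
      unfolding Yn_def by (rule char_wiener_sum[OF B t])
    have 5: "(\<lambda>n. \<Sum>i=1..N. \<Sum>k\<le>n. (fkG t \<theta> i (grid 0 t n k))\<^sup>2 * (grid 0 t n (Suc k) - grid 0 t n k)) \<longlonglongrightarrow> var \<theta>"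
      unfolding var_def
    proof (rule tendsto_sum)
      fix i assume i: "i \<in> {1..N}"
      have "continuous_on {0..t} (\<lambda>s. (fkG t \<theta> i s)\<^sup>2)" by (intro continuous_intros continuous_fkG)
      from grid_sum_tendsto_integral[OF t this]
      show "(\<lambda>n. \<Sum>k\<le>n. (fkG t \<theta> i (grid 0 t n k))\<^sup>2 * (grid 0 t n (Suc k) - grid 0 t n k)) \<longlonglongrightarrow> fk_var \<theta> i t"
        unfolding fk_var_integral(1)[where \<theta> = \<theta>, OF t \<alpha>0[OF i]] .
    qed
    have 6: "0 \<le> var \<theta>" unfolding var_def by (intro sum_nonneg fk_var_integral(2) t \<alpha>0)
    show "integrable M (\<lambda>\<omega>. exp (V' \<omega> + \<theta> * Y \<omega> - m \<theta>))"
     "(LINT \<omega>|M. exp (V' \<omega> + \<theta> * Y \<omega> - m \<theta>)) = exp (var \<theta> / 2)"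
      by (rule gaussian_limit_exp[OF 1 2 3 4 5 6])+
  qed
  have ex: "exp (V' \<omega> + \<theta> * Y \<omega>) = exp (m \<theta>) * exp (V' \<omega> + \<theta> * Y \<omega> - m \<theta>)" for \<omega> \<theta>
    by (simp add: exp_add[symmetric])
  have "(LINT \<omega>|M. Y \<omega> * exp (V' \<omega>)) = (bet t + (\<Sum>i=1..N. q i t * z i)) * exp ((\<Sum>i=1..N. a i t * z i) + kap t)"
  proof (rule exp_tilted_expectation[OF mV mY])
    show "integrable M (\<lambda>\<omega>. exp (V' \<omega> + \<theta> * Y \<omega>))" for \<theta>
      unfolding ex by (rule integrable_mult_right[OF main(1)])
    show "(LINT \<omega>|M. exp (V' \<omega> + \<theta> * Y \<omega>)) = exp ((\<Sum>i=1..N. a i t * z i) + kap t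
       + (bet t + (\<Sum>i=1..N. q i t * z i)) * \<theta> + (\<Sum>i=1..N. (\<zeta> i)\<^sup>2 * (1 - (exp (- \<alpha> i * t))\<^sup>2) / 2) * \<theta>\<^sup>2)" for \<theta>
    proof -
      have "(LINT \<omega>|M. exp (V' \<omega> + \<theta> * Y \<omega>)) = exp (m \<theta>) * exp (var \<theta> / 2)"
        unfolding ex integral_mult_right_zero main(2) ..
      also have "\<dots> = exp (m \<theta> + var \<theta> / 2)" by (rule exp_add[symmetric])
      finally show ?thesis unfolding m_def var_def fk_exponents .
    qed
  qed
  thus ?thesis unfolding fk U_def affine_exp_def .
qed

end

section \<open>Integration on the unit cube\<close>

(* From here on index sets such as {1..n} are kept in this form, rather than rewritten to {Suc 0..n}. *)
declare One_nat_def [simp del]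

lemma prob_leb01: "prob_space leb01"
  by (rule prob_spaceI) (simp add: emeasure_restrict_space)

interpretation leb01: prob_space leb01 by (rule prob_leb01)

interpretation cube: product_sigma_finite "\<lambda>_::nat. leb01" ..

lemma prob_cube: "prob_space (cube_measure n)"
  by (rule prob_space_PiM) (rule prob_leb01)

lemma space_cube: "space (cube_measure n) = closed_cube n"
  by (simp add: space_PiM closed_cube_def)

lemma cube_integrable:
  fixes f :: "(nat \<Rightarrow> real) \<Rightarrow> real"
  assumes "f \<in> borel_measurable (cube_measure n)" "\<And>x. x \<in> closed_cube n \<Longrightarrow> \<bar>f x\<bar> \<le> B"
  shows "integrable (cube_measure n) f"
proof -
  interpret prob_space "cube_measure n" by (rule prob_cube)
  show ?thesis by (rule integrable_const_bound[of _ B]) (use assms in \<open>auto simp: space_cube\<close>)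
qed

lemma leb01_integrable:
  fixes f :: "real \<Rightarrow> real"
  assumes "f \<in> borel_measurable leb01" "\<And>x. x \<in> {0..1} \<Longrightarrow> \<bar>f x\<bar> \<le> B"
  shows "integrable leb01 f"
  by (rule leb01.integrable_const_bound[of _ B]) (use assms in auto)

definition subcube :: "nat \<Rightarrow> real \<Rightarrow> real \<Rightarrow> (nat \<Rightarrow> real) set" where
  "subcube n a b = PiE {1..n} (\<lambda>_. {a..b})"

lemma closed_cube_subcube: "closed_cube n = subcube n 0 1"
  by (simp add: closed_cube_def subcube_def)

lemma subcube_subset_open_cube: "0 < a \<Longrightarrow> b < 1 \<Longrightarrow> subcube n a b \<subseteq> open_cube n"
  unfolding subcube_def open_cube_def by (intro PiE_mono) auto

lemma open_cube_subset: "open_cube n \<subseteq> closed_cube n"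
  by (auto simp: open_cube_def closed_cube_def PiE_iff less_imp_le)

text \<open>
  Points outside the index range are pinned to \<open>undefined\<close>, so the set is a product of compact sets over
  all indices.
\<close>

lemma compact_subcube: "compact (subcube n a b)"
proof -
  have "subcube n a b = PiE UNIV (\<lambda>i. if i \<in> {1..n} then {a..b} else {undefined})"
    by (auto simp: subcube_def PiE_iff extensional_def split: if_splits)
  moreover have "compactin (product_topology (\<lambda>_::nat. euclidean) UNIV)
      (PiE UNIV (\<lambda>i. if i \<in> {1..n} then {a..b} else {undefined}))"
    unfolding compactin_PiE by auto
  ultimately show ?thesis by (simp add: euclidean_product_topology)
qed

lemma cube_upd:
  assumes "x \<in> closed_cube n" "s \<in> {0..1}" "i \<in> {1..n}"
  shows "x(i := s) \<in> closed_cube n"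
  using assms by (auto simp: closed_cube_def PiE_iff extensional_def)

lemma cube_append:
  assumes "x \<in> closed_cube n" "s \<in> {0..1}"
  shows "x(n + 1 := s) \<in> closed_cube (n + 1)"
  using assms by (auto simp: closed_cube_def PiE_iff extensional_def)

lemma measurable_cube_restrict:
  fixes f :: "(nat \<Rightarrow> real) \<Rightarrow> real"
  assumes A: "A \<subseteq> closed_cube n" and f: "continuous_on A f"
  shows "f \<in> borel_measurable (restrict_space (cube_measure n) A)"
proof -
  have "(\<lambda>x. x) \<in> cube_measure n \<rightarrow>\<^sub>M (borel :: (nat \<Rightarrow> real) measure)"
  proof (rule measurable_coordinatewise_then_product)
    fix i :: nat
    show "(\<lambda>x. x i) \<in> borel_measurable (cube_measure n)"
    proof (cases "i \<in> {1..n}")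
      case True
      have "(\<lambda>x. x i) \<in> cube_measure n \<rightarrow>\<^sub>M leb01" by (rule measurable_component_singleton[OF True])
      moreover have "(\<lambda>x. x) \<in> leb01 \<rightarrow>\<^sub>M borel"
        by (intro measurable_restrict_space1 measurable_completion) simp
      ultimately show ?thesis by (rule measurable_compose)
    next
      case False
      have "(\<lambda>x. x i) \<in> borel_measurable (cube_measure n) \<longleftrightarrow> (\<lambda>x. undefined::real) \<in> borel_measurable (cube_measure n)"
        by (rule measurable_cong) (use False in \<open>auto simp: space_PiM PiE_iff extensional_def\<close>)
      thus ?thesis by simp
    qed
  qed
  hence "(\<lambda>x. x) \<in> restrict_space (cube_measure n) A \<rightarrow>\<^sub>M restrict_space borel A"
    by (intro measurable_restrict_space2 measurable_restrict_space1) (auto simp: space_restrict_space)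
  from measurable_compose[OF this borel_measurable_continuous_on_restrict[OF f]]
  show ?thesis .
qed

lemma measurable_cube:
  fixes f :: "(nat \<Rightarrow> real) \<Rightarrow> real"
  assumes "continuous_on (closed_cube n) f"
  shows "f \<in> borel_measurable (cube_measure n)"
proof -
  have s: "closed_cube n \<inter> space (cube_measure n) \<in> sets (cube_measure n)"
    using sets.top[of "cube_measure n"] by (simp add: space_cube)
  have "(\<lambda>x. indicator (closed_cube n) x *\<^sub>R f x) \<in> borel_measurable (cube_measure n)"
    using measurable_cube_restrict[OF order.refl assms] borel_measurable_restrict_space_iff[OF s] by blast
  thus ?thesis by (rule measurable_cong[THEN iffD1, rotated]) (simp add: space_cube)
qed

lemma sets_open_cube: "open_cube n \<in> sets (cube_measure n)"
  unfolding open_cube_def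
  by (rule sets_PiM_I_finite) (auto simp: sets_restrict_space_iff)

text \<open>
  The time derivative and the second spatial derivatives are controlled in the open cube only; this is
  how they become integrable against test functions that vanish near the boundary.
\<close>

lemma measurable_cube_supported:
  fixes f g :: "(nat \<Rightarrow> real) \<Rightarrow> real"
  assumes f: "continuous_on (open_cube n) f" and g: "g \<in> borel_measurable (cube_measure n)"
    and z: "\<And>x. x \<in> closed_cube n \<Longrightarrow> x \<notin> open_cube n \<Longrightarrow> g x = 0"
  shows "(\<lambda>x. f x * g x) \<in> borel_measurable (cube_measure n)"
proof -
  have "(\<lambda>x. indicator (open_cube n) x *\<^sub>R f x) \<in> borel_measurable (cube_measure n)"
  proof (subst borel_measurable_restrict_space_iff[symmetric])
    show "open_cube n \<inter> space (cube_measure n) \<in> sets (cube_measure n)"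
      unfolding space_cube Int_absorb2[OF open_cube_subset] by (rule sets_open_cube)
  qed (rule measurable_cube_restrict[OF open_cube_subset f])
  hence m: "(\<lambda>x. (indicator (open_cube n) x *\<^sub>R f x) * g x) \<in> borel_measurable (cube_measure n)"
    using g by (rule borel_measurable_times)
  show ?thesis
  proof (rule measurable_cong[THEN iffD1, OF _ m])
    show "(indicator (open_cube n) x *\<^sub>R f x) * g x = f x * g x" if "x \<in> space (cube_measure n)" for x
      using z[of x] that by (cases "x \<in> open_cube n") (simp_all add: space_cube)
  qed
qed

lemma measurable_coord:
  assumes "g \<in> borel_measurable leb01" "i \<in> {1..n}"
  shows "(\<lambda>x. g (x i)) \<in> borel_measurable (cube_measure n)"
  by (rule measurable_compose[OF measurable_component_singleton[OF assms(2)] assms(1)])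

lemma measurable_tensor:
  assumes "\<And>l. l \<in> {1..n} \<Longrightarrow> \<xi> (j l) \<in> borel_measurable leb01"
  shows "tensor \<xi> n j \<in> borel_measurable (cube_measure n)"
  unfolding tensor_def by (intro borel_measurable_prod measurable_coord assms)

lemma tensor_bound:
  assumes "\<And>l s. l \<in> {1..n} \<Longrightarrow> s \<in> {0..1} \<Longrightarrow> \<bar>\<xi> (j l) s\<bar> \<le> C" and x: "x \<in> closed_cube n"
  shows "\<bar>tensor \<xi> n j x\<bar> \<le> C ^ n"
proof -
  have "\<bar>tensor \<xi> n j x\<bar> \<le> (\<Prod>i=1..n. C)" unfolding tensor_def abs_prod
    by (rule prod_mono) (use assms in \<open>auto simp: closed_cube_def PiE_iff\<close>)
  thus ?thesis by simp
qed

lemma cube_measurable_upd: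
  "i \<in> {1..n} \<Longrightarrow> (\<lambda>(x, s). x(i := s)) \<in> cube_measure n \<Otimes>\<^sub>M leb01 \<rightarrow>\<^sub>M cube_measure n"
  unfolding case_prod_unfold by (rule measurable_fun_upd[where J = "{1..n}"]) auto

text \<open>
  The unit interval has mass one, so integrating out coordinate \<open>i\<close> may be followed by integrating over the
  whole cube again. One-dimensional identities can thus be used in any direction without passing to a
  cube of lower dimension.
\<close>

lemma resample_coordinate:
  fixes F :: "(nat \<Rightarrow> real) \<Rightarrow> real"
  assumes i: "i \<in> {1..n}" and F: "F \<in> borel_measurable (cube_measure n)"
    and B: "\<And>x. x \<in> closed_cube n \<Longrightarrow> \<bar>F x\<bar> \<le> B"
  shows "(LINT x|cube_measure n. F x) = (LINT x|cube_measure n. (LINT s|leb01. F (x(i := s))))"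
    and "(\<lambda>x. LINT s|leb01. F (x(i := s))) \<in> borel_measurable (cube_measure n)"
    and "x \<in> closed_cube n \<Longrightarrow> \<bar>LINT s|leb01. F (x(i := s))\<bar> \<le> B"
proof -
  let ?H = "\<lambda>x. LINT s|leb01. F (x(i := s))"
  let ?I = "{1..n} - {i}"
  have ins: "insert i ?I = {1..n}" using i by auto
  show Hm: "?H \<in> borel_measurable (cube_measure n)"
    by (rule leb01.borel_measurable_lebesgue_integral)
       (use measurable_compose[OF cube_measurable_upd[OF i] F] in \<open>simp add: case_prod_unfold\<close>)
  have Hb: "\<bar>?H x\<bar> \<le> B" if x: "x \<in> closed_cube n" for x
  proof -
    have m: "(\<lambda>s. F (x(i := s))) \<in> borel_measurable leb01"
    proof -
      have "(\<lambda>s. (x, s)) \<in> leb01 \<rightarrow>\<^sub>M cube_measure n \<Otimes>\<^sub>M leb01"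
        by (rule measurable_Pair1') (simp add: space_cube x)
      from measurable_compose[OF this measurable_compose[OF cube_measurable_upd[OF i] F]] show ?thesis by simp
    qed
    have "norm (?H x) \<le> (LINT s|leb01. norm (F (x(i := s))))" by simp
    also have "\<dots> \<le> (LINT s|leb01. B)"
      by (rule integral_mono) (use m B cube_upd[OF x _ i] in \<open>auto intro!: leb01_integrable[of _ B]\<close>)
    also have "\<dots> = B" using leb01.prob_space by simp
    finally show ?thesis by simp
  qed
  show "x \<in> closed_cube n \<Longrightarrow> \<bar>LINT s|leb01. F (x(i := s))\<bar> \<le> B" by (rule Hb)
  have 1: "(LINT x|cube_measure n. F x) = (LINT x|PiM ?I (\<lambda>_. leb01). ?H x)"
    using cube.product_integral_insert[of ?I i F] cube_integrable[OF F B] unfolding ins by simp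
  have 2: "(LINT x|cube_measure n. ?H x) = (LINT x|PiM ?I (\<lambda>_. leb01). (LINT s|leb01. ?H (x(i := s))))"
    using cube.product_integral_insert[of ?I i ?H] cube_integrable[OF Hm Hb] unfolding ins by simp
  show "(LINT x|cube_measure n. F x) = (LINT x|cube_measure n. ?H x)"
    unfolding 1 2 using leb01.prob_space by simp
qed

lemma integral_indicator_leb01:
  fixes F :: "real \<Rightarrow> real"
  assumes "0 \<le> a" "b \<le> 1" and F: "F absolutely_integrable_on {a..b}"
  shows "(LINT s|leb01. indicator {a..b} s * F s) = integral {a..b} F"
proof -
  have "(LINT s|leb01. indicator {a..b} s * F s) = (LINT s|lebesgue. indicator {0..1} s *\<^sub>R (indicator {a..b} s * F s))"
    by (rule integral_restrict_space) simp
  also have "\<dots> = (LINT s|lebesgue. indicator {a..b} s *\<^sub>R F s)"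
    by (intro Bochner_Integration.integral_cong refl) (use assms in \<open>auto simp: indicator_def\<close>)
  also have "\<dots> = integral {a..b} F"
    using set_lebesgue_integral_eq_integral(2)[OF F] by (simp add: set_lebesgue_integral_def)
  finally show ?thesis .
qed

text \<open>
  Difference quotients are bounded by \<open>B\<close> through the mean value theorem.
\<close>

lemma has_derivative_under_integral:
  fixes f f' :: "real \<Rightarrow> 'a \<Rightarrow> real"
  assumes t: "a < t" "t < b"
    and int: "\<And>s. a < s \<Longrightarrow> s < b \<Longrightarrow> integrable M (f s)"
    and d: "\<And>s x. a < s \<Longrightarrow> s < b \<Longrightarrow> x \<in> space M \<Longrightarrow> ((\<lambda>r. f r x) has_real_derivative f' s x) (at s)"
    and B: "\<And>s x. a < s \<Longrightarrow> s < b \<Longrightarrow> x \<in> space M \<Longrightarrow> \<bar>f' s x\<bar> \<le> B x" and Bi: "integrable M B"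
    and m: "f' t \<in> borel_measurable M"
  shows "((\<lambda>r. LINT x|M. f r x) has_real_derivative (LINT x|M. f' t x)) (at t)"
proof -
  let ?F = "\<lambda>r. LINT x|M. f r x"
  have "((\<lambda>r. (?F r - ?F t) / (r - t)) \<longlongrightarrow> (LINT x|M. f' t x)) (at t within {a<..<b})"
    unfolding tendsto_at_iff_sequentially
  proof (intro allI impI)
    fix X assume X: "\<forall>i. X i \<in> {a<..<b} - {t}" and lim: "X \<longlonglongrightarrow> t"
    have Xi: "a < X i" "X i < b" "X i \<noteq> t" for i using X by auto
    have ii: "integrable M (f (X i))" "integrable M (f t)" for i using int Xi t by blast+
    have "(\<lambda>i. LINT x|M. (f (X i) x - f t x) / (X i - t)) \<longlonglongrightarrow> (LINT x|M. f' t x)"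
    proof (rule integral_dominated_convergence[where w = B])
      show "(\<lambda>x. (f (X i) x - f t x) / (X i - t)) \<in> borel_measurable M" for i
        by (intro borel_measurable_divide borel_measurable_diff borel_measurable_const
            borel_measurable_integrable[OF ii(1)] borel_measurable_integrable[OF ii(2)])
      show "AE x in M. (\<lambda>i. (f (X i) x - f t x) / (X i - t)) \<longlonglongrightarrow> f' t x"
      proof (rule AE_I2)
        fix x assume x: "x \<in> space M"
        have "((\<lambda>r. (f r x - f t x) / (r - t)) \<longlongrightarrow> f' t x) (at t)"
          using d[OF t x] by (simp add: has_field_derivative_iff)
        moreover have "filterlim X (at t) sequentially"
          using lim Xi(3) by (simp add: filterlim_at)
        ultimately show "(\<lambda>i. (f (X i) x - f t x) / (X i - t)) \<longlonglongrightarrow> f' t x"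
          by (rule filterlim_compose)
      qed
      show "AE x in M. norm ((f (X i) x - f t x) / (X i - t)) \<le> B x" for i
      proof (rule AE_I2)
        fix x assume x: "x \<in> space M"
        have "norm (f (X i) x - f t x) \<le> B x * norm (X i - t)"
        proof (rule field_differentiable_bound[where S = "{a<..<b}" and f' = "\<lambda>s. f' s x" and f = "\<lambda>s. f s x"])
          show "((\<lambda>s. f s x) has_real_derivative f' s x) (at s within {a<..<b})" if "s \<in> {a<..<b}" for s
            by (rule has_field_derivative_at_within, rule d) (use that x in auto)
          show "norm (f' s x) \<le> B x" if "s \<in> {a<..<b}" for s
            using B[of s x] that x by simp
        qed (use t Xi[of i] in auto)
        moreover have "0 < norm (X i - t)" using Xi[of i] by simp
        ultimately show "norm ((f (X i) x - f t x) / (X i - t)) \<le> B x"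
          unfolding norm_divide by (subst pos_divide_le_eq)
      qed
    qed (use m Bi in auto)
    moreover have "(LINT x|M. (f (X i) x - f t x) / (X i - t)) = (?F (X i) - ?F t) / (X i - t)" for i
      unfolding integral_divide_zero by (simp only: Bochner_Integration.integral_diff[OF ii])
    ultimately show "((\<lambda>r. (?F r - ?F t) / (r - t)) \<circ> X) \<longlonglongrightarrow> (LINT x|M. f' t x)"
      unfolding comp_def by (simp only:)
  qed
  moreover have "at t within {a<..<b} = at t" by (rule at_within_open) (use t in auto)
  ultimately show ?thesis by (simp add: has_field_derivative_iff)
qed

section \<open>Green's identity for the eigenfunctions\<close>

lemma integrable_leb_subinterval:
  assumes "integrable leb01 h" "0 \<le> a" "b \<le> 1"
  shows "h absolutely_integrable_on {a..b}"
proof -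
  have "set_integrable lebesgue {0..1} h"
    using assms(1) unfolding set_integrable_def by (subst (asm) integrable_restrict_space) auto
  thus ?thesis by (rule set_integrable_subset) (use assms in auto)
qed

text \<open>
  The derivative of \<open>f\<close> is only absolutely continuous and the eigenvalue equation holds almost everywhere,
  which calls for integration by parts of absolutely continuous functions. The potential \<open>ld\<close> cancels
  because the equation is multiplied by \<open>u\<close>. Subintervals are allowed since \<open>u''\<close> will be continuous in
  the open interval only.
\<close>

lemma neumann_eigenfunction_green:
  assumes eig: "neumann_eigenfunction ld al f"
  obtains f' where "\<And>x. x \<in> {0..1} \<Longrightarrow> (f has_real_derivative f' x) (at x within {0..1})"
    "continuous_on {0..1} f'" "f' 0 = 0" "f' 1 = 0"
    "\<And>a b u u' u''. \<lbrakk>0 \<le> a; a \<le> b; b \<le> 1;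
       \<And>s. s \<in> {a..b} \<Longrightarrow> (u has_real_derivative u' s) (at s within {a..b});
       \<And>s. s \<in> {a..b} \<Longrightarrow> (u' has_real_derivative u'' s) (at s within {a..b});
       continuous_on {a..b} u''\<rbrakk> \<Longrightarrow>
     (LINT s|leb01. indicator {a..b} s * ((u'' s - ld s * u s) * f s))
       = (u' b * f b - u b * f' b) - (u' a * f a - u a * f' a) - al * (LINT s|leb01. indicator {a..b} s * (u s * f s))"
proof -
  from eig obtain f' h where df: "\<And>x. x \<in> {0..1} \<Longrightarrow> (f has_real_derivative f' x) (at x within {0..1})"
    and h: "integrable leb01 h" and f': "\<And>x. x \<in> {0..1} \<Longrightarrow> f' x = f' 0 + (LINT y|lebesgue_on {0..x}. h y)"
    and bc: "f' 0 = 0" "f' 1 = 0" and ode: "AE x in leb01. - h x + ld x * f x = al * f x"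
    unfolding neumann_eigenfunction_def by blast
  have hi: "h integrable_on {0..1}"
    using integrable_leb_subinterval[OF h, of 0 1] by (simp add: absolutely_integrable_on_def)
  have f'i: "f' x = f' 0 + integral {0..x} h" if "x \<in> {0..1}" for x
  proof -
    have "h absolutely_integrable_on {0..x}" by (rule integrable_leb_subinterval[OF h]) (use that in auto)
    hence "(LINT y|lebesgue_on {0..x}. h y) = integral {0..x} h"
      by (intro lebesgue_integral_eq_integral) (auto simp: set_integrable_def integrable_restrict_space)
    thus ?thesis using f'[OF that] by simp
  qed
  have cf': "continuous_on {0..1} f'"
  proof (rule continuous_on_eq)
    show "continuous_on {0..1} (\<lambda>x. f' 0 + integral {0..x} h)"
      by (intro continuous_on_add continuous_on_const indefinite_integral_continuous_1 hi)
  qed (rule f'i[symmetric])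
  have cf: "continuous_on {0..1} f" by (rule DERIV_continuous_on[OF df])
  obtain Z where Z: "Z \<in> null_sets lebesgue" "{x. \<not> (x \<in> {0..1} \<longrightarrow> - h x + ld x * f x = al * f x)} \<subseteq> Z"
  proof -
    have "AE x in lebesgue. x \<in> {0..1} \<longrightarrow> - h x + ld x * f x = al * f x"
      using ode by (subst (asm) AE_restrict_space_iff) auto
    thus ?thesis using that unfolding eventually_ae_filter by auto
  qed
  have neg: "negligible Z" using Z(1) by (simp add: negligible_iff_null_sets)
  show ?thesis
  proof (rule that[OF df cf' bc])
    fix a b u u' u''
    assume ab: "0 \<le> a" "a \<le> (b::real)" "b \<le> 1"
      and du: "\<And>s. s \<in> {a..b} \<Longrightarrow> (u has_real_derivative u' s) (at s within {a..b})"
      and du': "\<And>s. s \<in> {a..b} \<Longrightarrow> (u' has_real_derivative u'' s) (at s within {a..b})"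
      and cu'': "continuous_on {a..b} u''"
    have sub: "{a..b} \<subseteq> {0..1}" using ab by auto
    have cu': "continuous_on {a..b} u'" by (rule DERIV_continuous_on[OF du'])
    have cu: "continuous_on {a..b} u" by (rule DERIV_continuous_on[OF du])
    have cfab: "continuous_on {a..b} f" "continuous_on {a..b} f'"
      using continuous_on_subset[OF _ sub] cf cf' by auto
    have hab: "h absolutely_integrable_on {a..b}" by (rule integrable_leb_subinterval[OF h ab(1,3)])
    have f'a: "f' s = f' a + integral {a..s} h" if s: "s \<in> {a..b}" for s
    proof -
      have "h integrable_on {0..s}" by (rule integrable_subinterval_real[OF hi]) (use s ab in auto)
      hence "integral {0..a} h + integral {a..s} h = integral {0..s} h"
        by (intro Henstock_Kurzweil_Integration.integral_combine) (use s ab in auto)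
      moreover have "a \<in> {0..1}" "s \<in> {0..1}" using s ab by auto
      ultimately show ?thesis using f'i[of a] f'i[of s] by linarith
    qed
    have p1: "integral {a..b} (\<lambda>s. u s * h s) = u b * f' b - u a * f' a - integral {a..b} (\<lambda>s. f' s * u' s)"
      by (rule integral_by_parts_absolutely_continuous[OF ab(2) cu' du hab f'a])
    have u'a: "u' s = u' a + integral {a..s} u''" if s: "s \<in> {a..b}" for s
    proof -
      have "(u'' has_integral u' s - u' a) {a..s}"
      proof (rule fundamental_theorem_of_calculus)
        fix r assume r: "r \<in> {a..s}"
        hence "(u' has_real_derivative u'' r) (at r within {a..s})"
          using s by (intro has_field_derivative_subset[OF du']) auto
        thus "(u' has_vector_derivative u'' r) (at r within {a..s})"
          by (simp only: has_real_derivative_iff_has_vector_derivative)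
      qed (use s in auto)
      thus ?thesis by (simp add: integral_unique)
    qed
    have df_ab: "(f has_real_derivative f' s) (at s within {a..b})" if "s \<in> {a..b}" for s
      by (rule has_field_derivative_subset[OF df sub]) (use that sub in auto)
    have p2: "integral {a..b} (\<lambda>s. f s * u'' s) = f b * u' b - f a * u' a - integral {a..b} (\<lambda>s. u' s * f' s)"
      by (rule integral_by_parts_absolutely_continuous[OF ab(2) cfab(2) df_ab absolutely_integrable_continuous_real[OF cu''] u'a])
    let ?F = "\<lambda>s. (u'' s - ld s * u s) * f s" and ?G = "\<lambda>s. f s * u'' s - u s * h s - al * (u s * f s)"
    have uh: "(\<lambda>s. u s * h s) absolutely_integrable_on {a..b}"
      by (rule absolutely_integrable_bounded_measurable_product_real[OF _ _ _ hab])
         (use cu in \<open>auto intro!: continuous_imp_measurable_on_sets_lebesgue compact_imp_bounded compact_continuous_image\<close>)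
    have fu: "(\<lambda>s. f s * u'' s) absolutely_integrable_on {a..b}" "(\<lambda>s. al * (u s * f s)) absolutely_integrable_on {a..b}"
       "(\<lambda>s. u s * f s) absolutely_integrable_on {a..b}"
      by (intro absolutely_integrable_continuous_real continuous_intros cfab cu cu'')+
    have GF: "?F s = ?G s" if "s \<in> {a..b} - Z" for s
    proof -
      have "- h s + ld s * f s = al * f s" using Z(2) that sub by blast
      hence "ld s * f s = h s + al * f s" by simp
      moreover have "?F s = f s * u'' s - u s * (ld s * f s)" by (simp add: algebra_simps)
      ultimately show ?thesis by (simp add: algebra_simps)
    qed
    have Gi: "?G absolutely_integrable_on {a..b}"
      by (intro set_integral_diff(1) uh fu)
    have Fi: "?F absolutely_integrable_on {a..b}"
      by (rule absolutely_integrable_spike[OF Gi neg GF])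
    have "(LINT s|leb01. indicator {a..b} s * ?F s) = integral {a..b} ?F"
      by (rule integral_indicator_leb01[OF ab(1,3) Fi])
    also have "\<dots> = integral {a..b} ?G"
      by (rule integral_spike[OF neg GF[symmetric]])
    also have "\<dots> = integral {a..b} (\<lambda>s. f s * u'' s) - integral {a..b} (\<lambda>s. u s * h s) - integral {a..b} (\<lambda>s. al * (u s * f s))"
      using uh fu by (simp add: absolutely_integrable_on_def Henstock_Kurzweil_Integration.integral_diff
          Henstock_Kurzweil_Integration.integrable_diff)
    also have "\<dots> = (u' b * f b - u b * f' b) - (u' a * f a - u a * f' a) - al * integral {a..b} (\<lambda>s. u s * f s)"
      unfolding p1 p2 by (simp add: mult.commute)
    also have "integral {a..b} (\<lambda>s. u s * f s) = (LINT s|leb01. indicator {a..b} s * (u s * f s))"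
      by (rule integral_indicator_leb01[OF ab(1,3) fu(3), symmetric])
    finally show "(LINT s|leb01. indicator {a..b} s * ?F s)
       = (u' b * f b - u b * f' b) - (u' a * f a - u a * f' a) - al * (LINT s|leb01. indicator {a..b} s * (u s * f s))" .
  qed
qed

section \<open>Coefficients of the densities\<close>

lemma cube_integral_bound:
  fixes f :: "(nat \<Rightarrow> real) \<Rightarrow> real"
  assumes "f \<in> borel_measurable (cube_measure n)" "\<And>x. x \<in> closed_cube n \<Longrightarrow> \<bar>f x\<bar> \<le> B"
  shows "\<bar>LINT x|cube_measure n. f x\<bar> \<le> B"
proof -
  interpret prob_space "cube_measure n" by (rule prob_cube)
  have "\<bar>LINT x|cube_measure n. f x\<bar> \<le> (LINT x|cube_measure n. \<bar>f x\<bar>)"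
    using integral_norm_bound[of "cube_measure n" f] by simp
  also have "\<dots> \<le> (LINT x|cube_measure n. B)"
    by (rule integral_mono) (use assms in \<open>auto simp: space_cube intro!: cube_integrable[of _ _ B]\<close>)
  also have "\<dots> = B" using prob_space by simp
  finally show ?thesis .
qed

lemma continuous_on_compact_bounded:
  fixes f :: "'a::topological_space \<Rightarrow> real"
  assumes "compact K" "continuous_on K f"
  obtains B where "B \<ge> 0" "\<And>x. x \<in> K \<Longrightarrow> \<bar>f x\<bar> \<le> B"
proof -
  have "bounded (f ` K)" by (rule compact_imp_bounded[OF compact_continuous_image[OF assms(2,1)]])
  then obtain B where "\<And>x. x \<in> K \<Longrightarrow> \<bar>f x\<bar> \<le> B" by (auto simp: bounded_iff)
  hence "\<And>x. x \<in> K \<Longrightarrow> \<bar>f x\<bar> \<le> \<bar>B\<bar>" using order_trans[OF _ abs_ge_self] by blast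
  thus ?thesis using that[of "\<bar>B\<bar>"] by auto
qed

text \<open>
  By compactness, \<open>g\<close> has a positive minimum on the part of \<open>K\<close> where \<open>\<bar>f\<bar> \<ge> e\<close>.
\<close>

lemma small_near_zero_set:
  fixes f g :: "'a::topological_space \<Rightarrow> real"
  assumes K: "compact K" and f: "continuous_on K f" and g: "continuous_on K g"
    and z: "\<And>x. x \<in> K \<Longrightarrow> g x \<le> 0 \<Longrightarrow> f x = 0" and e: "0 < e"
  obtains d where "0 < d" "\<And>x. x \<in> K \<Longrightarrow> g x < d \<Longrightarrow> \<bar>f x\<bar> < e"
proof -
  let ?K = "K \<inter> (\<lambda>x. \<bar>f x\<bar>) -` {e..}"
  obtain C where C: "closed C" "?K = K \<inter> C"
  proof -
    have c: "continuous_on K (\<lambda>x. \<bar>f x\<bar>)" by (intro continuous_intros f)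
    have "closedin (top_of_set K) ?K" by (rule continuous_closedin_preimage[OF c closed_atLeast])
    thus ?thesis using that by (auto simp: closedin_closed)
  qed
  have cK: "compact ?K" unfolding C(2) by (rule compact_Int_closed[OF K C(1)])
  show ?thesis
  proof (cases "?K = {}")
    case True
    thus ?thesis by (intro that[of 1]) (auto simp: not_le)
  next
    case False
    have "continuous_on ?K g" using g by (rule continuous_on_subset) auto
    from continuous_attains_inf[OF cK False this]
    obtain x where x: "x \<in> ?K" "\<And>y. y \<in> ?K \<Longrightarrow> g x \<le> g y" by blast
    have "g x > 0" using z[of x] x(1) e by (cases "g x \<le> 0") auto
    thus ?thesis by (rule that[of "g x"]) (use x(2) in \<open>force simp: not_le[symmetric]\<close>)
  qed
qed

lemma compact_time_subcube: "compact ({s..t::real} \<times> subcube n a b)"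
  by (intro compact_Times compact_subcube) simp

text \<open>
  A solution with its derivatives. The assumption \<open>ld_expand\<close> is what closes the system of coefficients
  with indices up to \<open>N\<close>.
\<close>

locale cdme_model =
  fixes ld lc :: "real \<Rightarrow> real" and \<xi> :: "nat \<Rightarrow> real \<Rightarrow> real" and \<alpha> :: "nat \<Rightarrow> real" and N :: nat
    and \<rho> \<rho>t :: "nat \<Rightarrow> real \<Rightarrow> (nat \<Rightarrow> real) \<Rightarrow> real"
    and D :: "nat \<Rightarrow> nat \<Rightarrow> real \<Rightarrow> (nat \<Rightarrow> real) \<Rightarrow> real"
    and DD :: "nat \<Rightarrow> nat \<Rightarrow> nat \<Rightarrow> real \<Rightarrow> (nat \<Rightarrow> real) \<Rightarrow> real"
    and d c :: "nat \<Rightarrow> real" and \<gamma> :: real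
  assumes ld: "nonneg_bounded_measurable ld" and lc: "nonneg_bounded_measurable lc"
    and eig: "\<And>k. k \<in> {1..N} \<Longrightarrow> neumann_eigenfunction ld (\<alpha> k) (\<xi> k)"
    and \<xi>m: "\<And>k. k \<in> {1..N} \<Longrightarrow> \<xi> k \<in> borel_measurable leb01"
    and ld_expand: "AE y in leb01. ld y = (\<Sum>k=1..N. d k * \<xi> k y)"
    and c_def: "\<And>k. c k = (LINT y|leb01. lc y * \<xi> k y)"
    and \<gamma>_def: "\<gamma> = (LINT y|leb01. lc y)"
    and \<rho>_cont: "\<And>n. continuous_on ({0..} \<times> closed_cube n) (\<lambda>(t, x). \<rho> n t x)"
    and \<rho>t_deriv: "\<And>n t x. t > 0 \<Longrightarrow> x \<in> open_cube n \<Longrightarrow> ((\<lambda>s. \<rho> n s x) has_real_derivative \<rho>t n t x) (at t)"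
    and \<rho>t_cont: "\<And>n. continuous_on ({0<..} \<times> open_cube n) (\<lambda>(t, x). \<rho>t n t x)"
    and D_deriv: "\<And>n i t x. i \<in> {1..n} \<Longrightarrow> t \<ge> 0 \<Longrightarrow> x \<in> closed_cube n \<Longrightarrow>
        ((\<lambda>s. \<rho> n t (x(i := s))) has_real_derivative D n i t x) (at (x i) within {0..1})"
    and D_cont: "\<And>n i. i \<in> {1..n} \<Longrightarrow> continuous_on ({0..} \<times> closed_cube n) (\<lambda>(t, x). D n i t x)"
    and DD_deriv: "\<And>n i t x. i \<in> {1..n} \<Longrightarrow> t > 0 \<Longrightarrow> x \<in> open_cube n \<Longrightarrow>
        ((\<lambda>s. D n i t (x(i := s))) has_real_derivative DD n i i t x) (at (x i))"
    and DD_cont: "\<And>n i. i \<in> {1..n} \<Longrightarrow> continuous_on ({0<..} \<times> open_cube n) (\<lambda>(t, x). DD n i i t x)"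
    and eq_0: "\<And>t. t > 0 \<Longrightarrow> \<rho>t 0 t (\<lambda>_. undefined) =
        (LINT y|leb01. ld y * \<rho> 1 t ((\<lambda>_. undefined)(1 := y))) - (LINT y|leb01. lc y) * \<rho> 0 t (\<lambda>_. undefined)"
    and eq_n: "\<And>n t x. n \<ge> 1 \<Longrightarrow> t > 0 \<Longrightarrow> x \<in> open_cube n \<Longrightarrow> \<rho>t n t x =
        (\<Sum>i=1..n. DD n i i t x)
        + real (n + 1) * (LINT y|leb01. ld y * \<rho> (n + 1) t (x(n + 1 := y)))
        - (\<Sum>i=1..n. ld (x i) * \<rho> n t x)
        + 1 / real n * (\<Sum>i=1..n. lc (x i) * \<rho> (n - 1) t (drop_coord n i x))
        - (LINT y|leb01. lc y) * \<rho> n t x"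
    and neumann: "\<And>n t x i. n \<ge> 1 \<Longrightarrow> t \<ge> 0 \<Longrightarrow> x \<in> closed_cube n \<Longrightarrow> i \<in> {1..n} \<Longrightarrow> x i \<in> {0, 1} \<Longrightarrow> D n i t x = 0"
begin

definition density_coef :: "nat \<Rightarrow> (nat \<Rightarrow> nat) \<Rightarrow> real \<Rightarrow> real" where
  "density_coef n j t = (LINT x|cube_measure n. \<rho> n t x * tensor \<xi> n j x)"

lemma cont_at_time:
  assumes "continuous_on (A \<times> B) (\<lambda>(t, x). f t x)" "t \<in> A"
  shows "continuous_on B (f t)"
proof -
  have "continuous_on B (\<lambda>x. (t, x))" by (intro continuous_intros)
  from continuous_on_compose2[OF assms(1) this] show ?thesis using assms(2) by auto
qed

lemma \<rho>_meas: "t \<ge> 0 \<Longrightarrow> \<rho> n t \<in> borel_measurable (cube_measure n)"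
  by (rule measurable_cube, rule cont_at_time[OF \<rho>_cont]) simp

lemma \<rho>_bound:
  obtains B where "B \<ge> 0" "\<And>t x. 0 \<le> t \<Longrightarrow> t \<le> T \<Longrightarrow> x \<in> closed_cube n \<Longrightarrow> \<bar>\<rho> n t x\<bar> \<le> B"
proof -
  have "continuous_on ({0..T} \<times> subcube n 0 1) (\<lambda>(t, x). \<rho> n t x)"
    by (rule continuous_on_subset[OF \<rho>_cont]) (auto simp: closed_cube_subcube)
  from continuous_on_compact_bounded[OF compact_time_subcube this] obtain B where
    "B \<ge> 0" "\<And>z. z \<in> {0..T} \<times> subcube n 0 1 \<Longrightarrow> \<bar>(\<lambda>(t, x). \<rho> n t x) z\<bar> \<le> B" by blast
  thus ?thesis by (intro that[of B]) (auto simp: closed_cube_subcube)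
qed

lemma \<xi>_bound:
  obtains C where "C \<ge> 1" "\<And>k s. k \<in> {1..N} \<Longrightarrow> s \<in> {0..1} \<Longrightarrow> \<bar>\<xi> k s\<bar> \<le> C"
proof -
  have "\<exists>B. \<forall>s\<in>{0..1}. \<bar>\<xi> k s\<bar> \<le> B" if k: "k \<in> {1..N}" for k
  proof -
    from neumann_eigenfunction_green[OF eig[OF k]] obtain f' where
      "\<And>x. x \<in> {0..1} \<Longrightarrow> (\<xi> k has_real_derivative f' x) (at x within {0..1})" by metis
    hence "continuous_on {0..1} (\<xi> k)" by (rule DERIV_continuous_on)
    from continuous_on_compact_bounded[OF compact_Icc this] show ?thesis by metis
  qed
  then obtain B where B: "\<And>k s. k \<in> {1..N} \<Longrightarrow> s \<in> {0..1} \<Longrightarrow> \<bar>\<xi> k s\<bar> \<le> B k" by metis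
  define C where "C = Max (insert 1 (B ` {1..N}))"
  have "B k \<le> C" if "k \<in> {1..N}" for k unfolding C_def by (rule Max_ge) (use that in auto)
  moreover have "1 \<le> C" unfolding C_def by (rule Max_ge) auto
  ultimately show ?thesis using B by (intro that[of C]) (auto intro: order_trans)
qed

lemma tensor_meas: "j ` {1..n} \<subseteq> {1..N} \<Longrightarrow> tensor \<xi> n j \<in> borel_measurable (cube_measure n)"
  by (rule measurable_tensor, rule \<xi>m) blast

lemma ld_bound: obtains B where "B \<ge> 0" "\<And>s. s \<in> {0..1} \<Longrightarrow> \<bar>ld s\<bar> \<le> B"
proof -
  from ld obtain B where "\<And>s. s \<in> {0..1} \<Longrightarrow> 0 \<le> ld s \<and> ld s \<le> B"
    unfolding nonneg_bounded_measurable_def by blast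
  thus ?thesis using that[of "\<bar>B\<bar>"] by force
qed

lemma lc_bound: obtains B where "B \<ge> 0" "\<And>s. s \<in> {0..1} \<Longrightarrow> \<bar>lc s\<bar> \<le> B"
proof -
  from lc obtain B where "\<And>s. s \<in> {0..1} \<Longrightarrow> 0 \<le> lc s \<and> lc s \<le> B"
    unfolding nonneg_bounded_measurable_def by blast
  thus ?thesis using that[of "\<bar>B\<bar>"] by force
qed

text \<open>
  Dominated convergence; \<open>\<rho> n\<close> is bounded on compact time intervals.
\<close>

lemma density_coef_continuous:
  assumes j: "j ` {1..n} \<subseteq> {1..N}"
  shows "continuous_on {0..} (density_coef n j)"
  unfolding continuous_on_sequentially comp_def
proof (intro allI ballI impI)
  fix u :: "nat \<Rightarrow> real" and t :: real
  assume t: "t \<in> {0..}" and "(\<forall>m. u m \<in> {0..}) \<and> u \<longlonglongrightarrow> t"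
  hence u: "\<And>m. 0 \<le> u m" "u \<longlonglongrightarrow> t" by auto
  obtain T where T: "\<And>m. u m \<le> T"
    using convergent_imp_Bseq[of u] u(2) unfolding convergent_def by (auto simp: Bseq_def abs_le_iff)
  obtain B where B: "B \<ge> 0" "\<And>t x. 0 \<le> t \<Longrightarrow> t \<le> T \<Longrightarrow> x \<in> closed_cube n \<Longrightarrow> \<bar>\<rho> n t x\<bar> \<le> B"
    using \<rho>_bound by blast
  obtain C where C: "C \<ge> 1" "\<And>k s. k \<in> {1..N} \<Longrightarrow> s \<in> {0..1} \<Longrightarrow> \<bar>\<xi> k s\<bar> \<le> C" using \<xi>_bound by blast
  have tb: "\<bar>tensor \<xi> n j x\<bar> \<le> C ^ n" if "x \<in> closed_cube n" for x
    by (rule tensor_bound[OF C(2) that]) (use j in blast)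
  interpret prob_space "cube_measure n" by (rule prob_cube)
  show "(\<lambda>m. density_coef n j (u m)) \<longlonglongrightarrow> density_coef n j t"
    unfolding density_coef_def
  proof (rule integral_dominated_convergence[where w = "\<lambda>_. B * C ^ n"])
    show "(\<lambda>x. \<rho> n t x * tensor \<xi> n j x) \<in> borel_measurable (cube_measure n)"
      using t by (intro borel_measurable_times \<rho>_meas tensor_meas j) auto
    show "(\<lambda>x. \<rho> n (u m) x * tensor \<xi> n j x) \<in> borel_measurable (cube_measure n)" for m
      by (intro borel_measurable_times \<rho>_meas tensor_meas j u)
    show "AE x in cube_measure n. (\<lambda>m. \<rho> n (u m) x * tensor \<xi> n j x) \<longlonglongrightarrow> \<rho> n t x * tensor \<xi> n j x"
    proof (rule AE_I2)
      fix x assume "x \<in> space (cube_measure n)"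
      hence x: "x \<in> closed_cube n" by (simp add: space_cube)
      have "(\<lambda>m. (\<lambda>(t, x). \<rho> n t x) (u m, x)) \<longlonglongrightarrow> (\<lambda>(t, x). \<rho> n t x) (t, x)"
        by (rule continuous_on_tendsto_compose[OF \<rho>_cont]) (use u t x in \<open>auto intro!: tendsto_intros\<close>)
      thus "(\<lambda>m. \<rho> n (u m) x * tensor \<xi> n j x) \<longlonglongrightarrow> \<rho> n t x * tensor \<xi> n j x"
        by (intro tendsto_mult tendsto_const) simp
    qed
    show "AE x in cube_measure n. norm (\<rho> n (u m) x * tensor \<xi> n j x) \<le> B * C ^ n" for m
      by (rule AE_I2) (use B u(1) T tb in \<open>auto simp: space_cube abs_mult intro!: mult_mono\<close>)
  qed simp
qed

lemma up_meas:
  assumes "t \<ge> 0"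
  shows "(\<lambda>x. LINT y|leb01. ld y * \<rho> (n + 1) t (x(n + 1 := y))) \<in> borel_measurable (cube_measure n)"
proof (rule leb01.borel_measurable_lebesgue_integral)
  have "(\<lambda>(x, s). x(n + 1 := s)) \<in> cube_measure n \<Otimes>\<^sub>M leb01 \<rightarrow>\<^sub>M cube_measure (n + 1)"
    unfolding case_prod_unfold by (rule measurable_fun_upd[where J = "{1..n}"]) auto
  from measurable_compose[OF this \<rho>_meas[OF assms]]
  have "(\<lambda>z. \<rho> (n + 1) t (case z of (x, s) \<Rightarrow> x(n + 1 := s))) \<in> borel_measurable (cube_measure n \<Otimes>\<^sub>M leb01)" .
  moreover have "(\<lambda>z. ld (snd z)) \<in> borel_measurable (cube_measure n \<Otimes>\<^sub>M leb01)"
    by (rule measurable_compose[OF measurable_snd]) (use ld in \<open>simp add: nonneg_bounded_measurable_def\<close>)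
  ultimately show "(\<lambda>(x, y). ld y * \<rho> (n + 1) t (x(n + 1 := y))) \<in> borel_measurable (cube_measure n \<Otimes>\<^sub>M leb01)"
    unfolding case_prod_unfold by (rule borel_measurable_times[rotated])
qed

lemma slice_meas:
  assumes t: "t \<ge> 0" and x: "x \<in> closed_cube n"
  shows "(\<lambda>y. \<rho> (n + 1) t (x(n + 1 := y))) \<in> borel_measurable leb01"
proof -
  have 1: "(\<lambda>(x, s). x(n + 1 := s)) \<in> cube_measure n \<Otimes>\<^sub>M leb01 \<rightarrow>\<^sub>M cube_measure (n + 1)"
    unfolding case_prod_unfold by (rule measurable_fun_upd[where J = "{1..n}"]) auto
  have "(\<lambda>s. (x, s)) \<in> leb01 \<rightarrow>\<^sub>M cube_measure n \<Otimes>\<^sub>M leb01"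
    by (rule measurable_Pair1') (simp add: space_cube x)
  from measurable_compose[OF this measurable_compose[OF 1 \<rho>_meas[OF t]]] show ?thesis by simp
qed

lemma up_bound:
  assumes t: "0 \<le> t" and x: "x \<in> closed_cube n" and f: "f \<in> borel_measurable leb01"
    and fB: "\<And>s. s \<in> {0..1} \<Longrightarrow> \<bar>f s\<bar> \<le> B" and B0: "0 \<le> B"
    and \<rho>B: "\<And>x. x \<in> closed_cube (n + 1) \<Longrightarrow> \<bar>\<rho> (n + 1) t x\<bar> \<le> B'" and B0': "0 \<le> B'"
  shows "\<bar>LINT y|leb01. f y * \<rho> (n + 1) t (x(n + 1 := y))\<bar> \<le> B * B'"
    and "integrable leb01 (\<lambda>y. f y * \<rho> (n + 1) t (x(n + 1 := y)))"
proof -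
  let ?f = "\<lambda>y. f y * \<rho> (n + 1) t (x(n + 1 := y))"
  have m: "?f \<in> borel_measurable leb01" by (intro borel_measurable_times f slice_meas[OF t x])
  have b: "\<bar>?f y\<bar> \<le> B * B'" if "y \<in> {0..1}" for y
    unfolding abs_mult using fB[OF that] \<rho>B[of "x(n + 1 := y)"] cube_append[OF x that] B0 B0'
    by (intro mult_mono) auto
  show i: "integrable leb01 ?f" by (rule leb01_integrable[OF m b])
  have "\<bar>LINT y|leb01. ?f y\<bar> \<le> (LINT y|leb01. \<bar>?f y\<bar>)"
    using integral_norm_bound[of leb01 ?f] by simp
  also have "\<dots> \<le> (LINT y|leb01. B * B')"
    by (rule integral_mono) (use i b in auto)
  also have "\<dots> = B * B'" using leb01.prob_space by simp
  finally show "\<bar>LINT y|leb01. ?f y\<bar> \<le> B * B'" .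
qed

lemma tensor_append:
  "tensor \<xi> (n + 1) (j(n + 1 := k)) (x(n + 1 := y)) = tensor \<xi> n j x * \<xi> k y"
proof -
  have "(\<Prod>i=1..n. \<xi> ((j(n + 1 := k)) i) ((x(n + 1 := y)) i)) = (\<Prod>i=1..n. \<xi> (j i) (x i))"
    by (rule prod.cong) auto
  moreover have "{1..n + 1} = insert (n + 1) {1..n}" by auto
  ultimately show ?thesis unfolding tensor_def by simp
qed

text \<open>
  The extra particle is integrated against the finite expansion of \<open>ld\<close>, which produces one more tensor
  factor.
\<close>

lemma up_coef:
  assumes t: "0 \<le> t" and j: "j ` {1..n} \<subseteq> {1..N}"
  shows "(LINT x|cube_measure n. (LINT y|leb01. ld y * \<rho> (n + 1) t (x(n + 1 := y))) * tensor \<xi> n j x)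
    = (\<Sum>k=1..N. d k * density_coef (n + 1) (j(n + 1 := k)) t)"
proof -
  obtain B' where B': "B' \<ge> 0" "\<And>x. x \<in> closed_cube (n + 1) \<Longrightarrow> \<bar>\<rho> (n + 1) t x\<bar> \<le> B'"
    using \<rho>_bound[of t "n + 1"] t by (metis order.refl)
  obtain C where C: "C \<ge> 1" "\<And>k s. k \<in> {1..N} \<Longrightarrow> s \<in> {0..1} \<Longrightarrow> \<bar>\<xi> k s\<bar> \<le> C" using \<xi>_bound by blast
  have I: "integrable leb01 (\<lambda>y. \<xi> k y * \<rho> (n + 1) t (x(n + 1 := y)))" if "k \<in> {1..N}" "x \<in> closed_cube n" for k x
    by (rule up_bound(2)[OF t that(2) \<xi>m[OF that(1)] C(2)[OF that(1)] _ B'(2,1)]) (use C(1) in auto)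
  have inner: "(LINT y|leb01. ld y * \<rho> (n + 1) t (x(n + 1 := y)))
     = (\<Sum>k=1..N. d k * (LINT y|leb01. \<xi> k y * \<rho> (n + 1) t (x(n + 1 := y))))" if x: "x \<in> closed_cube n" for x
  proof -
    have "(LINT y|leb01. ld y * \<rho> (n + 1) t (x(n + 1 := y)))
      = (LINT y|leb01. (\<Sum>k=1..N. d k * (\<xi> k y * \<rho> (n + 1) t (x(n + 1 := y)))))"
    proof (rule integral_cong_AE)
      show "(\<lambda>y. ld y * \<rho> (n + 1) t (x(n + 1 := y))) \<in> borel_measurable leb01"
        using ld by (intro borel_measurable_times slice_meas[OF t x]) (simp add: nonneg_bounded_measurable_def)
      show "(\<lambda>y. \<Sum>k=1..N. d k * (\<xi> k y * \<rho> (n + 1) t (x(n + 1 := y)))) \<in> borel_measurable leb01"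
        by (intro borel_measurable_sum borel_measurable_times borel_measurable_const \<xi>m slice_meas[OF t x])
      show "AE y in leb01. ld y * \<rho> (n + 1) t (x(n + 1 := y)) = (\<Sum>k=1..N. d k * (\<xi> k y * \<rho> (n + 1) t (x(n + 1 := y))))"
        using ld_expand by eventually_elim (simp add: sum_distrib_right mult.assoc)
    qed
    also have "\<dots> = (\<Sum>k=1..N. LINT y|leb01. d k * (\<xi> k y * \<rho> (n + 1) t (x(n + 1 := y))))"
      by (intro Bochner_Integration.integral_sum integrable_mult_right I x)
    finally show ?thesis by (simp only: integral_mult_right_zero)
  qed
  have rk: "(LINT x|cube_measure n. (LINT y|leb01. \<xi> k y * \<rho> (n + 1) t (x(n + 1 := y))) * tensor \<xi> n j x)
      = density_coef (n + 1) (j(n + 1 := k)) t"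
    and ik: "integrable (cube_measure n) (\<lambda>x. (LINT y|leb01. \<xi> k y * \<rho> (n + 1) t (x(n + 1 := y))) * tensor \<xi> n j x)"
    if k: "k \<in> {1..N}" for k
  proof -
    let ?j = "j(n + 1 := k)"
    let ?F = "\<lambda>x. \<rho> (n + 1) t x * tensor \<xi> (n + 1) ?j x"
    have j': "?j ` {1..n + 1} \<subseteq> {1..N}" using j k by auto
    have Fi: "integrable (cube_measure (n + 1)) ?F"
    proof (rule cube_integrable)
      show "?F \<in> borel_measurable (cube_measure (n + 1))"
        by (intro borel_measurable_times \<rho>_meas tensor_meas j' t)
      show "\<bar>?F x\<bar> \<le> B' * C ^ (n + 1)" if x: "x \<in> closed_cube (n + 1)" for x
        unfolding abs_mult
      proof (intro mult_mono B' x tensor_bound[OF C(2) x])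
        show "(j(n + 1 := k)) l \<in> {1..N}" if "l \<in> {1..n + 1}" for l using j' that by blast
      qed auto
    qed
    have ins: "{1..n + 1} = insert (n + 1) {1..n}" by auto
    have eq: "(LINT y|leb01. ?F (x(n + 1 := y))) = (LINT y|leb01. \<xi> k y * \<rho> (n + 1) t (x(n + 1 := y))) * tensor \<xi> n j x" for x
      unfolding tensor_append integral_mult_left_zero[symmetric] by (simp only: mult_ac)
    have "density_coef (n + 1) ?j t = (LINT x|cube_measure n. (LINT y|leb01. ?F (x(n + 1 := y))))"
      unfolding density_coef_def ins by (rule cube.product_integral_insert) (use Fi in \<open>auto simp: ins\<close>)
    thus "(LINT x|cube_measure n. (LINT y|leb01. \<xi> k y * \<rho> (n + 1) t (x(n + 1 := y))) * tensor \<xi> n j x) = density_coef (n + 1) ?j t"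
      unfolding eq by simp
    show "integrable (cube_measure n) (\<lambda>x. (LINT y|leb01. \<xi> k y * \<rho> (n + 1) t (x(n + 1 := y))) * tensor \<xi> n j x)"
    proof (rule cube_integrable)
      have 1: "(\<lambda>(x, s). x(n + 1 := s)) \<in> cube_measure n \<Otimes>\<^sub>M leb01 \<rightarrow>\<^sub>M cube_measure (n + 1)"
        unfolding case_prod_unfold by (rule measurable_fun_upd[where J = "{1..n}"]) auto
      have "(\<lambda>z. \<rho> (n + 1) t (case z of (x, s) \<Rightarrow> x(n + 1 := s))) \<in> borel_measurable (cube_measure n \<Otimes>\<^sub>M leb01)"
        by (rule measurable_compose[OF 1 \<rho>_meas[OF t]])
      moreover have "(\<lambda>z. \<xi> k (snd z)) \<in> borel_measurable (cube_measure n \<Otimes>\<^sub>M leb01)"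
        by (rule measurable_compose[OF measurable_snd \<xi>m[OF k]])
      ultimately have "(\<lambda>(x, y). \<xi> k y * \<rho> (n + 1) t (x(n + 1 := y))) \<in> borel_measurable (cube_measure n \<Otimes>\<^sub>M leb01)"
        unfolding case_prod_unfold by (rule borel_measurable_times[rotated])
      thus "(\<lambda>x. (LINT y|leb01. \<xi> k y * \<rho> (n + 1) t (x(n + 1 := y))) * tensor \<xi> n j x) \<in> borel_measurable (cube_measure n)"
        by (intro borel_measurable_times tensor_meas j leb01.borel_measurable_lebesgue_integral)
      show "\<bar>(LINT y|leb01. \<xi> k y * \<rho> (n + 1) t (x(n + 1 := y))) * tensor \<xi> n j x\<bar> \<le> (C * B') * C ^ n"
        if x: "x \<in> closed_cube n" for x
        unfolding abs_mult
      proof (intro mult_mono up_bound(1)[OF t x \<xi>m[OF k] C(2)[OF k] _ B'(2,1)] tensor_bound[OF C(2) x])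
        show "j l \<in> {1..N}" if "l \<in> {1..n}" for l using j that by blast
      qed (use B' C(1) in auto)
    qed
  qed
  have "(LINT x|cube_measure n. (LINT y|leb01. ld y * \<rho> (n + 1) t (x(n + 1 := y))) * tensor \<xi> n j x)
    = (LINT x|cube_measure n. (\<Sum>k=1..N. d k * ((LINT y|leb01. \<xi> k y * \<rho> (n + 1) t (x(n + 1 := y))) * tensor \<xi> n j x)))"
    by (rule Bochner_Integration.integral_cong[OF refl])
       (simp only: space_cube inner sum_distrib_right mult.assoc)
  also have "\<dots> = (\<Sum>k=1..N. LINT x|cube_measure n. d k * ((LINT y|leb01. \<xi> k y * \<rho> (n + 1) t (x(n + 1 := y))) * tensor \<xi> n j x))"
    by (intro Bochner_Integration.integral_sum integrable_mult_right ik)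
  also have "\<dots> = (\<Sum>k=1..N. d k * density_coef (n + 1) (j(n + 1 := k)) t)"
    by (rule sum.cong) (simp_all only: integral_mult_right_zero rk)
  finally show ?thesis .
qed

end

section \<open>Creation terms and truncated test functions\<close>

context cdme_model
begin

lemma drop_coord_eq: "drop_coord n i x = (\<lambda>m\<in>{1..n - 1}. x (if m < i then m else Suc m))"
  unfolding drop_coord_def by (rule ext) simp

lemma drop_meas:
  assumes t: "0 \<le> t"
  shows "(\<lambda>x. \<rho> (n - 1) t (drop_coord n i x)) \<in> borel_measurable (cube_measure n)"
proof -
  have "(\<lambda>x. drop_coord n i x) \<in> cube_measure n \<rightarrow>\<^sub>M cube_measure (n - 1)"
    unfolding drop_coord_eq
  proof (rule measurable_restrict)
    show "(\<lambda>x. x (if m < i then m else Suc m)) \<in> cube_measure n \<rightarrow>\<^sub>M leb01" if "m \<in> {1..n - 1}" for m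
      by (rule measurable_component_singleton) (use that in auto)
  qed
  from measurable_compose[OF this \<rho>_meas[OF t]] show ?thesis .
qed

lemma drop_cube:
  assumes x: "x \<in> closed_cube n"
  shows "drop_coord n i x \<in> closed_cube (n - 1)"
proof -
  have "x (if m < i then m else Suc m) \<in> {0..1}" if "m \<in> {1..n - 1}" for m
  proof -
    have "(if m < i then m else Suc m) \<in> {1..n}" using that by auto
    thus ?thesis using x unfolding closed_cube_def by (rule PiE_mem[rotated])
  qed
  thus ?thesis unfolding drop_coord_eq closed_cube_def by (intro restrict_PiE_iff[THEN iffD2]) blast
qed

lemma tensor_remove:
  assumes i: "i \<in> {1..n}"
  shows "tensor \<eta> n j (x(i := s)) = \<eta> (j i) s * (\<Prod>l\<in>{1..n} - {i}. \<eta> (j l) (x l))"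
proof -
  have "(\<Prod>l\<in>{1..n} - {i}. \<eta> (j l) ((x(i := s)) l)) = (\<Prod>l\<in>{1..n} - {i}. \<eta> (j l) (x l))"
    by (rule prod.cong) auto
  moreover have "tensor \<eta> n j (x(i := s)) = \<eta> (j i) ((x(i := s)) i) * (\<Prod>l\<in>{1..n} - {i}. \<eta> (j l) ((x(i := s)) l))"
    unfolding tensor_def by (rule prod.remove) (use i in auto)
  ultimately show ?thesis by simp
qed

text \<open>
  The integral over \<open>x i\<close> splits off as the coefficient of \<open>lc\<close>, and the other coordinates are renumbered.
\<close>

lemma down_coef:
  assumes t: "0 \<le> t" and j: "j ` {1..n} \<subseteq> {1..N}" and i: "i \<in> {1..n}"
  shows "(LINT x|cube_measure n. (lc (x i) * \<rho> (n - 1) t (drop_coord n i x)) * tensor \<xi> n j x)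
    = c (j i) * density_coef (n - 1) (drop_nth i j) t"
proof -
  let ?I = "{1..n} - {i}"
  define h where "h = (\<lambda>l. if l < i then l else Suc l)"
  have h: "h ` {1..n - 1} = ?I" "inj_on h {1..n - 1}"
    unfolding h_def using skip_image[OF i] skip_inj by auto
  have ins: "insert i ?I = {1..n}" using i by auto
  let ?F = "\<lambda>x. (lc (x i) * \<rho> (n - 1) t (drop_coord n i x)) * tensor \<xi> n j x"
  let ?G = "\<lambda>y. \<rho> (n - 1) t y * tensor \<xi> (n - 1) (drop_nth i j) y"
  obtain B' where B': "B' \<ge> 0" "\<And>x. x \<in> closed_cube (n - 1) \<Longrightarrow> \<bar>\<rho> (n - 1) t x\<bar> \<le> B'"
    using \<rho>_bound[of t "n - 1"] t by (metis order.refl)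
  obtain C where C: "C \<ge> 1" "\<And>k s. k \<in> {1..N} \<Longrightarrow> s \<in> {0..1} \<Longrightarrow> \<bar>\<xi> k s\<bar> \<le> C" using \<xi>_bound by blast
  obtain Bl where Bl: "Bl \<ge> 0" "\<And>s. s \<in> {0..1} \<Longrightarrow> \<bar>lc s\<bar> \<le> Bl" using lc_bound by blast
  have lcm: "lc \<in> borel_measurable leb01" using lc by (simp add: nonneg_bounded_measurable_def)
  have jl: "j l \<in> {1..N}" if "l \<in> {1..n}" for l using j that by blast
  have j': "drop_nth i j ` {1..n - 1} \<subseteq> {1..N}"
    unfolding drop_nth_def by (rule image_subsetI) (use jl in auto)
  have Fi: "integrable (cube_measure n) ?F"
  proof (rule cube_integrable)
    show "?F \<in> borel_measurable (cube_measure n)"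
      by (intro borel_measurable_times drop_meas t tensor_meas j measurable_coord lcm i)
    show "\<bar>?F x\<bar> \<le> (Bl * B') * C ^ n" if x: "x \<in> closed_cube n" for x
      unfolding abs_mult
    proof (intro mult_mono Bl(2) B'(2) drop_cube x tensor_bound[OF C(2) x] jl)
      show "x i \<in> {0..1}" using x i unfolding closed_cube_def by (rule PiE_mem)
    qed (use Bl B' in auto)
  qed
  have F: "(LINT s|leb01. ?F (x(i := s))) = c (j i) * ?G (\<lambda>m\<in>{1..n - 1}. x (h m))" for x
  proof -
    let ?y = "\<lambda>m\<in>{1..n - 1}. x (h m)"
    have d: "drop_coord n i (x(i := s)) = ?y" for s
      unfolding drop_coord_eq h_def by (rule restrict_ext) auto
    have p: "(\<Prod>l\<in>?I. \<xi> (j l) (x l)) = tensor \<xi> (n - 1) (drop_nth i j) ?y"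
      unfolding h(1)[symmetric] prod.reindex[OF h(2)] tensor_def comp_def
      by (rule prod.cong) (auto simp: drop_nth_def h_def)
    have e: "?F (x(i := s)) = (lc s * \<xi> (j i) s) * ?G ?y" for s
      unfolding d tensor_remove[OF i] p by (simp only: fun_upd_same mult_ac)
    show ?thesis unfolding e integral_mult_left_zero c_def ..
  qed
  have Gm: "?G \<in> borel_measurable (cube_measure (n - 1))"
    by (intro borel_measurable_times \<rho>_meas t tensor_meas j')
  have "(LINT x|cube_measure n. ?F x) = (LINT x|PiM ?I (\<lambda>_. leb01). (LINT s|leb01. ?F (x(i := s))))"
    using cube.product_integral_insert[of ?I i ?F] Fi unfolding ins by simp
  also have "\<dots> = c (j i) * (LINT x|PiM ?I (\<lambda>_. leb01). ?G (\<lambda>m\<in>{1..n - 1}. x (h m)))"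
    unfolding F by (rule integral_mult_right_zero)
  also have "(LINT x|PiM ?I (\<lambda>_. leb01). ?G (\<lambda>m\<in>{1..n - 1}. x (h m)))
     = (LINT y|distr (PiM ?I (\<lambda>_. leb01)) (cube_measure (n - 1)) (\<lambda>x. \<lambda>m\<in>{1..n - 1}. x (h m)). ?G y)"
  proof (rule integral_distr[symmetric, OF _ Gm])
    show "(\<lambda>x. \<lambda>m\<in>{1..n - 1}. x (h m)) \<in> PiM ?I (\<lambda>_. leb01) \<rightarrow>\<^sub>M cube_measure (n - 1)"
      by (rule measurable_restrict, rule measurable_component_singleton) (use h(1) in blast)
  qed
  also have "distr (PiM ?I (\<lambda>_. leb01)) (cube_measure (n - 1)) (\<lambda>x. \<lambda>m\<in>{1..n - 1}. x (h m)) = cube_measure (n - 1)"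
    by (rule distr_PiM_reindex[OF prob_leb01 h(2)]) (use h(1) in blast)
  finally show ?thesis unfolding density_coef_def .
qed

definition eps :: "nat \<Rightarrow> real" where "eps m = 1 / (real m + 3)"

text \<open>
  Truncation is sharp: the boundary terms that it creates are exactly those of Green's identity on
  \<open>[eps m, 1 - eps m]\<close>.
\<close>

definition cutoff :: "nat \<Rightarrow> nat \<Rightarrow> real \<Rightarrow> real" where
  "cutoff m k s = indicator {eps m..1 - eps m} s * \<xi> k s"

lemma eps: "0 < eps m" "eps m < 1 / 2" "eps m \<le> 1 - eps m" "0 \<le> eps m"
  by (auto simp: eps_def field_simps)

lemma eps_lim: "eps \<longlonglongrightarrow> 0"
  unfolding eps_def by real_asymp

lemma cutoff_meas: "k \<in> {1..N} \<Longrightarrow> cutoff m k \<in> borel_measurable leb01"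
  unfolding cutoff_def by (intro borel_measurable_times \<xi>m borel_measurable_indicator) (use eps(4) in \<open>auto simp: sets_restrict_space_iff\<close>)

lemma Phi_meas: "j ` {1..n} \<subseteq> {1..N} \<Longrightarrow> tensor (cutoff m) n j \<in> borel_measurable (cube_measure n)"
  by (rule measurable_tensor, rule cutoff_meas) blast

lemma cutoff_bound:
  assumes "\<And>k s. k \<in> {1..N} \<Longrightarrow> s \<in> {0..1} \<Longrightarrow> \<bar>\<xi> k s\<bar> \<le> C" "0 \<le> C" "k \<in> {1..N}" "s \<in> {0..1}"
  shows "\<bar>cutoff m k s\<bar> \<le> C"
  using assms by (auto simp: cutoff_def indicator_def)

lemma Phi_zero:
  assumes "x \<in> closed_cube n" "x \<notin> subcube n (eps m) (1 - eps m)"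
  shows "tensor (cutoff m) n j x = 0"
proof -
  obtain l where "l \<in> {1..n}" "x l \<notin> {eps m..1 - eps m}"
    using assms by (auto simp: closed_cube_def subcube_def PiE_iff)
  hence "cutoff m (j l) (x l) = 0" by (simp add: cutoff_def)
  thus ?thesis unfolding tensor_def using \<open>l \<in> {1..n}\<close> by (intro prod_zero) auto
qed

lemma subcube_eps_open: "subcube n (eps m) (1 - eps m) \<subseteq> open_cube n"
  by (rule subcube_subset_open_cube) (use eps[of m] in auto)

definition window :: "nat \<Rightarrow> nat \<Rightarrow> (nat \<Rightarrow> real) \<Rightarrow> real" where
  "window n m x = (\<Prod>l=1..n. indicator {eps m..1 - eps m} (x l))"

lemma Phi_window: "tensor (cutoff m) n j x = window n m x * tensor \<xi> n j x"
  by (simp add: tensor_def cutoff_def window_def prod.distrib)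

lemma window_01: "0 \<le> window n m x" "window n m x \<le> 1"
  unfolding window_def by (auto intro!: prod_nonneg prod_le_1)

lemma window_integral:
  "integrable (cube_measure n) (window n m)"
  "(LINT x|cube_measure n. window n m x) = (1 - 2 * eps m) ^ n"
proof -
  have i: "integrable leb01 (indicator {eps m..1 - eps m} :: real \<Rightarrow> real)"
    by (rule leb01_integrable[of _ 1]) (use eps(4) in \<open>auto simp: indicator_def sets_restrict_space_iff intro!: borel_measurable_indicator\<close>)
  show "integrable (cube_measure n) (window n m)"
    unfolding window_def by (rule cube.product_integrable_prod) (auto intro: i)
  have "(LINT s|leb01. indicator {eps m..1 - eps m} s * 1 :: real) = integral {eps m..1 - eps m} (\<lambda>_. 1)"
    by (rule integral_indicator_leb01)
       (use eps[of m] in \<open>auto intro!: absolutely_integrable_continuous_real\<close>)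
  hence "(LINT s|leb01. indicator {eps m..1 - eps m} s :: real) = 1 - 2 * eps m"
    using eps[of m] by simp
  thus "(LINT x|cube_measure n. window n m x) = (1 - 2 * eps m) ^ n"
    unfolding window_def by (subst cube.product_integral_prod) (auto intro: i)
qed

text \<open>
  Removing the truncation costs the mass of the boundary layer, uniformly in all \<open>g\<close> with the bound \<open>B\<close>.
\<close>

lemma window_error:
  assumes j: "j ` {1..n} \<subseteq> {1..N}" and g: "g \<in> borel_measurable (cube_measure n)"
    and B: "\<And>x. x \<in> closed_cube n \<Longrightarrow> \<bar>g x\<bar> \<le> B" and B0: "0 \<le> B"
    and C: "\<And>k s. k \<in> {1..N} \<Longrightarrow> s \<in> {0..1} \<Longrightarrow> \<bar>\<xi> k s\<bar> \<le> C" "0 \<le> C"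
  shows "\<bar>(LINT x|cube_measure n. g x * tensor (cutoff m) n j x) - (LINT x|cube_measure n. g x * tensor \<xi> n j x)\<bar>
     \<le> B * C ^ n * (1 - (1 - 2 * eps m) ^ n)"
proof -
  interpret prob_space "cube_measure n" by (rule prob_cube)
  have jl: "j l \<in> {1..N}" if "l \<in> {1..n}" for l using j that by blast
  have tb: "\<bar>tensor \<xi> n j x\<bar> \<le> C ^ n" if "x \<in> closed_cube n" for x
    by (rule tensor_bound[OF _ that]) (rule C(1)[OF jl])
  have cb: "\<bar>tensor (cutoff m) n j x\<bar> \<le> C ^ n" if "x \<in> closed_cube n" for x
    by (rule tensor_bound[OF _ that]) (rule cutoff_bound[OF C jl])
  have i1: "integrable (cube_measure n) (\<lambda>x. g x * tensor (cutoff m) n j x)"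
    by (rule cube_integrable[of _ _ "B * C ^ n"])
       (use B B0 cb in \<open>auto intro!: borel_measurable_times g Phi_meas j mult_mono simp: abs_mult\<close>)
  have i2: "integrable (cube_measure n) (\<lambda>x. g x * tensor \<xi> n j x)"
    by (rule cube_integrable[of _ _ "B * C ^ n"])
       (use B B0 tb in \<open>auto intro!: borel_measurable_times g tensor_meas j mult_mono simp: abs_mult\<close>)
  have "\<bar>(LINT x|cube_measure n. g x * tensor (cutoff m) n j x) - (LINT x|cube_measure n. g x * tensor \<xi> n j x)\<bar>
    = \<bar>LINT x|cube_measure n. g x * tensor (cutoff m) n j x - g x * tensor \<xi> n j x\<bar>"
    by (simp only: Bochner_Integration.integral_diff[OF i1 i2])
  also have "\<dots> \<le> (LINT x|cube_measure n. \<bar>g x * tensor (cutoff m) n j x - g x * tensor \<xi> n j x\<bar>)"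
    using integral_norm_bound[of "cube_measure n" "\<lambda>x. g x * tensor (cutoff m) n j x - g x * tensor \<xi> n j x"] by simp
  also have "\<dots> \<le> (LINT x|cube_measure n. B * C ^ n * (1 - window n m x))"
  proof (rule integral_mono)
    show "integrable (cube_measure n) (\<lambda>x. \<bar>g x * tensor (cutoff m) n j x - g x * tensor \<xi> n j x\<bar>)"
      by (intro integrable_abs Bochner_Integration.integrable_diff i1 i2)
    show "integrable (cube_measure n) (\<lambda>x. B * C ^ n * (1 - window n m x))"
      by (intro integrable_mult_right Bochner_Integration.integrable_diff window_integral(1) integrable_const)
    fix x assume "x \<in> space (cube_measure n)"
    hence x: "x \<in> closed_cube n" by (simp add: space_cube)
    have "g x * tensor (cutoff m) n j x - g x * tensor \<xi> n j x = - (g x * tensor \<xi> n j x * (1 - window n m x))"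
      unfolding Phi_window by (simp add: algebra_simps)
    hence "\<bar>g x * tensor (cutoff m) n j x - g x * tensor \<xi> n j x\<bar> = \<bar>g x\<bar> * \<bar>tensor \<xi> n j x\<bar> * (1 - window n m x)"
      using window_01[of n m x] by (simp add: abs_mult)
    also have "\<dots> \<le> B * C ^ n * (1 - window n m x)"
      using window_01[of n m x] B0 by (intro mult_right_mono mult_mono B x tb) auto
    finally show "\<bar>g x * tensor (cutoff m) n j x - g x * tensor \<xi> n j x\<bar> \<le> B * C ^ n * (1 - window n m x)" .
  qed
  also have "\<dots> = B * C ^ n * (1 - (1 - 2 * eps m) ^ n)"
    using prob_space by (simp add: Bochner_Integration.integral_diff window_integral)
  finally show ?thesis .
qed

lemma window_error_lim: "(\<lambda>m. 1 - (1 - 2 * eps m) ^ n) \<longlonglongrightarrow> 0"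
proof -
  have "(\<lambda>m. 1 - (1 - 2 * eps m) ^ n) \<longlonglongrightarrow> 1 - (1 - 2 * 0) ^ n"
    by (intro tendsto_intros eps_lim)
  thus ?thesis by simp
qed

text \<open>
  On one segment in direction \<open>i\<close>, the left-hand side consists of the boundary terms of Green's identity,
  in which each summand has a small factor: the normal derivative of \<open>\<rho> n\<close> or the derivative of the
  eigenfunction.
\<close>

lemma slice_green:
  assumes n: "n \<ge> 1" and i: "i \<in> {1..n}" and t: "0 < t" and x: "x \<in> closed_cube n"
    and k: "k \<in> {1..N}"
    and green: "\<And>a b u u' u''. \<lbrakk>0 \<le> a; a \<le> b; b \<le> 1;
       \<And>s. s \<in> {a..b} \<Longrightarrow> (u has_real_derivative u' s) (at s within {a..b});
       \<And>s. s \<in> {a..b} \<Longrightarrow> (u' has_real_derivative u'' s) (at s within {a..b});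
       continuous_on {a..b} u''\<rbrakk> \<Longrightarrow>
     (LINT s|leb01. indicator {a..b} s * ((u'' s - ld s * u s) * \<xi> k s))
       = (u' b * \<xi> k b - u b * f' b) - (u' a * \<xi> k a - u a * f' a) - al * (LINT s|leb01. indicator {a..b} s * (u s * \<xi> k s))"
    and \<rho>B: "\<And>x. x \<in> closed_cube n \<Longrightarrow> \<bar>\<rho> n t x\<bar> \<le> B" "0 \<le> B"
    and C: "\<And>k s. k \<in> {1..N} \<Longrightarrow> s \<in> {0..1} \<Longrightarrow> \<bar>\<xi> k s\<bar> \<le> C" "0 \<le> C"
    and D: "\<And>x. x \<in> closed_cube n \<Longrightarrow> x i = eps m \<or> x i = 1 - eps m \<Longrightarrow> \<bar>D n i t x\<bar> \<le> e"
    and f': "\<bar>f' (eps m)\<bar> \<le> e" "\<bar>f' (1 - eps m)\<bar> \<le> e" and e: "0 \<le> e"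
    and op: "\<And>s. s \<in> {eps m..1 - eps m} \<Longrightarrow> x(i := s) \<in> open_cube n"
  shows "\<bar>(LINT s|leb01. indicator {eps m..1 - eps m} s * ((DD n i i t (x(i := s)) - ld s * \<rho> n t (x(i := s))) * \<xi> k s))
     + al * (LINT s|leb01. indicator {eps m..1 - eps m} s * (\<rho> n t (x(i := s)) * \<xi> k s))\<bar> \<le> 2 * (C + B) * e"
proof -
  let ?a = "eps m" and ?b = "1 - eps m"
  let ?u = "\<lambda>s. \<rho> n t (x(i := s))" and ?u' = "\<lambda>s. D n i t (x(i := s))" and ?u'' = "\<lambda>s. DD n i i t (x(i := s))"
  have ab: "0 \<le> ?a" "?a \<le> ?b" "?b \<le> 1" using eps[of m] by auto
  have sub: "{?a..?b} \<subseteq> {0..1}" using ab by auto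
  have du: "(?u has_real_derivative ?u' s) (at s within {?a..?b})" if s: "s \<in> {?a..?b}" for s
  proof -
    have "x(i := s) \<in> closed_cube n" by (rule cube_upd[OF x _ i]) (use s sub in auto)
    from D_deriv[OF i less_imp_le[OF t] this] have "(?u has_real_derivative ?u' s) (at s within {0..1})" by simp
    thus ?thesis by (rule has_field_derivative_subset[OF _ sub])
  qed
  have du': "(?u' has_real_derivative ?u'' s) (at s within {?a..?b})" if s: "s \<in> {?a..?b}" for s
  proof -
    from DD_deriv[OF i t op[OF s]] have "(?u' has_real_derivative ?u'' s) (at s)" by simp
    thus ?thesis by (rule has_field_derivative_at_within)
  qed
  have cu: "continuous_on {?a..?b} (\<lambda>s. x(i := s))"
  proof (rule continuous_on_coordinatewise_then_product)
    show "continuous_on {?a..?b} (\<lambda>s. (x(i := s)) l)" for l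
      by (cases "l = i") (auto intro!: continuous_intros)
  qed
  have cD: "continuous_on (open_cube n) (\<lambda>x. DD n i i t x)"
    by (rule cont_at_time[OF DD_cont[OF i]]) (use t in simp)
  have cu'': "continuous_on {?a..?b} ?u''"
    by (rule continuous_on_compose2[OF cD cu]) (use op in auto)
  have eq: "(LINT s|leb01. indicator {?a..?b} s * ((?u'' s - ld s * ?u s) * \<xi> k s))
     + al * (LINT s|leb01. indicator {?a..?b} s * (?u s * \<xi> k s))
     = (?u' ?b * \<xi> k ?b - ?u ?b * f' ?b) - (?u' ?a * \<xi> k ?a - ?u ?a * f' ?a)"
    using green[OF ab du du' cu''] by simp
  have p: "\<bar>?u' s * \<xi> k s - ?u s * f' s\<bar> \<le> e * C + B * e" if s: "s = ?a \<or> s = ?b" for s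
  proof -
    have s01: "s \<in> {0..1}" using s sub ab by auto
    have xs: "x(i := s) \<in> closed_cube n" by (rule cube_upd[OF x s01 i])
    have "\<bar>?u' s * \<xi> k s - ?u s * f' s\<bar> \<le> \<bar>?u' s\<bar> * \<bar>\<xi> k s\<bar> + \<bar>?u s\<bar> * \<bar>f' s\<bar>"
      unfolding abs_mult[symmetric] by (rule abs_triangle_ineq4)
    also have "\<dots> \<le> e * C + B * e"
      using e C(2) \<rho>B(2) by (intro add_mono mult_mono D xs C(1) k s01 \<rho>B(1)) (use s f' in auto)
    finally show ?thesis .
  qed
  have "\<bar>(?u' ?b * \<xi> k ?b - ?u ?b * f' ?b) - (?u' ?a * \<xi> k ?a - ?u ?a * f' ?a)\<bar>
    \<le> (e * C + B * e) + (e * C + B * e)"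
    using p[of ?a] p[of ?b] by linarith
  also have "\<dots> = 2 * (C + B) * e" by (simp add: algebra_simps)
  finally show ?thesis unfolding eq .
qed

end

section \<open>The master equation tested against truncated tensors\<close>

context cdme_model
begin

text \<open>
  Diffusion and annihilation in direction \<open>i\<close> belong together, as \<open>\<xi> k\<close> is an eigenfunction of their sum.
\<close>

definition flux :: "nat \<Rightarrow> (nat \<Rightarrow> nat) \<Rightarrow> nat \<Rightarrow> nat \<Rightarrow> real \<Rightarrow> (nat \<Rightarrow> real) \<Rightarrow> real" where
  "flux n j m i t x = (DD n i i t x - ld (x i) * \<rho> n t x) * tensor (cutoff m) n j x"

text \<open>
  The remaining terms of the master equation; they involve no derivatives and are bounded on the closed
  cube.
\<close>

definition source :: "nat \<Rightarrow> real \<Rightarrow> (nat \<Rightarrow> real) \<Rightarrow> real" where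
  "source n t x = real (n + 1) * (LINT y|leb01. ld y * \<rho> (n + 1) t (x(n + 1 := y)))
     + 1 / real n * (\<Sum>i=1..n. lc (x i) * \<rho> (n - 1) t (drop_coord n i x)) - \<gamma> * \<rho> n t x"

lemma ld_meas: "ld \<in> borel_measurable leb01" and lc_meas: "lc \<in> borel_measurable leb01"
  using ld lc by (simp_all add: nonneg_bounded_measurable_def)

lemma subcube_bound:
  assumes c: "continuous_on ({0<..} \<times> open_cube n) (\<lambda>(t, x). f t x)" and t: "0 < (t1::real)"
  obtains B where "0 \<le> B" "\<And>t x. t1 \<le> t \<Longrightarrow> t \<le> t2 \<Longrightarrow> x \<in> subcube n (eps m) (1 - eps m) \<Longrightarrow> \<bar>f t x\<bar> \<le> (B::real)"
proof -
  have "continuous_on ({t1..t2} \<times> subcube n (eps m) (1 - eps m)) (\<lambda>(t, x). f t x)"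
    by (rule continuous_on_subset[OF c]) (use t subcube_eps_open in auto)
  from continuous_on_compact_bounded[OF compact_time_subcube this] obtain B where
    B: "B \<ge> 0" "\<And>z. z \<in> {t1..t2} \<times> subcube n (eps m) (1 - eps m) \<Longrightarrow> \<bar>(\<lambda>(t, x). f t x) z\<bar> \<le> B" by blast
  show ?thesis
  proof (rule that[OF B(1)])
    show "\<bar>f t x\<bar> \<le> B" if "t1 \<le> t" "t \<le> t2" "x \<in> subcube n (eps m) (1 - eps m)" for t x
      using B(2)[of "(t, x)"] that by simp
  qed
qed

lemma Phi_bound:
  assumes j: "j ` {1..n} \<subseteq> {1..N}" and C: "\<And>k s. k \<in> {1..N} \<Longrightarrow> s \<in> {0..1} \<Longrightarrow> \<bar>\<xi> k s\<bar> \<le> C" "0 \<le> C"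
    and x: "x \<in> closed_cube n"
  shows "\<bar>tensor (cutoff m) n j x\<bar> \<le> C ^ n"
  by (rule tensor_bound[OF _ x], rule cutoff_bound[OF C]) (use j in blast)+

lemma supported_meas:
  assumes c: "continuous_on ({0<..} \<times> open_cube n) (\<lambda>(t, x). f t x)" and t: "0 < t"
    and j: "j ` {1..n} \<subseteq> {1..N}"
  shows "(\<lambda>x. f t x * tensor (cutoff m) n j x) \<in> borel_measurable (cube_measure n)"
proof (rule measurable_cube_supported)
  show "continuous_on (open_cube n) (f t)" by (rule cont_at_time[OF c]) (use t in simp)
  show "tensor (cutoff m) n j x = 0" if "x \<in> closed_cube n" "x \<notin> open_cube n" for x
    by (rule Phi_zero[OF that(1)]) (use that(2) subcube_eps_open in blast)
qed (rule Phi_meas[OF j])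

lemma flux_meas_bound:
  assumes i: "i \<in> {1..n}" and t: "0 < t" and j: "j ` {1..n} \<subseteq> {1..N}"
  shows "flux n j m i t \<in> borel_measurable (cube_measure n)"
    and "\<exists>B. \<forall>x\<in>closed_cube n. \<bar>flux n j m i t x\<bar> \<le> B"
proof -
  have e: "flux n j m i t = (\<lambda>x. DD n i i t x * tensor (cutoff m) n j x - ld (x i) * \<rho> n t x * tensor (cutoff m) n j x)"
    by (simp add: flux_def fun_eq_iff left_diff_distrib)
  show "flux n j m i t \<in> borel_measurable (cube_measure n)"
    unfolding e
    by (intro borel_measurable_diff borel_measurable_times supported_meas[OF DD_cont[OF i] t j]
        measurable_coord[OF ld_meas i] \<rho>_meas less_imp_le[OF t] Phi_meas j)
  obtain C where C: "C \<ge> 1" "\<And>k s. k \<in> {1..N} \<Longrightarrow> s \<in> {0..1} \<Longrightarrow> \<bar>\<xi> k s\<bar> \<le> C" using \<xi>_bound by blast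
  obtain B1 where B1: "0 \<le> B1" "\<And>x. x \<in> subcube n (eps m) (1 - eps m) \<Longrightarrow> \<bar>DD n i i t x\<bar> \<le> B1"
    using subcube_bound[OF DD_cont[OF i] t, of t m] by (metis order.refl)
  obtain B2 where B2: "0 \<le> B2" "\<And>x. x \<in> closed_cube n \<Longrightarrow> \<bar>\<rho> n t x\<bar> \<le> B2"
    using \<rho>_bound[of t n] less_imp_le[OF t] by (metis order.refl)
  obtain B3 where B3: "0 \<le> B3" "\<And>s. s \<in> {0..1} \<Longrightarrow> \<bar>ld s\<bar> \<le> B3" using ld_bound by blast
  have "\<bar>flux n j m i t x\<bar> \<le> (B1 + B3 * B2) * C ^ n" if x: "x \<in> closed_cube n" for x
  proof (cases "x \<in> subcube n (eps m) (1 - eps m)")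
    case True
    have "x i \<in> {0..1}" using x i unfolding closed_cube_def by (rule PiE_mem)
    hence "\<bar>DD n i i t x - ld (x i) * \<rho> n t x\<bar> \<le> B1 + B3 * B2"
      using B1(2)[OF True] B2(2)[OF x] B3(2)[of "x i"] B3(1)
      by (intro order_trans[OF abs_triangle_ineq4] add_mono) (auto simp: abs_mult intro!: mult_mono)
    thus ?thesis unfolding flux_def abs_mult using B1 B2 B3 C
      by (intro mult_mono Phi_bound[OF j _ _ x]) auto
  next
    case False
    thus ?thesis unfolding flux_def using Phi_zero[OF x False] B1 B2 B3 C by simp
  qed
  thus "\<exists>B. \<forall>x\<in>closed_cube n. \<bar>flux n j m i t x\<bar> \<le> B" by blast
qed

text \<open>
  The boundary terms are small uniformly in time: \<open>D n i\<close> is continuous on the closed cube and vanishes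
  on the faces \<open>x i \<in> {0, 1}\<close>, hence by compactness it is small where \<open>x i * (1 - x i)\<close> is small.
\<close>

lemma flux_small:
  assumes n: "n \<ge> 1" and i: "i \<in> {1..n}" and j: "j ` {1..n} \<subseteq> {1..N}" and e: "0 < e"
  shows "\<forall>\<^sub>F m in sequentially. \<forall>t. 0 < t \<longrightarrow> t \<le> T \<longrightarrow>
    \<bar>(LINT x|cube_measure n. flux n j m i t x)
      + \<alpha> (j i) * (LINT x|cube_measure n. \<rho> n t x * tensor (cutoff m) n j x)\<bar> \<le> e"
proof -
  let ?k = "j i"
  have k: "?k \<in> {1..N}" using i j by blast
  obtain C where C: "C \<ge> 1" "\<And>k s. k \<in> {1..N} \<Longrightarrow> s \<in> {0..1} \<Longrightarrow> \<bar>\<xi> k s\<bar> \<le> C" using \<xi>_bound by blast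
  obtain B where B: "0 \<le> B" "\<And>t x. 0 \<le> t \<Longrightarrow> t \<le> T \<Longrightarrow> x \<in> closed_cube n \<Longrightarrow> \<bar>\<rho> n t x\<bar> \<le> B"
    using \<rho>_bound by blast
  \<comment> \<open>the constant of \<open>slice_green\<close> times a bound for the tensor factors in the other directions\<close>
  define K where "K = 2 * (C + B) * C ^ n"
  have K0: "K > 0" using B C by (simp add: K_def)
  define e1 where "e1 = e / K"
  have e1: "e1 > 0" using e K0 by (simp add: e1_def)
  obtain f' where f'c: "continuous_on {0..1} f'" and f'0: "f' 0 = 0" "f' 1 = 0"
    and green: "\<And>a b u u' u''. \<lbrakk>0 \<le> a; a \<le> b; b \<le> 1;
       \<And>s. s \<in> {a..b} \<Longrightarrow> (u has_real_derivative u' s) (at s within {a..b});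
       \<And>s. s \<in> {a..b} \<Longrightarrow> (u' has_real_derivative u'' s) (at s within {a..b});
       continuous_on {a..b} u''\<rbrakk> \<Longrightarrow>
     (LINT s|leb01. indicator {a..b} s * ((u'' s - ld s * u s) * \<xi> ?k s))
       = (u' b * \<xi> ?k b - u b * f' b) - (u' a * \<xi> ?k a - u a * f' a) - \<alpha> ?k * (LINT s|leb01. indicator {a..b} s * (u s * \<xi> ?k s))"
    by (rule neumann_eigenfunction_green[OF eig[OF k]]) blast
  have e01: "0 \<le> eps m" "eps m \<le> 1" for m using eps[of m] by auto
  have l1: "(\<lambda>m. 1 - eps m) \<longlonglongrightarrow> 1 - 0" by (intro tendsto_intros eps_lim)
  have "(\<lambda>m. f' (eps m)) \<longlonglongrightarrow> f' 0"
    by (rule continuous_on_tendsto_compose[OF f'c eps_lim]) (use e01 in \<open>auto intro: always_eventually\<close>)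
  hence ev1: "\<forall>\<^sub>F m in sequentially. \<bar>f' (eps m)\<bar> < e1"
    using e1 f'0 by (auto simp: tendsto_iff dist_real_def)
  have "(\<lambda>m. f' (1 - eps m)) \<longlonglongrightarrow> f' (1 - 0)"
    by (rule continuous_on_tendsto_compose[OF f'c l1]) (use e01 in \<open>auto intro: always_eventually\<close>)
  hence ev2: "\<forall>\<^sub>F m in sequentially. \<bar>f' (1 - eps m)\<bar> < e1"
    using e1 f'0 by (auto simp: tendsto_iff dist_real_def)
  obtain \<delta> where \<delta>: "0 < \<delta>" "\<And>z. z \<in> {0..T} \<times> subcube n 0 1 \<Longrightarrow> (\<lambda>(t, x). x i * (1 - x i)) z < \<delta> \<Longrightarrow> \<bar>(\<lambda>(t, x). D n i t x) z\<bar> < e1"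
  proof (rule small_near_zero_set[OF compact_time_subcube])
    show "continuous_on ({0..T} \<times> subcube n 0 1) (\<lambda>(t, x). D n i t x)"
      by (rule continuous_on_subset[OF D_cont[OF i]]) (auto simp: closed_cube_subcube)
    show "continuous_on ({0..T} \<times> subcube n 0 1) (\<lambda>(t, x). x i * (1 - x i))"
      unfolding case_prod_unfold
      by (intro continuous_intros continuous_on_product_then_coordinatewise[OF continuous_on_snd[OF continuous_on_id]])
    show "(\<lambda>(t, x). D n i t x) z = 0" if z: "z \<in> {0..T} \<times> subcube n 0 1" and g: "(\<lambda>(t, x). x i * (1 - x i)) z \<le> 0" for z
    proof -
      obtain t x where zz: "z = (t, x)" and t: "0 \<le> t" and x: "x \<in> closed_cube n" using z by (auto simp: closed_cube_subcube)
      have "x i \<in> {0..1}" using x i unfolding closed_cube_def by (rule PiE_mem)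
      hence "x i \<in> {0, 1}" using g by (auto simp: zz mult_le_0_iff)
      thus ?thesis using neumann[OF n t x i] by (simp add: zz)
    qed
  qed (use e1 in auto)
  have ev3: "\<forall>\<^sub>F m in sequentially. eps m < \<delta>" by (rule order_tendstoD(2)[OF eps_lim \<delta>(1)])
  from ev1 ev2 ev3 show ?thesis
  proof eventually_elim
    case (elim m)
    show ?case
    proof (intro allI impI)
      fix t assume t: "0 < t" "t \<le> T"
      let ?w = "indicator {eps m..1 - eps m} :: real \<Rightarrow> real"
      let ?\<rho>\<Phi> = "\<lambda>x. \<rho> n t x * tensor (cutoff m) n j x"
      have \<rho>b: "\<bar>\<rho> n t x\<bar> \<le> B" if "x \<in> closed_cube n" for x using B(2) that t by simp
      have Dsmall: "\<bar>D n i t x\<bar> \<le> e1" if x: "x \<in> closed_cube n" and xi: "x i = eps m \<or> x i = 1 - eps m" for x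
      proof -
        have "x i * (1 - x i) = eps m * (1 - eps m)" using xi by (auto simp: mult.commute)
        also have "\<dots> \<le> eps m * 1" using eps[of m] by (intro mult_left_mono) auto
        finally have "x i * (1 - x i) < \<delta>" using elim(3) by simp
        thus ?thesis using \<delta>(2)[of "(t, x)"] x t by (simp add: closed_cube_subcube)
      qed
      obtain BF where BF: "\<And>x. x \<in> closed_cube n \<Longrightarrow> \<bar>flux n j m i t x\<bar> \<le> BF"
        using flux_meas_bound(2)[OF i t(1) j] by blast
      note Fm = flux_meas_bound(1)[OF i t(1) j, of m]
      have Rm: "?\<rho>\<Phi> \<in> borel_measurable (cube_measure n)"
        by (intro borel_measurable_times \<rho>_meas Phi_meas j less_imp_le[OF t(1)])
      have Rb: "\<bar>?\<rho>\<Phi> x\<bar> \<le> B * C ^ n" if x: "x \<in> closed_cube n" for x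
        unfolding abs_mult using B(1) C by (intro mult_mono \<rho>b x Phi_bound[OF j _ _ x]) auto
      note R1 = resample_coordinate[OF i Fm BF] and R2 = resample_coordinate[OF i Rm Rb]
      let ?H1 = "\<lambda>x. LINT s|leb01. flux n j m i t (x(i := s))" and ?H2 = "\<lambda>x. LINT s|leb01. ?\<rho>\<Phi> (x(i := s))"
      have bd: "\<bar>?H1 x + \<alpha> ?k * ?H2 x\<bar> \<le> e" if x: "x \<in> closed_cube n" for x
      proof -
        \<comment> \<open>the factor independent of \<open>x i\<close>; unless it vanishes, the whole segment lies in the open cube\<close>
        define P where "P = (\<Prod>l\<in>{1..n} - {i}. cutoff m (j l) (x l))"
        have ck: "cutoff m ?k s = ?w s * \<xi> ?k s" for s by (simp add: cutoff_def)
        have h1: "?H1 x = P * (LINT s|leb01. ?w s * ((DD n i i t (x(i := s)) - ld s * \<rho> n t (x(i := s))) * \<xi> ?k s))"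
          unfolding flux_def tensor_remove[OF i] P_def[symmetric] integral_mult_right_zero[symmetric] ck
          by (simp only: fun_upd_same mult_ac)
        have h2: "?H2 x = P * (LINT s|leb01. ?w s * (\<rho> n t (x(i := s)) * \<xi> ?k s))"
          unfolding tensor_remove[OF i] P_def[symmetric] integral_mult_right_zero[symmetric] ck
          by (simp only: mult_ac)
        have xl: "x l \<in> {0..1}" if "l \<in> {1..n}" for l using x that unfolding closed_cube_def by (rule PiE_mem)
        have PB: "\<bar>P\<bar> \<le> C ^ n"
        proof -
          have "\<bar>P\<bar> \<le> (\<Prod>l\<in>{1..n} - {i}. C)" unfolding P_def abs_prod
          proof (rule prod_mono)
            fix l assume l: "l \<in> {1..n} - {i}"
            have "j l \<in> {1..N}" using j l by blast
            thus "0 \<le> \<bar>cutoff m (j l) (x l)\<bar> \<and> \<bar>cutoff m (j l) (x l)\<bar> \<le> C"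
              using cutoff_bound[OF C(2), of "j l" "x l" m] C(1) xl[of l] l by auto
          qed
          also have "\<dots> \<le> C ^ n"
            using C(1) card_Diff1_le[of "{1..n}" i] by (auto intro!: power_increasing)
          finally show ?thesis .
        qed
        show ?thesis
        proof (cases "P = 0")
          case True
          thus ?thesis unfolding h1 h2 using e by simp
        next
          case False
          have in_win: "x l \<in> {eps m..1 - eps m}" if "l \<in> {1..n} - {i}" for l
          proof (rule ccontr)
            assume "x l \<notin> {eps m..1 - eps m}"
            hence "cutoff m (j l) (x l) = 0" by (simp add: cutoff_def)
            hence "P = 0" unfolding P_def using that by (intro prod_zero) auto
            thus False using False by simp
          qed
          have op: "x(i := s) \<in> open_cube n" if s: "s \<in> {eps m..1 - eps m}" for s
          proof (rule subsetD[OF subcube_eps_open[of n m]])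
            show "x(i := s) \<in> subcube n (eps m) (1 - eps m)"
              unfolding subcube_def
            proof (rule PiE_I)
              show "(x(i := s)) l \<in> {eps m..1 - eps m}" if "l \<in> {1..n}" for l
                using in_win[of l] s that by (cases "l = i") auto
              show "(x(i := s)) l = undefined" if "l \<notin> {1..n}" for l
                using x i that by (auto simp: closed_cube_def PiE_iff extensional_def)
            qed
          qed
          let ?I1 = "LINT s|leb01. ?w s * ((DD n i i t (x(i := s)) - ld s * \<rho> n t (x(i := s))) * \<xi> ?k s)"
          let ?I2 = "LINT s|leb01. ?w s * (\<rho> n t (x(i := s)) * \<xi> ?k s)"
          have g: "\<bar>?I1 + \<alpha> ?k * ?I2\<bar> \<le> 2 * (C + B) * e1"
            by (rule slice_green[OF n i t(1) x k green \<rho>b B(1) C(2) _ Dsmall _ _ _ op])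
               (use elim(1,2) C(1) e1 in auto)
          have "\<bar>?H1 x + \<alpha> ?k * ?H2 x\<bar> = \<bar>P\<bar> * \<bar>?I1 + \<alpha> ?k * ?I2\<bar>"
            unfolding h1 h2 by (simp only: abs_mult[symmetric] distrib_left mult_ac)
          also have "\<dots> \<le> C ^ n * (2 * (C + B) * e1)"
            by (intro mult_mono PB g) (use C in auto)
          also have "\<dots> = e" using K0 unfolding e1_def K_def by (simp add: field_simps)
          finally show ?thesis .
        qed
      qed
      have i1: "integrable (cube_measure n) ?H1" by (rule cube_integrable[OF R1(2,3)])
      have i2: "integrable (cube_measure n) ?H2" by (rule cube_integrable[OF R2(2,3)])
      have "(LINT x|cube_measure n. flux n j m i t x) + \<alpha> ?k * (LINT x|cube_measure n. ?\<rho>\<Phi> x)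
        = (LINT x|cube_measure n. ?H1 x + \<alpha> ?k * ?H2 x)"
      proof -
        have "(LINT x|cube_measure n. flux n j m i t x) + \<alpha> ?k * (LINT x|cube_measure n. ?\<rho>\<Phi> x)
          = (LINT x|cube_measure n. ?H1 x) + \<alpha> ?k * (LINT x|cube_measure n. ?H2 x)"
          by (rule arg_cong2[where f = "\<lambda>u v. u + \<alpha> ?k * v", OF R1(1) R2(1)])
        also have "\<dots> = (LINT x|cube_measure n. ?H1 x) + (LINT x|cube_measure n. \<alpha> ?k * ?H2 x)"
          by (simp only: integral_mult_right_zero)
        also have "\<dots> = (LINT x|cube_measure n. ?H1 x + \<alpha> ?k * ?H2 x)"
          by (rule Bochner_Integration.integral_add[OF i1 integrable_mult_right[OF i2], symmetric])
        finally show ?thesis .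
      qed
      moreover have "\<bar>LINT x|cube_measure n. ?H1 x + \<alpha> ?k * ?H2 x\<bar> \<le> e"
        by (rule cube_integral_bound[OF _ bd])
           (intro borel_measurable_add borel_measurable_times borel_measurable_const R1(2) R2(2))
      ultimately show "\<bar>(LINT x|cube_measure n. flux n j m i t x) + \<alpha> ?k * (LINT x|cube_measure n. ?\<rho>\<Phi> x)\<bar> \<le> e"
        by (simp only:)
    qed
  qed
qed

lemma source_meas: "0 \<le> t \<Longrightarrow> source n t \<in> borel_measurable (cube_measure n)"
  unfolding source_def
  by (intro borel_measurable_add borel_measurable_diff borel_measurable_times borel_measurable_const
      borel_measurable_sum up_meas drop_meas \<rho>_meas measurable_coord lc_meas)

lemma source_bound:
  obtains B where "0 \<le> B" "\<And>t x. 0 \<le> t \<Longrightarrow> t \<le> T \<Longrightarrow> x \<in> closed_cube n \<Longrightarrow> \<bar>source n t x\<bar> \<le> B"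
proof -
  obtain B1 where B1: "0 \<le> B1" "\<And>t x. 0 \<le> t \<Longrightarrow> t \<le> T \<Longrightarrow> x \<in> closed_cube (n + 1) \<Longrightarrow> \<bar>\<rho> (n + 1) t x\<bar> \<le> B1"
    using \<rho>_bound by blast
  obtain B2 where B2: "0 \<le> B2" "\<And>t x. 0 \<le> t \<Longrightarrow> t \<le> T \<Longrightarrow> x \<in> closed_cube (n - 1) \<Longrightarrow> \<bar>\<rho> (n - 1) t x\<bar> \<le> B2"
    using \<rho>_bound by blast
  obtain B3 where B3: "0 \<le> B3" "\<And>t x. 0 \<le> t \<Longrightarrow> t \<le> T \<Longrightarrow> x \<in> closed_cube n \<Longrightarrow> \<bar>\<rho> n t x\<bar> \<le> B3"
    using \<rho>_bound by blast
  obtain Ld where Ld: "0 \<le> Ld" "\<And>s. s \<in> {0..1} \<Longrightarrow> \<bar>ld s\<bar> \<le> Ld" using ld_bound by blast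
  obtain Lc where Lc: "0 \<le> Lc" "\<And>s. s \<in> {0..1} \<Longrightarrow> \<bar>lc s\<bar> \<le> Lc" using lc_bound by blast
  let ?B = "real (n + 1) * (Ld * B1) + 1 / real n * (\<Sum>i=1..n. Lc * B2) + \<bar>\<gamma>\<bar> * B3"
  show ?thesis
  proof (rule that[of ?B])
    show "0 \<le> ?B" using B1 B2 B3 Ld Lc by (intro add_nonneg_nonneg mult_nonneg_nonneg sum_nonneg) auto
    fix t x assume t: "0 \<le> t" "t \<le> T" and x: "x \<in> closed_cube n"
    let ?u = "LINT y|leb01. ld y * \<rho> (n + 1) t (x(n + 1 := y))"
    let ?s = "\<Sum>i=1..n. lc (x i) * \<rho> (n - 1) t (drop_coord n i x)"
    have u: "\<bar>?u\<bar> \<le> Ld * B1"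
      by (rule up_bound(1)[OF t(1) x ld_meas Ld(2,1) B1(2)[OF t] B1(1)])
    have s: "\<bar>?s\<bar> \<le> (\<Sum>i=1..n. Lc * B2)"
    proof (rule order_trans[OF sum_abs sum_mono])
      fix i assume i: "i \<in> {1..n}"
      have "x i \<in> {0..1}" using x i unfolding closed_cube_def by (rule PiE_mem)
      thus "\<bar>lc (x i) * \<rho> (n - 1) t (drop_coord n i x)\<bar> \<le> Lc * B2"
        unfolding abs_mult using Lc B2(1) by (intro mult_mono Lc(2) B2(2) t drop_cube x) auto
    qed
    have "\<bar>source n t x\<bar> \<le> \<bar>real (n + 1) * ?u\<bar> + \<bar>1 / real n * ?s\<bar> + \<bar>\<gamma> * \<rho> n t x\<bar>"
      unfolding source_def by linarith
    also have "\<dots> = real (n + 1) * \<bar>?u\<bar> + 1 / real n * \<bar>?s\<bar> + \<bar>\<gamma>\<bar> * \<bar>\<rho> n t x\<bar>"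
      by (simp only: abs_mult abs_of_nat abs_divide abs_one)
    also have "\<dots> \<le> ?B"
      by (intro add_mono mult_left_mono u s B3(2) t x) auto
    finally show "\<bar>source n t x\<bar> \<le> ?B" .
  qed
qed

lemma source_coef:
  assumes t: "0 \<le> t" and j: "j ` {1..n} \<subseteq> {1..N}"
  shows "(LINT x|cube_measure n. source n t x * tensor \<xi> n j x)
    = real (n + 1) * (\<Sum>k=1..N. d k * density_coef (n + 1) (j(n + 1 := k)) t)
      + 1 / real n * (\<Sum>i=1..n. c (j i) * density_coef (n - 1) (drop_nth i j) t) - \<gamma> * density_coef n j t"
proof -
  obtain C where C: "C \<ge> 1" "\<And>k s. k \<in> {1..N} \<Longrightarrow> s \<in> {0..1} \<Longrightarrow> \<bar>\<xi> k s\<bar> \<le> C" using \<xi>_bound by blast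
  have jl: "j l \<in> {1..N}" if "l \<in> {1..n}" for l using j that by blast
  have I: "integrable (cube_measure n) (\<lambda>x. g x * tensor \<xi> n j x)"
    if "g \<in> borel_measurable (cube_measure n)" "\<And>x. x \<in> closed_cube n \<Longrightarrow> \<bar>g x\<bar> \<le> B" "0 \<le> B" for g B
  proof (rule cube_integrable)
    show "(\<lambda>x. g x * tensor \<xi> n j x) \<in> borel_measurable (cube_measure n)"
      by (intro borel_measurable_times that(1) tensor_meas j)
    fix x assume x: "x \<in> closed_cube n"
    have "\<bar>tensor \<xi> n j x\<bar> \<le> C ^ n" by (rule tensor_bound[OF _ x]) (rule C(2)[OF jl])
    thus "\<bar>g x * tensor \<xi> n j x\<bar> \<le> B * C ^ n"
      unfolding abs_mult using that(2)[OF x] that(3) by (intro mult_mono) auto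
  qed
  let ?u = "\<lambda>x. LINT y|leb01. ld y * \<rho> (n + 1) t (x(n + 1 := y))"
  let ?v = "\<lambda>i x. lc (x i) * \<rho> (n - 1) t (drop_coord n i x)"
  obtain B1 where B1: "0 \<le> B1" "\<And>x. x \<in> closed_cube (n + 1) \<Longrightarrow> \<bar>\<rho> (n + 1) t x\<bar> \<le> B1"
    using \<rho>_bound[of t "n + 1"] t by (metis order.refl)
  obtain B2 where B2: "0 \<le> B2" "\<And>x. x \<in> closed_cube (n - 1) \<Longrightarrow> \<bar>\<rho> (n - 1) t x\<bar> \<le> B2"
    using \<rho>_bound[of t "n - 1"] t by (metis order.refl)
  obtain B3 where B3: "0 \<le> B3" "\<And>x. x \<in> closed_cube n \<Longrightarrow> \<bar>\<rho> n t x\<bar> \<le> B3"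
    using \<rho>_bound[of t n] t by (metis order.refl)
  obtain Ld where Ld: "0 \<le> Ld" "\<And>s. s \<in> {0..1} \<Longrightarrow> \<bar>ld s\<bar> \<le> Ld" using ld_bound by blast
  obtain Lc where Lc: "0 \<le> Lc" "\<And>s. s \<in> {0..1} \<Longrightarrow> \<bar>lc s\<bar> \<le> Lc" using lc_bound by blast
  have iu: "integrable (cube_measure n) (\<lambda>x. ?u x * tensor \<xi> n j x)"
    by (rule I[of _ "Ld * B1"]) (use Ld B1 up_meas[OF t] up_bound(1)[OF t _ ld_meas Ld(2,1) B1(2,1)] in auto)
  have iv: "integrable (cube_measure n) (\<lambda>x. ?v i x * tensor \<xi> n j x)" if i: "i \<in> {1..n}" for i
  proof (rule I[of _ "Lc * B2"])
    show "?v i \<in> borel_measurable (cube_measure n)"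
      by (intro borel_measurable_times drop_meas t measurable_coord lc_meas i)
    fix x assume x: "x \<in> closed_cube n"
    have "x i \<in> {0..1}" using x i unfolding closed_cube_def by (rule PiE_mem)
    thus "\<bar>?v i x\<bar> \<le> Lc * B2"
      unfolding abs_mult using Lc B2(1) by (intro mult_mono Lc(2) B2(2) drop_cube x) auto
  qed (use Lc B2 in auto)
  have ir: "integrable (cube_measure n) (\<lambda>x. \<rho> n t x * tensor \<xi> n j x)"
    by (rule I[OF \<rho>_meas[OF t] B3(2,1)])
  have i_s: "integrable (cube_measure n) (\<lambda>x. \<Sum>i=1..n. ?v i x * tensor \<xi> n j x)"
    by (intro Bochner_Integration.integrable_sum iv)
  have "(LINT x|cube_measure n. source n t x * tensor \<xi> n j x)
     = (LINT x|cube_measure n. real (n + 1) * (?u x * tensor \<xi> n j x)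
         + 1 / real n * (\<Sum>i=1..n. ?v i x * tensor \<xi> n j x) - \<gamma> * (\<rho> n t x * tensor \<xi> n j x))"
    unfolding source_def by (simp only: left_diff_distrib distrib_right sum_distrib_right mult.assoc)
  also have "\<dots> = real (n + 1) * (LINT x|cube_measure n. ?u x * tensor \<xi> n j x)
     + 1 / real n * (LINT x|cube_measure n. (\<Sum>i=1..n. ?v i x * tensor \<xi> n j x)) - \<gamma> * density_coef n j t"
    unfolding density_coef_def
    by (simp only: Bochner_Integration.integral_diff Bochner_Integration.integral_add integral_mult_right_zero
        iu i_s ir integrable_mult_right Bochner_Integration.integrable_add)
  also have "(LINT x|cube_measure n. (\<Sum>i=1..n. ?v i x * tensor \<xi> n j x)) = (\<Sum>i=1..n. c (j i) * density_coef (n - 1) (drop_nth i j) t)"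
  proof -
    have "(LINT x|cube_measure n. (\<Sum>i=1..n. ?v i x * tensor \<xi> n j x))
       = (\<Sum>i=1..n. LINT x|cube_measure n. ?v i x * tensor \<xi> n j x)"
      by (rule Bochner_Integration.integral_sum[OF iv])
    also have "\<dots> = (\<Sum>i=1..n. c (j i) * density_coef (n - 1) (drop_nth i j) t)"
      by (rule sum.cong[OF refl], rule down_coef[OF t j])
    finally show ?thesis .
  qed
  also have "(LINT x|cube_measure n. ?u x * tensor \<xi> n j x) = (\<Sum>k=1..N. d k * density_coef (n + 1) (j(n + 1 := k)) t)"
    by (rule up_coef[OF t j])
  finally show ?thesis .
qed

end

section \<open>The differential equation of the coefficients\<close>

context cdme_model
begin

definition cutoff_coef :: "nat \<Rightarrow> (nat \<Rightarrow> nat) \<Rightarrow> nat \<Rightarrow> real \<Rightarrow> real" where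
  "cutoff_coef n j m t = (LINT x|cube_measure n. \<rho> n t x * tensor (cutoff m) n j x)"

text \<open>
  Inside the support of the truncated tensor the time derivative is bounded for \<open>t\<close> in compact subsets of
  the positive axis, which permits differentiation under the integral.
\<close>

lemma cutoff_coef_deriv:
  assumes n: "n \<ge> 1" and t: "0 < t" and j: "j ` {1..n} \<subseteq> {1..N}"
  shows "(cutoff_coef n j m has_real_derivative
     (\<Sum>i=1..n. LINT x|cube_measure n. flux n j m i t x)
       + (LINT x|cube_measure n. source n t x * tensor (cutoff m) n j x)) (at t)"
proof -
  obtain C where C: "C \<ge> 1" "\<And>k s. k \<in> {1..N} \<Longrightarrow> s \<in> {0..1} \<Longrightarrow> \<bar>\<xi> k s\<bar> \<le> C" using \<xi>_bound by blast
  let ?\<Phi> = "tensor (cutoff m) n j"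
  have \<Phi>B: "\<bar>?\<Phi> x\<bar> \<le> C ^ n" if x: "x \<in> closed_cube n" for x
    by (rule Phi_bound[OF j _ _ x]) (use C in auto)
  define t1 where "t1 = t / 2"
  define t2 where "t2 = t + 1"
  have t12: "0 < t1" "t1 < t" "t < t2" using t by (auto simp: t1_def t2_def)
  obtain B where B: "0 \<le> B" "\<And>t x. t1 \<le> t \<Longrightarrow> t \<le> t2 \<Longrightarrow> x \<in> subcube n (eps m) (1 - eps m) \<Longrightarrow> \<bar>\<rho>t n t x\<bar> \<le> B"
    using subcube_bound[OF \<rho>t_cont t12(1)] by blast
  obtain R where R: "0 \<le> R" "\<And>t x. 0 \<le> t \<Longrightarrow> t \<le> t2 \<Longrightarrow> x \<in> closed_cube n \<Longrightarrow> \<bar>\<rho> n t x\<bar> \<le> R"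
    using \<rho>_bound by blast
  obtain Sb where Sb: "0 \<le> Sb" "\<And>t x. 0 \<le> t \<Longrightarrow> t \<le> t2 \<Longrightarrow> x \<in> closed_cube n \<Longrightarrow> \<bar>source n t x\<bar> \<le> Sb"
    using source_bound by blast
  interpret prob_space "cube_measure n" by (rule prob_cube)
  have "((\<lambda>s. LINT x|cube_measure n. \<rho> n s x * ?\<Phi> x) has_real_derivative
     (LINT x|cube_measure n. \<rho>t n t x * ?\<Phi> x)) (at t)"
  proof (rule has_derivative_under_integral[OF t12(2,3), where B = "\<lambda>_. B * C ^ n"])
    fix s assume s: "t1 < s" "s < t2"
    have s0: "0 < s" using s t12 by simp
    show "integrable (cube_measure n) (\<lambda>x. \<rho> n s x * ?\<Phi> x)"
    proof (rule cube_integrable)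
      show "(\<lambda>x. \<rho> n s x * ?\<Phi> x) \<in> borel_measurable (cube_measure n)"
        by (intro borel_measurable_times \<rho>_meas Phi_meas j less_imp_le[OF s0])
      show "\<bar>\<rho> n s x * ?\<Phi> x\<bar> \<le> R * C ^ n" if x: "x \<in> closed_cube n" for x
        unfolding abs_mult using R(1) s s0 by (intro mult_mono R(2) x \<Phi>B) auto
    qed
    fix x assume "x \<in> space (cube_measure n)"
    hence x: "x \<in> closed_cube n" by (simp add: space_cube)
    show "((\<lambda>r. \<rho> n r x * ?\<Phi> x) has_real_derivative \<rho>t n s x * ?\<Phi> x) (at s)"
    proof (cases "x \<in> subcube n (eps m) (1 - eps m)")
      case True
      hence "x \<in> open_cube n" using subcube_eps_open by blast
      from DERIV_cmult_right[OF \<rho>t_deriv[OF s0 this]] show ?thesis .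
    next
      case False
      thus ?thesis using Phi_zero[OF x False] by simp
    qed
    show "\<bar>\<rho>t n s x * ?\<Phi> x\<bar> \<le> B * C ^ n"
    proof (cases "x \<in> subcube n (eps m) (1 - eps m)")
      case True
      show ?thesis unfolding abs_mult
        using B(1) s by (intro mult_mono B(2) \<Phi>B x True) auto
    next
      case False
      thus ?thesis using Phi_zero[OF x False] B C by simp
    qed
  next
    show "(\<lambda>x. \<rho>t n t x * ?\<Phi> x) \<in> borel_measurable (cube_measure n)"
      by (rule supported_meas[OF \<rho>t_cont t j])
  qed (rule integrable_const)
  moreover have "(LINT x|cube_measure n. \<rho>t n t x * ?\<Phi> x)
     = (\<Sum>i=1..n. LINT x|cube_measure n. flux n j m i t x) + (LINT x|cube_measure n. source n t x * ?\<Phi> x)"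
  proof -
    have eq: "\<rho>t n t x * ?\<Phi> x = (\<Sum>i=1..n. flux n j m i t x) + source n t x * ?\<Phi> x" if x: "x \<in> closed_cube n" for x
    proof (cases "x \<in> subcube n (eps m) (1 - eps m)")
      case True
      hence xo: "x \<in> open_cube n" using subcube_eps_open by blast
      have "\<rho>t n t x = (\<Sum>i=1..n. DD n i i t x - ld (x i) * \<rho> n t x) + source n t x"
        unfolding eq_n[OF n t xo] source_def \<gamma>_def[symmetric] sum_subtractf by simp
      thus ?thesis unfolding flux_def by (simp only: distrib_right sum_distrib_right)
    next
      case False
      thus ?thesis using Phi_zero[OF x False] by (simp add: flux_def)
    qed
    have fi: "integrable (cube_measure n) (flux n j m i t)" if i: "i \<in> {1..n}" for i
    proof -
      from flux_meas_bound(2)[OF i t j] obtain BF where "\<And>x. x \<in> closed_cube n \<Longrightarrow> \<bar>flux n j m i t x\<bar> \<le> BF" by blast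
      thus ?thesis by (rule cube_integrable[OF flux_meas_bound(1)[OF i t j]])
    qed
    have si: "integrable (cube_measure n) (\<lambda>x. source n t x * ?\<Phi> x)"
    proof (rule cube_integrable)
      show "(\<lambda>x. source n t x * ?\<Phi> x) \<in> borel_measurable (cube_measure n)"
        by (intro borel_measurable_times source_meas Phi_meas j less_imp_le[OF t])
      show "\<bar>source n t x * ?\<Phi> x\<bar> \<le> Sb * C ^ n" if x: "x \<in> closed_cube n" for x
        unfolding abs_mult using Sb(1) t t12 by (intro mult_mono Sb(2) x \<Phi>B) auto
    qed
    have "(LINT x|cube_measure n. \<rho>t n t x * ?\<Phi> x)
      = (LINT x|cube_measure n. (\<Sum>i=1..n. flux n j m i t x) + source n t x * ?\<Phi> x)"
      by (rule Bochner_Integration.integral_cong[OF refl]) (rule eq, simp only: space_cube)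
    also have "\<dots> = (LINT x|cube_measure n. (\<Sum>i=1..n. flux n j m i t x)) + (LINT x|cube_measure n. source n t x * ?\<Phi> x)"
      by (intro Bochner_Integration.integral_add Bochner_Integration.integrable_sum fi si)
    also have "(LINT x|cube_measure n. (\<Sum>i=1..n. flux n j m i t x)) = (\<Sum>i=1..n. LINT x|cube_measure n. flux n j m i t x)"
      by (rule Bochner_Integration.integral_sum[OF fi])
    finally show ?thesis .
  qed
  ultimately show ?thesis unfolding cutoff_coef_def[abs_def] by simp
qed

definition coef_rate :: "nat \<Rightarrow> (nat \<Rightarrow> nat) \<Rightarrow> real \<Rightarrow> real" where
  "coef_rate n j t = - (\<Sum>l=1..n. \<alpha> (j l)) * density_coef n j t
      + real (n + 1) * (\<Sum>k=1..N. d k * density_coef (n + 1) (j(n + 1 := k)) t)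
      + 1 / real n * (\<Sum>i=1..n. c (j i) * density_coef (n - 1) (drop_nth i j) t)
      - \<gamma> * density_coef n j t"

lemma cutoff_coef_deriv_limit:
  assumes n: "n \<ge> 1" and j: "j ` {1..n} \<subseteq> {1..N}" and e: "0 < e"
  shows "\<forall>\<^sub>F m in sequentially. \<forall>t. 0 < t \<longrightarrow> t \<le> T \<longrightarrow>
    \<bar>(\<Sum>i=1..n. LINT x|cube_measure n. flux n j m i t x)
       + (LINT x|cube_measure n. source n t x * tensor (cutoff m) n j x) - coef_rate n j t\<bar> \<le> e
     \<and> \<bar>cutoff_coef n j m t - density_coef n j t\<bar> \<le> e"
proof -
  obtain C where C: "C \<ge> 1" "\<And>k s. k \<in> {1..N} \<Longrightarrow> s \<in> {0..1} \<Longrightarrow> \<bar>\<xi> k s\<bar> \<le> C" using \<xi>_bound by blast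
  have C0: "0 \<le> C" using C by simp
  obtain R where R: "0 \<le> R" "\<And>t x. 0 \<le> t \<Longrightarrow> t \<le> T \<Longrightarrow> x \<in> closed_cube n \<Longrightarrow> \<bar>\<rho> n t x\<bar> \<le> R"
    using \<rho>_bound by blast
  obtain Sb where Sb: "0 \<le> Sb" "\<And>t x. 0 \<le> t \<Longrightarrow> t \<le> T \<Longrightarrow> x \<in> closed_cube n \<Longrightarrow> \<bar>source n t x\<bar> \<le> Sb"
    using source_bound by blast
  let ?w = "\<lambda>m. 1 - (1 - 2 * eps m) ^ n"
  define K where "K = (\<Sum>i=1..n. \<bar>\<alpha> (j i)\<bar>) * (R * C ^ n) + Sb * C ^ n"
  have lim: "(\<lambda>m. A * ?w m) \<longlonglongrightarrow> A * 0" for A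
    by (intro tendsto_mult tendsto_const window_error_lim)
  have ev1: "\<forall>\<^sub>F m in sequentially. K * ?w m < e / 2"
    by (rule order_tendstoD(2)[OF lim]) (use e in simp)
  have ev3: "\<forall>\<^sub>F m in sequentially. R * C ^ n * ?w m < e"
    by (rule order_tendstoD(2)[OF lim]) (use e in simp)
  have ev2: "\<forall>\<^sub>F m in sequentially. \<forall>i\<in>{1..n}. \<forall>t. 0 < t \<longrightarrow> t \<le> T \<longrightarrow>
    \<bar>(LINT x|cube_measure n. flux n j m i t x)
      + \<alpha> (j i) * (LINT x|cube_measure n. \<rho> n t x * tensor (cutoff m) n j x)\<bar> \<le> e / (2 * real n)"
    by (intro eventually_ball_finite ballI flux_small n j) (use e n in auto)
  from ev1 ev2 ev3 show ?thesis
  proof eventually_elim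
    case (elim m)
    show ?case
    proof (intro allI impI)
      fix t assume t: "0 < t" "t \<le> T"
      let ?f = "\<lambda>i. LINT x|cube_measure n. flux n j m i t x"
      let ?s = "LINT x|cube_measure n. source n t x * tensor (cutoff m) n j x"
      have er: "\<bar>cutoff_coef n j m t - density_coef n j t\<bar> \<le> R * C ^ n * ?w m"
        unfolding cutoff_coef_def density_coef_def
        by (rule window_error[OF j \<rho>_meas R(2) R(1) C(2) C0]) (use t in auto)
      have es: "\<bar>?s - (LINT x|cube_measure n. source n t x * tensor \<xi> n j x)\<bar> \<le> Sb * C ^ n * ?w m"
        by (rule window_error[OF j source_meas Sb(2) Sb(1) C(2) C0]) (use t in auto)
      have rhs: "coef_rate n j t = (LINT x|cube_measure n. source n t x * tensor \<xi> n j x) - (\<Sum>i=1..n. \<alpha> (j i) * density_coef n j t)"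
        unfolding coef_rate_def source_coef[OF less_imp_le[OF t(1)] j] by (simp add: sum_distrib_right)
      have diff: "(\<Sum>i=1..n. ?f i) + ?s - coef_rate n j t
        = (\<Sum>i=1..n. (?f i + \<alpha> (j i) * cutoff_coef n j m t) - \<alpha> (j i) * (cutoff_coef n j m t - density_coef n j t))
          + (?s - (LINT x|cube_measure n. source n t x * tensor \<xi> n j x))"
        unfolding rhs by (simp add: sum.distrib sum_subtractf algebra_simps)
      have "\<bar>(\<Sum>i=1..n. ?f i) + ?s - coef_rate n j t\<bar> \<le> (\<Sum>i=1..n. e / (2 * real n) + \<bar>\<alpha> (j i)\<bar> * (R * C ^ n * ?w m)) + Sb * C ^ n * ?w m"
        unfolding diff
      proof (rule order_trans[OF abs_triangle_ineq], rule add_mono[OF _ es], rule order_trans[OF sum_abs sum_mono])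
        fix i assume i: "i \<in> {1..n}"
        have 1: "\<bar>?f i + \<alpha> (j i) * cutoff_coef n j m t\<bar> \<le> e / (2 * real n)"
          using elim(2) i t unfolding cutoff_coef_def by blast
        have 2: "\<bar>\<alpha> (j i) * (cutoff_coef n j m t - density_coef n j t)\<bar> \<le> \<bar>\<alpha> (j i)\<bar> * (R * C ^ n * ?w m)"
          unfolding abs_mult by (intro mult_left_mono er) simp
        show "\<bar>(?f i + \<alpha> (j i) * cutoff_coef n j m t) - \<alpha> (j i) * (cutoff_coef n j m t - density_coef n j t)\<bar>
           \<le> e / (2 * real n) + \<bar>\<alpha> (j i)\<bar> * (R * C ^ n * ?w m)"
          by (rule order_trans[OF abs_triangle_ineq4 add_mono[OF 1 2]])
      qed
      also have "\<dots> = e / 2 + K * ?w m"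
      proof -
        have aux: "(\<Sum>i=1..n. y + \<bar>\<alpha> (j i)\<bar> * z) = real n * y + (\<Sum>i=1..n. \<bar>\<alpha> (j i)\<bar>) * z" for y z :: real
          by (simp add: sum.distrib sum_distrib_right)
        have "real n * (e / (2 * real n)) = e / 2" using n by simp
        thus ?thesis unfolding aux K_def by (simp only: distrib_right mult.assoc add.assoc)
      qed
      also have "\<dots> \<le> e" using elim(1) by simp
      finally show "\<bar>(\<Sum>i=1..n. ?f i) + ?s - coef_rate n j t\<bar> \<le> e \<and> \<bar>cutoff_coef n j m t - density_coef n j t\<bar> \<le> e"
        using er elim(3) by simp
    qed
  qed
qed

text \<open>
  The derivatives of the truncated coefficients converge uniformly on bounded time intervals, so the limit
  may be differentiated.
\<close>

lemma density_coef_deriv_pos: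
  assumes n: "n \<ge> 1" and t: "0 < t" and j: "j ` {1..n} \<subseteq> {1..N}"
  shows "(density_coef n j has_real_derivative coef_rate n j t) (at t)"
proof -
  define S where "S = {0<..<t + 1}"
  let ?F' = "\<lambda>m t. (\<Sum>i=1..n. LINT x|cube_measure n. flux n j m i t x)
       + (LINT x|cube_measure n. source n t x * tensor (cutoff m) n j x)"
  have lim: "(\<lambda>m. cutoff_coef n j m x) \<longlonglongrightarrow> density_coef n j x" if x: "x \<in> S" for x
  proof (rule LIMSEQ_I)
    fix e :: real assume e: "0 < e"
    have "\<forall>\<^sub>F m in sequentially. norm (cutoff_coef n j m x - density_coef n j x) < e"
      using cutoff_coef_deriv_limit[OF n j, of "e / 2" x] e x
      by (auto simp: S_def elim!: eventually_mono)
    thus "\<exists>no. \<forall>m\<ge>no. norm (cutoff_coef n j m x - density_coef n j x) < e"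
      unfolding eventually_sequentially .
  qed
  have "\<exists>g. \<forall>x\<in>S. (\<lambda>m. cutoff_coef n j m x) \<longlonglongrightarrow> g x \<and> (g has_derivative (\<lambda>h. h * coef_rate n j x)) (at x within S)"
  proof (rule has_derivative_sequence)
    show "convex S" unfolding S_def by (rule convex_real_interval)
    show "(cutoff_coef n j m has_derivative (\<lambda>h. h * ?F' m x)) (at x within S)" if "x \<in> S" for m x
    proof -
      have "(cutoff_coef n j m has_real_derivative ?F' m x) (at x within S)"
        by (rule has_field_derivative_at_within, rule cutoff_coef_deriv[OF n _ j]) (use that in \<open>simp add: S_def\<close>)
      moreover have "(\<lambda>h. h * y) = (*) y" for y :: real by (rule ext, rule mult.commute)
      ultimately show ?thesis unfolding has_field_derivative_def by (simp only:)
    qed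
    show "\<forall>\<^sub>F m in sequentially. \<forall>x\<in>S. \<forall>h. norm (h * ?F' m x - h * coef_rate n j x) \<le> e * norm h" if "0 < e" for e
      using cutoff_coef_deriv_limit[OF n j that, of "t + 1"]
    proof eventually_elim
      case (elim m)
      show ?case
      proof (intro ballI allI)
        fix x h assume "x \<in> S"
        hence "\<bar>?F' m x - coef_rate n j x\<bar> \<le> e" using elim by (simp add: S_def)
        hence "\<bar>h\<bar> * \<bar>?F' m x - coef_rate n j x\<bar> \<le> \<bar>h\<bar> * e" by (rule mult_left_mono) simp
        thus "norm (h * ?F' m x - h * coef_rate n j x) \<le> e * norm h"
          by (simp only: real_norm_def right_diff_distrib[symmetric] abs_mult mult.commute)
      qed
    qed
    show "t \<in> S" using t by (simp add: S_def)
    thus "(\<lambda>m. cutoff_coef n j m t) \<longlonglongrightarrow> density_coef n j t" by (rule lim)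
  qed
  then obtain g where g: "\<And>x. x \<in> S \<Longrightarrow> (\<lambda>m. cutoff_coef n j m x) \<longlonglongrightarrow> g x"
     "\<And>x. x \<in> S \<Longrightarrow> (g has_derivative (\<lambda>h. h * coef_rate n j x)) (at x within S)" by blast
  have gr: "g x = density_coef n j x" if "x \<in> S" for x by (rule LIMSEQ_unique[OF g(1) lim]) (use that in auto)
  have tS: "t \<in> S" "open S" using t by (auto simp: S_def)
  have "(g has_real_derivative coef_rate n j t) (at t)"
    using g(2)[OF tS(1)] at_within_open[OF tS] by (simp add: has_field_derivative_def mult.commute[of _ "coef_rate n j t"])
  thus ?thesis
    by (rule has_field_derivative_transform_within_open[OF _ tS(2,1)]) (rule gr)
qed

text \<open>
  The product measure over the empty index set is a point mass.
\<close>

lemma density_coef_0: "density_coef 0 j t = \<rho> 0 t (\<lambda>_. undefined)"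
proof -
  have "(LINT x|PiM {} (\<lambda>_::nat. leb01). \<rho> 0 t x) = \<rho> 0 t (\<lambda>_. undefined)"
    unfolding PiM_empty by (subst lebesgue_integral_count_space_finite) auto
  thus ?thesis by (simp add: density_coef_def tensor_def)
qed

lemma density_coef_deriv:
  assumes t: "0 < t" and j: "j ` {1..n} \<subseteq> {1..N}"
  shows "(density_coef n j has_real_derivative coef_rate n j t) (at t)"
proof (cases "n = 0")
  case False
  thus ?thesis using density_coef_deriv_pos[OF _ t j] by simp
next
  case True
  let ?u = "\<lambda>_::nat. undefined :: real"
  have u: "?u \<in> open_cube 0" by (simp add: open_cube_def)
  have up: "(LINT y|leb01. ld y * \<rho> 1 t (?u(1 := y))) = (\<Sum>k=1..N. d k * density_coef 1 (j(1 := k)) t)"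
  proof -
    have "(LINT x|cube_measure 0. (LINT y|leb01. ld y * \<rho> (0 + 1) t (x(0 + 1 := y))) * tensor \<xi> 0 j x)
      = (LINT y|leb01. ld y * \<rho> 1 t (?u(1 := y)))"
      by (simp add: PiM_empty lebesgue_integral_count_space_finite tensor_def fun_upd_def)
    thus ?thesis using up_coef[of t j 0] t by simp
  qed
  have "((\<lambda>s. \<rho> 0 s ?u) has_real_derivative \<rho>t 0 t ?u) (at t)" by (rule \<rho>t_deriv[OF t u])
  moreover have "\<rho>t 0 t ?u = coef_rate 0 j t"
    unfolding eq_0[OF t] up coef_rate_def density_coef_0 \<gamma>_def[symmetric] by simp
  ultimately show ?thesis unfolding True density_coef_0[abs_def] by simp
qed

end

section \<open>Identification of the coefficients and projection\<close>

text \<open>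
  The coefficients are forced by testing against the members of the family.
\<close>

lemma orth_proj_orthonormal:
  assumes I: "finite I"
    and bb: "\<And>i k. i \<in> I \<Longrightarrow> k \<in> I \<Longrightarrow> integrable M (\<lambda>x. b i x * b k x)"
    and on: "\<And>i k. i \<in> I \<Longrightarrow> k \<in> I \<Longrightarrow> l2_inner M (b i) (b k) = (if i = k then 1 else 0)"
    and fb: "\<And>i. i \<in> I \<Longrightarrow> integrable M (\<lambda>x. f x * b i x)"
  shows "orth_proj M I b f = (\<lambda>x. \<Sum>i\<in>I. l2_inner M f (b i) * b i x)"
proof -
  have ip: "l2_inner M (\<lambda>x. f x - (\<Sum>i\<in>I. a i * b i x)) (b k) = l2_inner M f (b k) - a k"
    and ipi: "integrable M (\<lambda>x. (f x - (\<Sum>i\<in>I. a i * b i x)) * b k x)"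
    if k: "k \<in> I" for a k
  proof -
    have e: "(\<lambda>x. (f x - (\<Sum>i\<in>I. a i * b i x)) * b k x) = (\<lambda>x. f x * b k x - (\<Sum>i\<in>I. a i * (b i x * b k x)))"
      by (simp add: left_diff_distrib sum_distrib_right mult.assoc)
    have s: "integrable M (\<lambda>x. \<Sum>i\<in>I. a i * (b i x * b k x))"
      by (intro Bochner_Integration.integrable_sum integrable_mult_right bb k)
    show "integrable M (\<lambda>x. (f x - (\<Sum>i\<in>I. a i * b i x)) * b k x)"
      unfolding e by (intro Bochner_Integration.integrable_diff fb k s)
    have "(LINT x|M. (\<Sum>i\<in>I. a i * (b i x * b k x))) = (\<Sum>i\<in>I. LINT x|M. a i * (b i x * b k x))"
      by (intro Bochner_Integration.integral_sum integrable_mult_right bb k)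
    also have "\<dots> = (\<Sum>i\<in>I. a i * (if i = k then 1 else 0))"
      by (rule sum.cong) (use on[OF _ k] in \<open>simp_all add: l2_inner_def\<close>)
    also have "\<dots> = (\<Sum>i\<in>I. if i = k then a i else 0)" by (rule sum.cong) auto
    also have "\<dots> = a k" using k I by simp
    finally show "l2_inner M (\<lambda>x. f x - (\<Sum>i\<in>I. a i * b i x)) (b k) = l2_inner M f (b k) - a k"
      unfolding l2_inner_def e by (simp only: Bochner_Integration.integral_diff[OF fb[OF k] s])
  qed
  show ?thesis unfolding orth_proj_def
  proof (rule the_equality)
    let ?g = "\<lambda>x. \<Sum>i\<in>I. l2_inner M f (b i) * b i x"
    show "?g \<in> lin_span I b \<and> (\<forall>h\<in>lin_span I b. l2_inner M (\<lambda>x. f x - ?g x) h = 0)"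
    proof (intro conjI ballI)
      show "?g \<in> lin_span I b" unfolding lin_span_def mem_Collect_eq
        by (rule exI[of _ "\<lambda>i. l2_inner M f (b i)"]) (rule refl)
      fix h assume "h \<in> lin_span I b"
      then obtain a where h: "h = (\<lambda>x. \<Sum>k\<in>I. a k * b k x)" unfolding lin_span_def by blast
      have e: "(f x - ?g x) * h x = (\<Sum>k\<in>I. a k * ((f x - ?g x) * b k x))" for x
        unfolding h by (subst sum_distrib_left) (rule sum.cong[OF refl], rule mult.left_commute)
      have "l2_inner M (\<lambda>x. f x - ?g x) h = (\<Sum>k\<in>I. LINT x|M. a k * ((f x - ?g x) * b k x))"
        unfolding l2_inner_def[of _ _ h] e
        by (intro Bochner_Integration.integral_sum integrable_mult_right ipi)
      also have "\<dots> = (\<Sum>k\<in>I. a k * l2_inner M (\<lambda>x. f x - ?g x) (b k))"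
        by (simp only: integral_mult_right_zero l2_inner_def[of _ "\<lambda>x. f x - ?g x"])
      also have "\<dots> = 0" by (rule sum.neutral) (simp add: ip)
      finally show "l2_inner M (\<lambda>x. f x - ?g x) h = 0" .
    qed
  next
    fix g assume g: "g \<in> lin_span I b \<and> (\<forall>h\<in>lin_span I b. l2_inner M (\<lambda>x. f x - g x) h = 0)"
    then obtain a where a: "g = (\<lambda>x. \<Sum>i\<in>I. a i * b i x)" unfolding lin_span_def by blast
    have "a k = l2_inner M f (b k)" if k: "k \<in> I" for k
    proof -
      have "b k = (\<lambda>x. \<Sum>i\<in>I. (if i = k then 1 else 0) * b i x)"
      proof
        fix x
        have "(\<Sum>i\<in>I. (if i = k then 1 else 0) * b i x) = (\<Sum>i\<in>I. if i = k then b i x else 0)"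
          by (rule sum.cong) auto
        thus "b k x = (\<Sum>i\<in>I. (if i = k then 1 else 0) * b i x)" using k I by simp
      qed
      hence "b k \<in> lin_span I b" unfolding lin_span_def mem_Collect_eq
        by (rule exI[of _ "\<lambda>i. if i = k then 1 else 0"])
      hence "l2_inner M (\<lambda>x. f x - g x) (b k) = 0" using g by blast
      thus ?thesis using ip[OF k, of a] unfolding a by simp
    qed
    thus "g = (\<lambda>x. \<Sum>i\<in>I. l2_inner M f (b i) * b i x)" unfolding a by simp
  qed
qed

lemma l2_inner_tensor:
  assumes m: "\<And>k. k \<in> {1..N} \<Longrightarrow> \<xi> k \<in> borel_measurable leb01"
    and B: "\<And>k s. k \<in> {1..N} \<Longrightarrow> s \<in> {0..1} \<Longrightarrow> \<bar>\<xi> k s\<bar> \<le> C" and C: "0 \<le> C"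
    and on: "\<And>i k. i \<in> {1..N} \<Longrightarrow> k \<in> {1..N} \<Longrightarrow> l2_inner leb01 (\<xi> i) (\<xi> k) = (if i = k then 1 else 0)"
    and j: "j \<in> multi_idx N n" and k: "k \<in> multi_idx N n"
  shows "l2_inner (cube_measure n) (tensor \<xi> n j) (tensor \<xi> n k) = (if j = k then 1 else 0)"
proof -
  have jl: "j l \<in> {1..N}" "k l \<in> {1..N}" if "l \<in> {1..n}" for l
    using j k that unfolding multi_idx_def by (auto simp: PiE_iff)
  have "l2_inner (cube_measure n) (tensor \<xi> n j) (tensor \<xi> n k)
     = (LINT x|cube_measure n. (\<Prod>l=1..n. \<xi> (j l) (x l) * \<xi> (k l) (x l)))"
    unfolding l2_inner_def tensor_def prod.distrib ..
  also have "\<dots> = (\<Prod>l=1..n. LINT s|leb01. \<xi> (j l) s * \<xi> (k l) s)"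
  proof (rule cube.product_integral_prod)
    show "integrable leb01 (\<lambda>s. \<xi> (j l) s * \<xi> (k l) s)" if l: "l \<in> {1..n}" for l
    proof (rule leb01_integrable)
      show "(\<lambda>s. \<xi> (j l) s * \<xi> (k l) s) \<in> borel_measurable leb01"
        by (intro borel_measurable_times m jl l)
      show "\<bar>\<xi> (j l) s * \<xi> (k l) s\<bar> \<le> C * C" if "s \<in> {0..1}" for s
        unfolding abs_mult by (intro mult_mono B jl l that C) simp
    qed
  qed simp
  also have "\<dots> = (\<Prod>l=1..n. if j l = k l then 1 else 0)"
    by (rule prod.cong[OF refl]) (use on jl in \<open>simp add: l2_inner_def\<close>)
  also have "\<dots> = (if j = k then 1 else 0)"
  proof (cases "j = k")
    case False
    have "\<exists>l\<in>{1..n}. j l \<noteq> k l"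
    proof (rule ccontr)
      assume "\<not> ?thesis"
      hence "j = k" using j k unfolding multi_idx_def by (intro PiE_ext[of j "{1..n}" _ k]) auto
      thus False using False by simp
    qed
    then obtain l where "l \<in> {1..n}" "j l \<noteq> k l" by blast
    hence "(\<Prod>l=1..n. if j l = k l then 1 else 0 :: real) = 0" by (intro prod_zero) auto
    thus ?thesis using False by simp
  qed simp
  finally show ?thesis .
qed

lemma finite_multi_idx: "finite (multi_idx N n)"
  unfolding multi_idx_def by (rule finite_PiE) auto

lemma multi_idx_image: "j \<in> multi_idx N n \<Longrightarrow> j ` {1..n} \<subseteq> {1..N}"
  unfolding multi_idx_def by auto

lemma particle_mass:
  assumes "particle_densities \<rho>" "0 \<le> t"
  shows "0 \<le> (LINT x|cube_measure n. \<rho> n t x)" "(LINT x|cube_measure n. \<rho> n t x) \<le> 1"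
proof -
  have nn: "0 \<le> (LINT x|cube_measure n. \<rho> n t x)" for n
    using assms unfolding particle_densities_def
    by (intro Bochner_Integration.integral_nonneg) (auto simp: space_cube)
  have s: "(\<lambda>n. LINT x|cube_measure n. \<rho> n t x) sums 1"
    using assms unfolding particle_densities_def by blast
  have "(\<Sum>n\<in>{n}. LINT x|cube_measure n. \<rho> n t x) \<le> (\<Sum>n. LINT x|cube_measure n. \<rho> n t x)"
    by (rule sum_le_suminf) (use s nn in \<open>auto simp: sums_iff\<close>)
  thus "(LINT x|cube_measure n. \<rho> n t x) \<le> 1" using s by (simp add: sums_iff)
  show "0 \<le> (LINT x|cube_measure n. \<rho> n t x)" by (rule nn)
qed

context cdme_model
begin

text \<open>
  Positivity enters here: the \<open>L\<^sup>1\<close> norm of \<open>\<rho> n t\<close> is a probability, whence a bound that is geometric in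
  \<open>n\<close> and uniform in \<open>t\<close>.
\<close>

lemma density_coef_growth:
  assumes pd: "particle_densities \<rho>" and t: "0 \<le> t" and j: "j ` {1..n} \<subseteq> {1..N}"
    and C: "\<And>k s. k \<in> {1..N} \<Longrightarrow> s \<in> {0..1} \<Longrightarrow> \<bar>\<xi> k s\<bar> \<le> C" "0 \<le> C"
  shows "\<bar>density_coef n j t\<bar> \<le> C ^ n"
proof -
  obtain B where B: "0 \<le> B" "\<And>x. x \<in> closed_cube n \<Longrightarrow> \<bar>\<rho> n t x\<bar> \<le> B"
    using \<rho>_bound[of t n] t by (metis order.refl)
  have tb: "\<bar>tensor \<xi> n j x\<bar> \<le> C ^ n" if x: "x \<in> closed_cube n" for x
    by (rule tensor_bound[OF _ x]) (use j C(1) in blast)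
  have nn: "0 \<le> \<rho> n t x" if "x \<in> closed_cube n" for x
    using pd t that unfolding particle_densities_def by blast
  have i: "integrable (cube_measure n) (\<lambda>x. \<rho> n t x * tensor \<xi> n j x)"
  proof (rule cube_integrable)
    show "(\<lambda>x. \<rho> n t x * tensor \<xi> n j x) \<in> borel_measurable (cube_measure n)"
      by (intro borel_measurable_times \<rho>_meas t tensor_meas j)
    show "\<bar>\<rho> n t x * tensor \<xi> n j x\<bar> \<le> B * C ^ n" if "x \<in> closed_cube n" for x
      unfolding abs_mult by (intro mult_mono B tb that) auto
  qed
  have "\<bar>density_coef n j t\<bar> \<le> (LINT x|cube_measure n. \<bar>\<rho> n t x * tensor \<xi> n j x\<bar>)"
    unfolding density_coef_def using integral_norm_bound[of "cube_measure n" "\<lambda>x. \<rho> n t x * tensor \<xi> n j x"] by simp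
  also have "\<dots> \<le> (LINT x|cube_measure n. C ^ n * \<rho> n t x)"
  proof (rule integral_mono)
    show "integrable (cube_measure n) (\<lambda>x. \<bar>\<rho> n t x * tensor \<xi> n j x\<bar>)" by (rule integrable_abs[OF i])
    show "integrable (cube_measure n) (\<lambda>x. C ^ n * \<rho> n t x)"
      by (intro integrable_mult_right cube_integrable[OF \<rho>_meas[OF t] B(2)])
    show "\<bar>\<rho> n t x * tensor \<xi> n j x\<bar> \<le> C ^ n * \<rho> n t x" if "x \<in> space (cube_measure n)" for x
    proof -
      have x: "x \<in> closed_cube n" using that by (simp only: space_cube)
      have "\<bar>\<rho> n t x * tensor \<xi> n j x\<bar> = \<bar>tensor \<xi> n j x\<bar> * \<rho> n t x"
        using nn[OF x] by (simp add: abs_mult)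
      also have "\<dots> \<le> C ^ n * \<rho> n t x" by (intro mult_right_mono tb x nn)
      finally show ?thesis .
    qed
  qed
  also have "\<dots> = C ^ n * (LINT x|cube_measure n. \<rho> n t x)" by simp
  also have "\<dots> \<le> C ^ n * 1"
    by (intro mult_left_mono particle_mass(2)[OF pd t]) (use C in simp)
  finally show ?thesis by simp
qed

text \<open>
  The difference of the two families solves the homogeneous linear system with zero initial values, and it
  satisfies the growth bound of the uniqueness lemma.
\<close>

lemma density_coef_eq_coef:
  assumes pd: "particle_densities \<rho>" and N1: "1 \<le> N"
    and init: "\<rho> 0 0 (\<lambda>_. undefined) = 0" "\<And>x. x \<in> closed_cube 1 \<Longrightarrow> \<rho> 1 0 x = \<zeta> (x 1)"
      "\<And>n x. n > 1 \<Longrightarrow> x \<in> closed_cube n \<Longrightarrow> \<rho> n 0 x = 0"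
    and \<zeta>: "\<zeta> \<in> borel_measurable leb01"
    and \<zeta>k: "\<And>k. \<zeta>k k = (LINT y|leb01. \<zeta> y * \<xi> k y)"
    and t: "0 \<le> t" and j: "j ` {1..n} \<subseteq> {1..N}"
  shows "density_coef n j t = ou_data.coef N \<alpha> d c \<zeta>k \<gamma> n j t"
proof -
  interpret ou: ou_data N \<alpha> d c \<zeta>k \<gamma> .
  obtain C1 where C1: "C1 \<ge> 1" "\<And>k s. k \<in> {1..N} \<Longrightarrow> s \<in> {0..1} \<Longrightarrow> \<bar>\<xi> k s\<bar> \<le> C1" using \<xi>_bound by blast
  obtain A2 C2 where C2: "A2 \<ge> 0" "C2 \<ge> 1" "\<And>n j s. (\<forall>l\<in>{1..n}. j l \<in> {1..N}) \<Longrightarrow> 0 \<le> s \<Longrightarrow> s \<le> t \<Longrightarrow> \<bar>ou.coef n j s\<bar> \<le> A2 * C2 ^ n"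
    using ou.coef_bounded[of t] by blast
  define I where "I n = {j :: nat \<Rightarrow> nat. j ` {1..n} \<subseteq> {1..N}}" for n
  define \<delta> where "\<delta> n j s = density_coef n j s - ou.coef n j s" for n j s
  define Df where "Df n j s = - (\<Sum>l=1..n. \<alpha> (j l)) * \<delta> n j s
      + real (n + 1) * (\<Sum>k=1..N. d k * \<delta> (n + 1) (j(n + 1 := k)) s)
      + 1 / real n * (\<Sum>i=1..n. c (j i) * \<delta> (n - 1) (drop_nth i j) s)
      - \<gamma> * \<delta> n j s" for n j s
  define L where "L = (\<Sum>k=1..N. \<bar>\<alpha> k\<bar>) + (\<Sum>k=1..N. \<bar>d k\<bar>) + (\<Sum>k=1..N. \<bar>c k\<bar>) + \<bar>\<gamma>\<bar>"
  have "\<delta> n j t = 0"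
  proof (rule coupled_hierarchy_zero[where \<delta> = \<delta> and n = n and j = j and t = t and I = I and D = Df and A = "1 + A2" and C = "max C1 C2" and L = L and T = t])
    show "0 \<le> 1 + A2" "0 < max C1 C2" using C1 C2 by auto
    show "0 \<le> L" unfolding L_def by (intro add_nonneg_nonneg sum_nonneg) auto
    show "continuous_on {0..t} (\<delta> n j)" if "j \<in> I n" for n j
      unfolding \<delta>_def[abs_def]
      by (intro continuous_on_diff ou.continuous_coef continuous_on_subset[OF density_coef_continuous])
         (use that in \<open>auto simp: I_def\<close>)
    show "\<delta> n j 0 = 0" if "j \<in> I n" for n j
    proof -
      have j: "j ` {1..n} \<subseteq> {1..N}" using that by (simp add: I_def)
      consider "n = 0" | "n = 1" | "n > 1" by linarith
      thus ?thesis
      proof cases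
        case 1
        thus ?thesis unfolding \<delta>_def ou.coef_0 using init(1) by (simp add: density_coef_0)
      next
        case 2
        have "1 \<in> {1..n}" using 2 by simp
        hence j1: "j 1 \<in> {1..N}" using j by blast
        have "density_coef 1 j 0 = (LINT x|cube_measure 1. (\<lambda>s. \<zeta> s * \<xi> (j 1) s) (x 1))"
          unfolding density_coef_def
        proof (rule Bochner_Integration.integral_cong[OF refl])
          fix x assume "x \<in> space (cube_measure 1)"
          hence "\<rho> 1 0 x = \<zeta> (x 1)" by (intro init(2)) (simp only: space_cube)
          thus "\<rho> 1 0 x * tensor \<xi> 1 j x = \<zeta> (x 1) * \<xi> (j 1) (x 1)" by (simp add: tensor_def)
        qed
        also have "\<dots> = (LINT x|PiM {1::nat} (\<lambda>_. leb01). (\<lambda>s. \<zeta> s * \<xi> (j 1) s) (x 1))" by simp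
        also have "\<dots> = (LINT s|leb01. \<zeta> s * \<xi> (j 1) s)"
          by (rule cube.product_integral_singleton) (intro borel_measurable_times \<zeta> \<xi>m j1)
        finally show ?thesis using 2 by (simp add: \<delta>_def ou.coef_0 \<zeta>k)
      next
        case 3
        have "density_coef n j 0 = (LINT x|cube_measure n. 0)"
          unfolding density_coef_def by (rule Bochner_Integration.integral_cong[OF refl])
            (use init(3)[OF 3] in \<open>simp add: space_cube\<close>)
        thus ?thesis using 3 by (simp add: \<delta>_def ou.coef_0)
      qed
    qed
    show "(\<delta> n j has_real_derivative Df n j s) (at s)" if "j \<in> I n" "0 < s" for n j s
    proof -
      have "(\<delta> n j has_real_derivative coef_rate n j s - (- (\<Sum>l=1..n. \<alpha> (j l)) * ou.coef n j s
      + real (n + 1) * (\<Sum>k=1..N. d k * ou.coef (n + 1) (j(n + 1 := k)) s)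
      + 1 / real n * (\<Sum>i=1..n. c (j i) * ou.coef (n - 1) (drop_nth i j) s)
      - \<gamma> * ou.coef n j s)) (at s)"
        unfolding \<delta>_def[abs_def]
        by (intro DERIV_diff density_coef_deriv ou.coef_deriv) (use that in \<open>auto simp: I_def\<close>)
      moreover have "Df n j s = coef_rate n j s - (- (\<Sum>l=1..n. \<alpha> (j l)) * ou.coef n j s
      + real (n + 1) * (\<Sum>k=1..N. d k * ou.coef (n + 1) (j(n + 1 := k)) s)
      + 1 / real n * (\<Sum>i=1..n. c (j i) * ou.coef (n - 1) (drop_nth i j) s)
      - \<gamma> * ou.coef n j s)"
        unfolding Df_def coef_rate_def \<delta>_def right_diff_distrib sum_subtractf by linarith
      ultimately show ?thesis by (simp only:)
    qed
    show "\<bar>\<delta> n j s\<bar> \<le> (1 + A2) * max C1 C2 ^ n" if "j \<in> I n" "0 \<le> s" "s \<le> t" for n j s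
    proof -
      have j: "j ` {1..n} \<subseteq> {1..N}" using that by (simp add: I_def)
      have "\<bar>density_coef n j s\<bar> \<le> C1 ^ n" by (rule density_coef_growth[OF pd that(2) j C1(2)]) (use C1 in auto)
      also have "\<dots> \<le> max C1 C2 ^ n" by (rule power_mono) (use C1 in auto)
      finally have 1: "\<bar>density_coef n j s\<bar> \<le> max C1 C2 ^ n" .
      have "\<bar>ou.coef n j s\<bar> \<le> A2 * C2 ^ n" by (rule C2(3)) (use j that in blast)+
      also have "\<dots> \<le> A2 * max C1 C2 ^ n" by (intro mult_left_mono power_mono) (use C2 in auto)
      finally have 2: "\<bar>ou.coef n j s\<bar> \<le> A2 * max C1 C2 ^ n" .
      have "\<bar>\<delta> n j s\<bar> \<le> \<bar>density_coef n j s\<bar> + \<bar>ou.coef n j s\<bar>" unfolding \<delta>_def by (rule abs_triangle_ineq4)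
      also have "\<dots> \<le> max C1 C2 ^ n + A2 * max C1 C2 ^ n" by (rule add_mono[OF 1 2])
      finally show ?thesis by (simp add: distrib_right)
    qed
    show "\<bar>Df n j s\<bar> \<le> L * (real (Suc n) * (y n + y (Suc n)) + y (n - 1))"
      if jI: "j \<in> I n" and s: "0 < s" "s < t" and y: "\<And>m i. i \<in> I m \<Longrightarrow> \<bar>\<delta> m i s\<bar> \<le> y m" for n j s y
    proof -
      have j: "j ` {1..n} \<subseteq> {1..N}" using jI by (simp add: I_def)
      have y0: "0 \<le> y m" for m
      proof -
        \<comment> \<open>every level has at least one index, so each \<open>y m\<close> bounds some absolute value\<close>
        have "(\<lambda>_. 1) \<in> I m" using N1 by (auto simp: I_def)
        from y[OF this] show ?thesis by linarith
      qed
      have le: "\<bar>f (j i)\<bar> \<le> (\<Sum>k=1..N. \<bar>f k\<bar>)" if "i \<in> {1..n}" for f :: "nat \<Rightarrow> real" and i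
      proof -
        have "j i \<in> {1..N}" using j that by blast
        thus ?thesis by (rule member_le_sum) auto
      qed
      let ?A = "\<Sum>k=1..N. \<bar>\<alpha> k\<bar>" and ?D = "\<Sum>k=1..N. \<bar>d k\<bar>" and ?C = "\<Sum>k=1..N. \<bar>c k\<bar>"
      have nn: "0 \<le> ?A" "0 \<le> ?D" "0 \<le> ?C" by (auto intro: sum_nonneg)
      have 1: "\<bar>- (\<Sum>l=1..n. \<alpha> (j l)) * \<delta> n j s\<bar> \<le> (real n * ?A) * y n"
      proof -
        have "\<bar>\<Sum>l=1..n. \<alpha> (j l)\<bar> \<le> (\<Sum>l=1..n. ?A)"
          by (rule order_trans[OF sum_abs sum_mono]) (rule le)
        thus ?thesis using y[OF jI] nn by (simp add: abs_mult) (intro mult_mono, auto)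
      qed
      have 2: "\<bar>real (n + 1) * (\<Sum>k=1..N. d k * \<delta> (n + 1) (j(n + 1 := k)) s)\<bar> \<le> real (n + 1) * (?D * y (n + 1))"
      proof -
        have "\<bar>\<Sum>k=1..N. d k * \<delta> (n + 1) (j(n + 1 := k)) s\<bar> \<le> (\<Sum>k=1..N. \<bar>d k\<bar> * y (n + 1))"
        proof (rule order_trans[OF sum_abs sum_mono])
          fix k assume k: "k \<in> {1..N}"
          have "j(n + 1 := k) \<in> I (n + 1)" using j k by (auto simp: I_def)
          thus "\<bar>d k * \<delta> (n + 1) (j(n + 1 := k)) s\<bar> \<le> \<bar>d k\<bar> * y (n + 1)"
            unfolding abs_mult by (intro mult_left_mono y) auto
        qed
        thus ?thesis unfolding sum_distrib_right[symmetric] abs_mult abs_of_nat by (rule mult_left_mono) simp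
      qed
      have 3: "\<bar>1 / real n * (\<Sum>i=1..n. c (j i) * \<delta> (n - 1) (drop_nth i j) s)\<bar> \<le> ?C * y (n - 1)"
      proof (cases "n = 0")
        case False
        have "\<bar>\<Sum>i=1..n. c (j i) * \<delta> (n - 1) (drop_nth i j) s\<bar> \<le> (\<Sum>i=1..n. ?C * y (n - 1))"
        proof (rule order_trans[OF sum_abs sum_mono])
          fix i assume i: "i \<in> {1..n}"
          have "drop_nth i j l \<in> {1..N}" if "l \<in> {1..n - 1}" for l
          proof -
            have "(if l < i then l else Suc l) \<in> {1..n}" using that by auto
            hence "j (if l < i then l else Suc l) \<in> {1..N}" using j by blast
            thus ?thesis by (simp add: drop_nth_def split: if_splits)
          qed
          hence "drop_nth i j \<in> I (n - 1)" unfolding I_def by blast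
          thus "\<bar>c (j i) * \<delta> (n - 1) (drop_nth i j) s\<bar> \<le> ?C * y (n - 1)"
            unfolding abs_mult by (intro mult_mono y le i nn) auto
        qed
        hence "1 / real n * \<bar>\<Sum>i=1..n. c (j i) * \<delta> (n - 1) (drop_nth i j) s\<bar> \<le> 1 / real n * (real n * (?C * y (n - 1)))"
          by (intro mult_left_mono) auto
        thus ?thesis using False by (simp add: abs_mult)
      qed (use nn y0 in simp)
      have 4: "\<bar>\<gamma> * \<delta> n j s\<bar> \<le> \<bar>\<gamma>\<bar> * y n" unfolding abs_mult by (intro mult_left_mono y jI) auto
      have "\<bar>Df n j s\<bar> \<le> (real n * ?A) * y n + real (n + 1) * (?D * y (n + 1)) + ?C * y (n - 1) + \<bar>\<gamma>\<bar> * y n"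
        unfolding Df_def using 1 2 3 4 by linarith
      also have "\<dots> \<le> L * (real (Suc n) * y n) + L * (real (Suc n) * y (Suc n)) + L * y (n - 1)"
      proof -
        have a: "(real n * ?A) * y n + \<bar>\<gamma>\<bar> * y n \<le> L * (real (Suc n) * y n)"
        proof -
          have "(real n * ?A) * y n + \<bar>\<gamma>\<bar> * y n \<le> (?A + \<bar>\<gamma>\<bar>) * (real (Suc n) * y n)"
            using nn y0[of n] by (simp add: algebra_simps)
          also have "\<dots> \<le> L * (real (Suc n) * y n)"
            by (rule mult_right_mono) (use nn y0 in \<open>auto simp: L_def\<close>)
          finally show ?thesis .
        qed
        have b: "real (n + 1) * (?D * y (n + 1)) \<le> L * (real (Suc n) * y (Suc n))"
        proof -
          have "real (n + 1) * (?D * y (n + 1)) = ?D * (real (Suc n) * y (Suc n))"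
            unfolding Suc_eq_plus1 by (simp only: mult.left_commute)
          also have "\<dots> \<le> L * (real (Suc n) * y (Suc n))"
            by (rule mult_right_mono) (use nn y0 in \<open>auto simp: L_def\<close>)
          finally show ?thesis .
        qed
        have c: "?C * y (n - 1) \<le> L * y (n - 1)"
          by (rule mult_right_mono) (use nn y0 in \<open>auto simp: L_def\<close>)
        from a b c show ?thesis by linarith
      qed
      also have "\<dots> = L * (real (Suc n) * (y n + y (Suc n)) + y (n - 1))"
        by (simp only: distrib_left)
      finally show ?thesis .
    qed
    show "j \<in> I n" using j by (simp add: I_def)
  qed (use t in auto)
  thus ?thesis by (simp add: \<delta>_def)
qed

end

theorem theorem1p5:
  fixes ld lc \<zeta> :: "real \<Rightarrow> real"
    and \<xi> :: "nat \<Rightarrow> real \<Rightarrow> real" and \<alpha> :: "nat \<Rightarrow> real"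
    and \<rho> :: "nat \<Rightarrow> real \<Rightarrow> (nat \<Rightarrow> real) \<Rightarrow> real"
    and N0 N :: nat
    and dk ck \<zeta>k :: "nat \<Rightarrow> real" and \<gamma> :: real
    and M :: "'w measure" and W :: "nat \<Rightarrow> real \<Rightarrow> 'w \<Rightarrow> real"
    and X :: "nat \<Rightarrow> real \<Rightarrow> real \<Rightarrow> 'w \<Rightarrow> real"
    and u :: "real \<Rightarrow> (nat \<Rightarrow> real) \<Rightarrow> real"
  defines "dk \<equiv> \<lambda>k. l2_inner leb01 ld (\<xi> k)"
    and "ck \<equiv> \<lambda>k. l2_inner leb01 lc (\<xi> k)"
    and "\<zeta>k \<equiv> \<lambda>k. l2_inner leb01 \<zeta> (\<xi> k)"
    and "\<gamma> \<equiv> LINT y|leb01. lc y"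
  assumes data: "nonneg_bounded_measurable ld" "nonneg_bounded_measurable lc"
      "nonneg_bounded_measurable \<zeta>"
    and zeta: "smooth01 \<zeta>"
      "(\<zeta> has_real_derivative 0) (at 0 within {0..1})"
      "(\<zeta> has_real_derivative 0) (at 1 within {0..1})"
      "(LINT x|leb01. \<zeta> x) = 1"
    and basis: "orthonormal_basis leb01 \<xi>"
    and eigen: "\<And>k. k \<ge> 1 \<Longrightarrow> \<alpha> k \<ge> 0"
      "\<And>k. k \<ge> 1 \<Longrightarrow> neumann_eigenfunction ld (\<alpha> k) (\<xi> k)"
    and N0: "N0 \<ge> 1" "AE x in leb01. orth_proj leb01 {1..N0} \<xi> ld x = ld x"
    and cdme: "cdme_classical_solution ld lc \<zeta> \<rho>" "particle_densities \<rho>"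
    and N: "N \<ge> N0"
    and prob: "prob_space M" "independent_brownian_motions M N W"
    and sde: "\<And>i z. i \<in> {1..N} \<Longrightarrow>
      strong_solution M (W i) (\<lambda>y. dk i - ck i - \<alpha> i * y) (sqrt (2 * \<alpha> i)) z (X i z)"
    and u: "\<And>t z. t \<ge> 0 \<Longrightarrow> z \<in> euclid N \<Longrightarrow> u t z = feynman_kac M N X \<zeta>k ck \<gamma> t z"
  shows "ou_classical_solution N \<alpha> dk ck \<zeta>k \<gamma> u \<and>
    (\<forall>t\<ge>0.
       integrable (std_gaussian N) (u t) \<and>
       \<rho> 0 t (\<lambda>_. undefined) = (LINT z|std_gaussian N. u t z) \<and>
       has_all_partials N (u t) \<and>
       (\<forall>n\<ge>1.
          (\<forall>j\<in>multi_idx N n.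
             integrable (std_gaussian N) (partials (map j [1..<n+1]) (u t))) \<and>
          (\<forall>x\<in>closed_cube n.
             tensor_proj \<xi> N n (\<rho> n t) x =
             1 / fact n * (\<Sum>j\<in>multi_idx N n.
               (LINT z|std_gaussian N. partials (map j [1..<n+1]) (u t) z)
                 * (\<Prod>i=1..n. \<xi> (j i) (x i))))))"
proof -
  obtain \<rho>t D DD where sol:
     "\<forall>n. continuous_on ({0..} \<times> closed_cube n) (\<lambda>(t, x). \<rho> n t x)"
     "\<forall>n. \<forall>t>0. \<forall>x\<in>open_cube n. ((\<lambda>s. \<rho> n s x) has_real_derivative \<rho>t n t x) (at t)"
     "\<forall>n. continuous_on ({0<..} \<times> open_cube n) (\<lambda>(t, x). \<rho>t n t x)"
     "\<forall>n. \<forall>i\<in>{1..n}. \<forall>t\<ge>0. \<forall>x\<in>closed_cube n.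
        ((\<lambda>s. \<rho> n t (x(i := s))) has_real_derivative D n i t x) (at (x i) within {0..1})"
     "\<forall>n. \<forall>i\<in>{1..n}. continuous_on ({0..} \<times> closed_cube n) (\<lambda>(t, x). D n i t x)"
     "\<forall>n. \<forall>i\<in>{1..n}. \<forall>j\<in>{1..n}. \<forall>t>0. \<forall>x\<in>open_cube n.
        ((\<lambda>s. D n i t (x(j := s))) has_real_derivative DD n i j t x) (at (x j))"
     "\<forall>n. \<forall>i\<in>{1..n}. \<forall>j\<in>{1..n}.
        continuous_on ({0<..} \<times> open_cube n) (\<lambda>(t, x). DD n i j t x)"
     "\<forall>t>0. \<rho>t 0 t (\<lambda>_. undefined) =
        (LINT y|leb01. ld y * \<rho> 1 t ((\<lambda>_. undefined)(1 := y)))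
        - (LINT y|leb01. lc y) * \<rho> 0 t (\<lambda>_. undefined)"
     "\<forall>n\<ge>1. \<forall>t>0. \<forall>x\<in>open_cube n. \<rho>t n t x =
        (\<Sum>i=1..n. DD n i i t x)
        + real (n + 1) * (LINT y|leb01. ld y * \<rho> (n + 1) t (x(n + 1 := y)))
        - (\<Sum>i=1..n. ld (x i) * \<rho> n t x)
        + 1 / real n * (\<Sum>i=1..n. lc (x i) * \<rho> (n - 1) t (drop_coord n i x))
        - (LINT y|leb01. lc y) * \<rho> n t x"
     "\<rho> 0 0 (\<lambda>_. undefined) = 0"
     "\<forall>x\<in>closed_cube 1. \<rho> 1 0 x = \<zeta> (x 1)"
     "\<forall>n>1. \<forall>x\<in>closed_cube n. \<rho> n 0 x = 0"
     "\<forall>n\<ge>1. \<forall>t\<ge>0. \<forall>x\<in>closed_cube n. \<forall>i\<in>{1..n}. x i \<in> {0, 1} \<longrightarrow> D n i t x = 0"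
    using cdme(1) unfolding cdme_classical_solution_def
    by (elim exE conjE) (rule that; assumption)
  have \<xi>m: "\<xi> k \<in> borel_measurable leb01" if "k \<ge> 1" for k
    using basis that unfolding orthonormal_basis_def square_integrable_def by blast
  have on: "l2_inner leb01 (\<xi> i) (\<xi> k) = (if i = k then 1 else 0)" if "i \<ge> 1" "k \<ge> 1" for i k
    using basis that unfolding orthonormal_basis_def by blast
  have ldm: "ld \<in> borel_measurable leb01" using data(1) by (simp add: nonneg_bounded_measurable_def)
  obtain Bd where Bd: "\<And>s. s \<in> {0..1} \<Longrightarrow> \<bar>ld s\<bar> \<le> Bd"
  proof -
    from data(1) obtain B where "\<And>s. s \<in> {0..1} \<Longrightarrow> 0 \<le> ld s \<and> ld s \<le> B"
      unfolding nonneg_bounded_measurable_def by blast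
    thus ?thesis using that[of B] by force
  qed
  have \<xi>B: "\<exists>B. \<forall>s\<in>{0..1}. \<bar>\<xi> k s\<bar> \<le> B" if "k \<ge> 1" for k
  proof -
    from neumann_eigenfunction_green[OF eigen(2)[OF that]] obtain f' where
      "\<And>x. x \<in> {0..1} \<Longrightarrow> (\<xi> k has_real_derivative f' x) (at x within {0..1})" by metis
    hence "continuous_on {0..1} (\<xi> k)" by (rule DERIV_continuous_on)
    from continuous_on_compact_bounded[OF compact_Icc this] show ?thesis by metis
  qed
  have bi: "integrable leb01 (\<lambda>s. f s * g s)" if fg: "f \<in> borel_measurable leb01" "g \<in> borel_measurable leb01"
    "\<exists>B. \<forall>s\<in>{0..1}. \<bar>f s\<bar> \<le> B" "\<exists>B. \<forall>s\<in>{0..1}. \<bar>g s\<bar> \<le> B" for f g :: "real \<Rightarrow> real"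
  proof -
    obtain B1 B2 where "\<forall>s\<in>{0..1}. \<bar>f s\<bar> \<le> B1" "\<forall>s\<in>{0..1}. \<bar>g s\<bar> \<le> B2" using fg(3,4) by blast
    hence "\<bar>f s * g s\<bar> \<le> \<bar>B1\<bar> * \<bar>B2\<bar>" if "s \<in> {0..1}" for s
      unfolding abs_mult using that by (intro mult_mono) (auto intro: order_trans[OF _ abs_ge_self])
    thus ?thesis by (rule leb01_integrable[OF borel_measurable_times[OF fg(1,2)]])
  qed
  have x_i: "integrable leb01 (\<lambda>s. \<xi> i s * \<xi> k s)" if "i \<ge> 1" "k \<ge> 1" for i k
    by (intro bi \<xi>m \<xi>B that)
  have ldx_i: "integrable leb01 (\<lambda>s. ld s * \<xi> k s)" if "k \<ge> 1" for k
    by (intro bi \<xi>m \<xi>B ldm that) (use Bd in blast)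
  have proj: "orth_proj leb01 {1..N0} \<xi> ld = (\<lambda>x. \<Sum>k=1..N0. dk k * \<xi> k x)"
    unfolding dk_def by (rule orth_proj_orthonormal) (auto intro: x_i ldx_i simp: on)
  have exp0: "AE x in leb01. ld x = (\<Sum>k=1..N0. dk k * \<xi> k x)"
    using N0(2) unfolding proj by eventually_elim simp
  \<comment> \<open>by orthogonality the expansion of \<open>ld\<close> up to \<open>N0\<close> is also its expansion up to \<open>N\<close>\<close>
  have dk0: "dk k = 0" if k: "N0 < k" for k
  proof -
    have "dk k = (LINT x|leb01. (\<Sum>i=1..N0. dk i * (\<xi> i x * \<xi> k x)))"
      unfolding dk_def[of] l2_inner_def
    proof (rule integral_cong_AE)
      show "(\<lambda>x. ld x * \<xi> k x) \<in> borel_measurable leb01" using ldx_i[of k] k by auto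
      show "(\<lambda>x. \<Sum>i=1..N0. (LINT x|leb01. ld x * \<xi> i x) * (\<xi> i x * \<xi> k x)) \<in> borel_measurable leb01"
        by (intro borel_measurable_sum borel_measurable_times borel_measurable_const \<xi>m) (use k in auto)
      show "AE x in leb01. ld x * \<xi> k x = (\<Sum>i=1..N0. (LINT x|leb01. ld x * \<xi> i x) * (\<xi> i x * \<xi> k x))"
        using exp0 unfolding dk_def l2_inner_def by eventually_elim (simp add: sum_distrib_right mult.assoc)
    qed
    also have "\<dots> = (\<Sum>i=1..N0. LINT x|leb01. dk i * (\<xi> i x * \<xi> k x))"
      by (intro Bochner_Integration.integral_sum integrable_mult_right x_i) (use k in auto)
    also have "\<dots> = (\<Sum>i=1..N0. dk i * l2_inner leb01 (\<xi> i) (\<xi> k))"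
      by (simp only: integral_mult_right_zero l2_inner_def)
    also have "\<dots> = 0" by (rule sum.neutral) (use k on in auto)
    finally show ?thesis .
  qed
  have "(\<Sum>k=1..N0. dk k * \<xi> k x) = (\<Sum>k=1..N. dk k * \<xi> k x)" for x
    by (rule sum.mono_neutral_left) (use N dk0 in auto)
  hence ld_expand: "AE x in leb01. ld x = (\<Sum>k=1..N. dk k * \<xi> k x)" using exp0 by simp
  interpret cdme_model ld lc \<xi> \<alpha> N \<rho> \<rho>t D DD dk ck \<gamma>
  proof (unfold_locales, goal_cases)
    case 1 show ?case by (rule data(1))
  next
    case 2 show ?case by (rule data(2))
  next
    case (3 k) thus ?case by (intro eigen(2)) simp
  next
    case (4 k) thus ?case by (intro \<xi>m) simp
  next
    case 5 show ?case by (rule ld_expand)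
  next
    case (6 k) show ?case by (simp add: ck_def l2_inner_def)
  next
    case 7 show ?case by (simp add: \<gamma>_def)
  next
    case (8 n) show ?case using sol(1) by (rule spec)
  next
    case (9 n t x) thus ?case using sol(2) by blast
  next
    case (10 n) show ?case using sol(3) by (rule spec)
  next
    case (11 n i t x) thus ?case using sol(4) by blast
  next
    case (12 n i) thus ?case using sol(5) by blast
  next
    case (13 n i t x) thus ?case using sol(6) by blast
  next
    case (14 n i) thus ?case using sol(7) by blast
  next
    case (15 t) thus ?case using sol(8) by blast
  next
    case (16 n t x) thus ?case using sol(9) by blast
  next
    case (17 n t x i) thus ?case using sol(13) by blast
  qed
  interpret ou: ou_data N \<alpha> dk ck \<zeta>k \<gamma> .
  have N1: "1 \<le> N" using N N0(1) by simp
  have uU: "u t z = ou.U t z" if "0 \<le> t" "z \<in> euclid N" for t z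
  proof -
    have "u t z = feynman_kac M N X \<zeta>k ck \<gamma> t z" by (rule u[OF that])
    also have "\<dots> = ou.U t z"
      by (rule ou.feynman_kac_eq_U[OF prob _ sde that(1)]) (use eigen(1) in auto)
    finally show ?thesis .
  qed
  have \<zeta>m: "\<zeta> \<in> borel_measurable leb01" using data(3) by (simp add: nonneg_bounded_measurable_def)
  have rc: "density_coef n j t = ou.coef n j t" if "0 \<le> t" "j ` {1..n} \<subseteq> {1..N}" for n j t
    by (rule density_coef_eq_coef[OF cdme(2) N1 sol(10) bspec[OF sol(11)] _ \<zeta>m _ that])
       (use sol(12) in \<open>simp_all add: \<zeta>k_def l2_inner_def\<close>)
  obtain C where C: "C \<ge> 1" "\<And>k s. k \<in> {1..N} \<Longrightarrow> s \<in> {0..1} \<Longrightarrow> \<bar>\<xi> k s\<bar> \<le> C" using \<xi>_bound by blast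
  have tproj: "tensor_proj \<xi> N n (\<rho> n t) x = (\<Sum>j\<in>multi_idx N n. ou.coef n j t * tensor \<xi> n j x)"
    if t: "0 \<le> t" for n t x
  proof -
    have tb: "\<bar>tensor \<xi> n j x\<bar> \<le> C ^ n" if "j \<in> multi_idx N n" "x \<in> closed_cube n" for j x
      by (rule tensor_bound[OF C(2) that(2)]) (use multi_idx_image[OF that(1)] in blast)
    obtain B where B: "0 \<le> B" "\<And>x. x \<in> closed_cube n \<Longrightarrow> \<bar>\<rho> n t x\<bar> \<le> B"
      using \<rho>_bound[of t n] t by (metis order.refl)
    have "tensor_proj \<xi> N n (\<rho> n t) = (\<lambda>x. \<Sum>j\<in>multi_idx N n. l2_inner (cube_measure n) (\<rho> n t) (tensor \<xi> n j) * tensor \<xi> n j x)"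
      unfolding tensor_proj_def
    proof (rule orth_proj_orthonormal[OF finite_multi_idx])
      fix j assume j: "j \<in> multi_idx N n"
      show "integrable (cube_measure n) (\<lambda>x. \<rho> n t x * tensor \<xi> n j x)"
      proof (rule cube_integrable)
        show "(\<lambda>x. \<rho> n t x * tensor \<xi> n j x) \<in> borel_measurable (cube_measure n)"
          by (intro borel_measurable_times \<rho>_meas t tensor_meas multi_idx_image j)
        show "\<bar>\<rho> n t x * tensor \<xi> n j x\<bar> \<le> B * C ^ n" if "x \<in> closed_cube n" for x
          unfolding abs_mult by (intro mult_mono B tb j that) auto
      qed
      fix k assume k: "k \<in> multi_idx N n"
      show "l2_inner (cube_measure n) (tensor \<xi> n j) (tensor \<xi> n k) = (if j = k then 1 else 0)"
        by (rule l2_inner_tensor[OF _ C(2) _ _ j k]) (use C(1) \<xi>m on in auto)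
      show "integrable (cube_measure n) (\<lambda>x. tensor \<xi> n j x * tensor \<xi> n k x)"
      proof (rule cube_integrable)
        show "(\<lambda>x. tensor \<xi> n j x * tensor \<xi> n k x) \<in> borel_measurable (cube_measure n)"
          by (intro borel_measurable_times tensor_meas multi_idx_image j k)
        show "\<bar>tensor \<xi> n j x * tensor \<xi> n k x\<bar> \<le> C ^ n * C ^ n" if "x \<in> closed_cube n" for x
          unfolding abs_mult by (intro mult_mono tb j k that) (use C(1) in auto)
      qed
    qed
    moreover have "l2_inner (cube_measure n) (\<rho> n t) (tensor \<xi> n j) = ou.coef n j t" if "j \<in> multi_idx N n" for j
      using rc[OF t multi_idx_image[OF that]] by (simp add: density_coef_def l2_inner_def)
    ultimately show ?thesis by simp
  qed
  show ?thesis
  proof (intro conjI allI impI ballI)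
    show "ou_classical_solution N \<alpha> dk ck \<zeta>k \<gamma> u" by (rule ou.U_classical_solution[OF uU])
    fix t :: real assume t: "0 \<le> t"
    note uUt = uU[OF t]
    show "integrable (std_gaussian N) (u t)" by (rule ou.gaussian_U(1)[OF uUt])
    show "has_all_partials N (u t)" by (rule ou.gaussian_U(3)[OF uUt])
    show "\<rho> 0 t (\<lambda>_. undefined) = (LINT z|std_gaussian N. u t z)"
      using rc[OF t, of "\<lambda>_. 1" 0] ou.gaussian_U(2)[OF uUt, of "\<lambda>_. 1"] by (simp add: density_coef_0)
    fix n :: nat assume n: "1 \<le> n"
    show "integrable (std_gaussian N) (partials (map j [1..<n+1]) (u t))" if "j \<in> multi_idx N n" for j
      by (rule ou.gaussian_partials_coef(1)[OF uUt that])
    fix x assume x: "x \<in> closed_cube n"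
    have "tensor_proj \<xi> N n (\<rho> n t) x = (\<Sum>j\<in>multi_idx N n. ou.coef n j t * tensor \<xi> n j x)"
      by (rule tproj[OF t])
    also have "\<dots> = (\<Sum>j\<in>multi_idx N n. 1 / fact n * ((LINT z|std_gaussian N. partials (map j [1..<n+1]) (u t) z)
                 * (\<Prod>i=1..n. \<xi> (j i) (x i))))"
    proof (rule sum.cong[OF refl])
      fix j assume j: "j \<in> multi_idx N n"
      show "ou.coef n j t * tensor \<xi> n j x = 1 / fact n * ((LINT z|std_gaussian N. partials (map j [1..<n+1]) (u t) z)
                 * (\<Prod>i=1..n. \<xi> (j i) (x i)))"
        using ou.gaussian_partials_coef(2)[OF uUt j] unfolding tensor_def by simp
    qed
    finally show "tensor_proj \<xi> N n (\<rho> n t) x = 1 / fact n * (\<Sum>j\<in>multi_idx N n.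
       (LINT z|std_gaussian N. partials (map j [1..<n+1]) (u t) z) * (\<Prod>i=1..n. \<xi> (j i) (x i)))"
      unfolding sum_distrib_left[symmetric] .
  qed
qed

end
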